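(* Let $X=\mathbb C/(\mathbb Z+\tau\mathbb Z)$ ($\tau\in\mathbb C$, $\operatorname{Im}\tau>0$) be a compact Riemann surface of genus $1$, and let $L$ be a positive line bundle on $X$ of degree $d>2$. Let $\kappa_{X,d}$ be the Bergman kernel of the line bundle $K_X\otimes L$, let $\omega=\frac{1}{\operatorname{Im}\tau}dz\otimes d\bar z$, let $h_L$ be the canonical Hermitian metric on $L$, which satisfies $c_1(L)=b\omega$ with a constant $b>0$, and let $c_X$ be the logarithmic capacity of $X$. Then for every $p\in X$, $$\pi\bigg(1+\frac{1}{\frac d2-1}\bigg)\,|\kappa_{X,d}(p,p)|_{\omega,h_{L}}\geq c_{X}^{2}(p).$$
   Context: $dA_\omega=\frac{1}{\operatorname{Im}\tau}dx\,dy$ is the area form of the flat metric $\omega$ ($z=x+\sqrt{-1}y$), of total mass $1$. The condition $c_1(L)=b\omega$ means that the curvature form of $h_L$ is a positive constant multiple of the Kähler form of $\omega$. $|\cdot|_{\omega,h_L}$ is the norm on $K_X\otimes L$ induced by $\omega$ on $K_X$ and $h_L$ on $L$. $\kappa_{X,d}(p,p)=\sum_j\sigma_j(p)\otimes\overline{\sigma_j(p)}$, where $\{\sigma_j\}$ is an orthonormal basis of $H^0(X,K_X\otimes L)$ for the norm $\|\sigma\|^2=\int_X|\sigma|^2_{\omega,h_L}\,dA_\omega$; thus $|\kappa_{X,d}(p,p)|_{\omega,h_L}=\sum_j|\sigma_j(p)|^2_{\omega,h_L}$. $G:X\times X\to[-\infty,0)$ denotes the (Arakelov-type) Green function: for each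 fixed $q\in X$, (a) the Laplacian of $G(\cdot,q)$ with respect to $\omega$ is a negative constant on $X\setminus\{q\}$, i.e. $\frac{\sqrt{-1}}{\pi}\partial\bar\partial G(\cdot,q)=[\{q\}]-a\,dA_\omega$ as currents, with a constant $a>0$ such that $\int_X a\,dA_\omega=1$ and $[\{q\}]$ the Dirac mass at $q$; (b) $G(p,q)=\log\mathrm{dist}_\omega(p,q)+O(1)$ as $p\to q$; (c) $G(p,p)=-\infty$. The logarithmic capacity is $c_X(p):=\exp\big(\lim_{q\to p}(G(p,q)-\log\mathrm{dist}_\omega(p,q))\big)$. *)

theory Defs
  imports "HOL-Complex_Analysis.Complex_Analysis" "HOL-Library.Landau_Symbols"
begin

section \<open>The torus and its flat metric\<close>

text \<open>
  Points of \<open>X = \<complex>/(\<int> + \<tau>\<int>)\<close> are cosets. A local object on \<open>X\<close> is holomorphic, smooth, etc.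
  iff its pullback under the covering map \<open>proj \<tau>\<close> is.
\<close>

definition lattice :: "complex \<Rightarrow> complex set" where
  "lattice \<tau> = {of_int m + of_int n * \<tau> | m n :: int. True}"

definition proj :: "complex \<Rightarrow> complex \<Rightarrow> complex set" where
  "proj \<tau> z = (\<lambda>l. z + l) ` lattice \<tau>"

definition torus :: "complex \<Rightarrow> complex set set" where
  "torus \<tau> = range (proj \<tau>)"

definition torus_open :: "complex \<Rightarrow> complex set set \<Rightarrow> bool" where
  "torus_open \<tau> U \<longleftrightarrow> U \<subseteq> torus \<tau> \<and> open (proj \<tau> -` U)"

definition torus_holomorphic_on ::
    "complex \<Rightarrow> (complex set \<Rightarrow> complex) \<Rightarrow> complex set set \<Rightarrow> bool" where
  "torus_holomorphic_on \<tau> f U \<longleftrightarrow> (\<lambda>z. f (proj \<tau> z)) holomorphic_on (proj \<tau> -` U)"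

text \<open>For an open set \<open>S\<close>, \<open>Ck_on k S f\<close> says that \<open>f\<close> is of class \<open>C\<^sup>k\<close> on \<open>S\<close>.\<close>

primrec Ck_on :: "nat \<Rightarrow> complex set \<Rightarrow> (complex \<Rightarrow> real) \<Rightarrow> bool" where
  "Ck_on 0 S f \<longleftrightarrow> continuous_on S f"
| "Ck_on (Suc k) S f \<longleftrightarrow>
     (\<forall>z\<in>S. f differentiable (at z)) \<and>
     Ck_on k S (\<lambda>z. frechet_derivative f (at z) 1) \<and>
     Ck_on k S (\<lambda>z. frechet_derivative f (at z) \<i>)"

definition torus_Ck_on :: "complex \<Rightarrow> nat \<Rightarrow> complex set set \<Rightarrow> (complex set \<Rightarrow> real) \<Rightarrow> bool" where
  "torus_Ck_on \<tau> k U f \<longleftrightarrow> Ck_on k (proj \<tau> -` U) (\<lambda>z. f (proj \<tau> z))"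

definition torus_smooth_on :: "complex \<Rightarrow> complex set set \<Rightarrow> (complex set \<Rightarrow> real) \<Rightarrow> bool" where
  "torus_smooth_on \<tau> U f \<longleftrightarrow> (\<forall>k. torus_Ck_on \<tau> k U f)"

definition laplacian :: "(complex \<Rightarrow> real) \<Rightarrow> complex \<Rightarrow> real" where
  "laplacian f z =
     frechet_derivative (\<lambda>w. frechet_derivative f (at w) 1) (at z) 1 +
     frechet_derivative (\<lambda>w. frechet_derivative f (at w) \<i>) (at z) \<i>"

text \<open>
  The Laplacian of the metric \<open>(dx\<^sup>2 + dy\<^sup>2) / Im \<tau>\<close>. With \<open>dA\<close> the area form
  \<open>dx dy / Im \<tau>\<close> one has \<open>(\<i>/\<pi>) \<partial>\<partial>\<^sup>- u = (1 / (2\<pi>)) (torus_laplacian \<tau> u) dA\<close>, where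
  \<open>\<partial>\<^sup>-\<close> stands for d-bar. The choice of representative of \<open>P\<close> is immaterial by periodicity.
\<close>

definition torus_laplacian :: "complex \<Rightarrow> (complex set \<Rightarrow> real) \<Rightarrow> complex set \<Rightarrow> real" where
  "torus_laplacian \<tau> u P = Im \<tau> * laplacian (\<lambda>w. u (proj \<tau> w)) (SOME z. z \<in> P)"

text \<open>
  The distance of the flat metric: Euclidean distance between cosets, rescaled.
\<close>

definition torus_dist :: "complex \<Rightarrow> complex set \<Rightarrow> complex set \<Rightarrow> real" where
  "torus_dist \<tau> P Q = setdist P Q / sqrt (Im \<tau>)"

definition fund_parallelogram :: "complex \<Rightarrow> complex set" where
  "fund_parallelogram \<tau> =
     {of_real s + of_real t * \<tau> | s t :: real. s \<in> {0..<1} \<and> t \<in> {0..<1}}"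

text \<open>Integration against \<open>dA = dx dy / Im \<tau>\<close>.\<close>

definition torus_integral ::
    "complex \<Rightarrow> (complex set \<Rightarrow> 'a::{banach, second_countable_topology}) \<Rightarrow> 'a" where
  "torus_integral \<tau> f =
     set_lebesgue_integral lborel (fund_parallelogram \<tau>) (\<lambda>z. f (proj \<tau> z)) /\<^sub>R Im \<tau>"


section \<open>Holomorphic line bundles\<close>

text \<open>
  A line bundle is given by an open cover \<open>U\<^sub>i\<close> with holomorphic frames \<open>e\<^sub>i\<close> and transition
  functions \<open>g\<^sub>i\<^sub>j\<close>, with \<open>e\<^sub>j = g\<^sub>i\<^sub>j e\<^sub>i\<close>. A section \<open>s\<close> is given by its coefficients
  in these frames, so that \<open>s\<^sub>i = g\<^sub>i\<^sub>j s\<^sub>j\<close>; a Hermitian metric by the functions \<open>h\<^sub>i = |e\<^sub>i|\<^sup>2\<close>.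
\<close>

record 'i line_bundle =
  bindex :: "'i set"
  bdom :: "'i \<Rightarrow> complex set set"
  btrans :: "'i \<Rightarrow> 'i \<Rightarrow> complex set \<Rightarrow> complex"

definition holomorphic_line_bundle :: "complex \<Rightarrow> 'i line_bundle \<Rightarrow> bool" where
  "holomorphic_line_bundle \<tau> L \<longleftrightarrow>
     (\<forall>i\<in>bindex L. torus_open \<tau> (bdom L i)) \<and>
     (\<Union>i\<in>bindex L. bdom L i) = torus \<tau> \<and>
     (\<forall>i\<in>bindex L. \<forall>j\<in>bindex L.
        torus_holomorphic_on \<tau> (btrans L i j) (bdom L i \<inter> bdom L j) \<and>
        (\<forall>P \<in> bdom L i \<inter> bdom L j. btrans L i j P \<noteq> 0)) \<and>
     (\<forall>i\<in>bindex L. \<forall>P\<in>bdom L i. btrans L i i P = 1) \<and>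
     (\<forall>i\<in>bindex L. \<forall>j\<in>bindex L. \<forall>k\<in>bindex L. \<forall>P \<in> bdom L i \<inter> bdom L j \<inter> bdom L k.
        btrans L i j P * btrans L j k P = btrans L i k P)"

definition hermitian_metric ::
    "complex \<Rightarrow> 'i line_bundle \<Rightarrow> ('i \<Rightarrow> complex set \<Rightarrow> real) \<Rightarrow> bool" where
  "hermitian_metric \<tau> L h \<longleftrightarrow>
     (\<forall>i\<in>bindex L. torus_smooth_on \<tau> (bdom L i) (h i) \<and> (\<forall>P\<in>bdom L i. h i P > 0)) \<and>
     (\<forall>i\<in>bindex L. \<forall>j\<in>bindex L. \<forall>P \<in> bdom L i \<inter> bdom L j.
        h j P = (cmod (btrans L i j P))\<^sup>2 * h i P)"

definition frame_at :: "'i line_bundle \<Rightarrow> complex set \<Rightarrow> 'i" where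
  "frame_at L P = (SOME i. i \<in> bindex L \<and> P \<in> bdom L i)"

text \<open>
  The density with respect to \<open>dA\<close> of the Chern form
  \<open>c\<^sub>1(L,h) = -(\<i>/(2\<pi>)) \<partial>\<partial>\<^sup>- log h\<^sub>i\<close>, which does not depend on the frame.
\<close>

definition c1_density ::
    "complex \<Rightarrow> 'i line_bundle \<Rightarrow> ('i \<Rightarrow> complex set \<Rightarrow> real) \<Rightarrow> complex set \<Rightarrow> real" where
  "c1_density \<tau> L h P = - torus_laplacian \<tau> (\<lambda>Q. ln (h (frame_at L P) Q)) P / (4 * pi)"

definition positive_line_bundle :: "complex \<Rightarrow> 'i line_bundle \<Rightarrow> bool" where
  "positive_line_bundle \<tau> L \<longleftrightarrow>
     (\<exists>h. hermitian_metric \<tau> L h \<and> (\<forall>P\<in>torus \<tau>. c1_density \<tau> L h P > 0))"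

text \<open>The degree is the integral of the Chern form of any Hermitian metric.\<close>

definition has_degree :: "complex \<Rightarrow> 'i line_bundle \<Rightarrow> int \<Rightarrow> bool" where
  "has_degree \<tau> L d \<longleftrightarrow>
     (\<exists>h. hermitian_metric \<tau> L h) \<and>
     (\<forall>h. hermitian_metric \<tau> L h \<longrightarrow> torus_integral \<tau> (c1_density \<tau> L h) = of_int d)"

text \<open>
  The coordinate changes of \<open>X\<close> are translations, with derivative \<open>1\<close>, so \<open>dz\<close> is a global
  holomorphic frame of \<open>K\<^sub>X\<close>. Its squared norm under \<open>\<omega> = dz \<otimes> d\<zeta> / Im \<tau>\<close>, with \<open>\<zeta>\<close> the
  conjugate of \<open>z\<close>, is \<open>Im \<tau>\<close>.
\<close>

definition canonical_bundle :: "complex \<Rightarrow> unit line_bundle" where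
  "canonical_bundle \<tau> =
     \<lparr>bindex = {()}, bdom = (\<lambda>_. torus \<tau>), btrans = (\<lambda>_ _ _. 1)\<rparr>"

definition canonical_bundle_metric :: "complex \<Rightarrow> unit \<Rightarrow> complex set \<Rightarrow> real" where
  "canonical_bundle_metric \<tau> = (\<lambda>_ _. Im \<tau>)"

definition tensor_bundle :: "'i line_bundle \<Rightarrow> 'j line_bundle \<Rightarrow> ('i \<times> 'j) line_bundle" where
  "tensor_bundle L M =
     \<lparr>bindex = bindex L \<times> bindex M,
      bdom = (\<lambda>(i, j). bdom L i \<inter> bdom M j),
      btrans = (\<lambda>(i, j) (i', j') P. btrans L i i' P * btrans M j j' P)\<rparr>"

definition tensor_metric ::
    "('i \<Rightarrow> complex set \<Rightarrow> real) \<Rightarrow> ('j \<Rightarrow> complex set \<Rightarrow> real) \<Rightarrow> ('i \<times> 'j \<Rightarrow> complex set \<Rightarrow> real)"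
  where
  "tensor_metric h k = (\<lambda>(i, j) P. h i P * k j P)"


section \<open>Holomorphic sections and the Bergman kernel\<close>

definition holomorphic_section ::
    "complex \<Rightarrow> 'i line_bundle \<Rightarrow> ('i \<Rightarrow> complex set \<Rightarrow> complex) \<Rightarrow> bool" where
  "holomorphic_section \<tau> L s \<longleftrightarrow>
     (\<forall>i\<in>bindex L. torus_holomorphic_on \<tau> (s i) (bdom L i)) \<and>
     (\<forall>i\<in>bindex L. \<forall>j\<in>bindex L. \<forall>P \<in> bdom L i \<inter> bdom L j. s i P = btrans L i j P * s j P)"

definition section_inner ::
    "complex \<Rightarrow> 'i line_bundle \<Rightarrow> ('i \<Rightarrow> complex set \<Rightarrow> real) \<Rightarrow>
     ('i \<Rightarrow> complex set \<Rightarrow> complex) \<Rightarrow> ('i \<Rightarrow> complex set \<Rightarrow> complex) \<Rightarrow> complex" where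
  "section_inner \<tau> L h s t =
     torus_integral \<tau>
       (\<lambda>P. let i = frame_at L P in of_real (h i P) * s i P * cnj (t i P))"

definition orthonormal_basis ::
    "complex \<Rightarrow> 'i line_bundle \<Rightarrow> ('i \<Rightarrow> complex set \<Rightarrow> real) \<Rightarrow>
     nat \<Rightarrow> (nat \<Rightarrow> 'i \<Rightarrow> complex set \<Rightarrow> complex) \<Rightarrow> bool" where
  "orthonormal_basis \<tau> L h n \<sigma> \<longleftrightarrow>
     (\<forall>k<n. holomorphic_section \<tau> L (\<sigma> k)) \<and>
     (\<forall>k<n. \<forall>l<n. section_inner \<tau> L h (\<sigma> k) (\<sigma> l) = (if k = l then 1 else 0)) \<and>
     (\<forall>s. holomorphic_section \<tau> L s \<longrightarrow>
        (\<exists>a :: nat \<Rightarrow> complex. \<forall>i\<in>bindex L. \<forall>P\<in>bdom L i. s i P = (\<Sum>k<n. a k * \<sigma> k i P)))"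

text \<open>\<open>\<kappa> i j P Q\<close> is the coefficient of \<open>\<kappa>(P,Q)\<close> in the frame \<open>e\<^sub>i(P) \<otimes> cnj (e\<^sub>j(Q))\<close>.\<close>

definition is_bergman_kernel ::
    "complex \<Rightarrow> 'i line_bundle \<Rightarrow> ('i \<Rightarrow> complex set \<Rightarrow> real) \<Rightarrow>
     ('i \<Rightarrow> 'i \<Rightarrow> complex set \<Rightarrow> complex set \<Rightarrow> complex) \<Rightarrow> bool" where
  "is_bergman_kernel \<tau> L h \<kappa> \<longleftrightarrow>
     (\<exists>n \<sigma>. orthonormal_basis \<tau> L h n \<sigma> \<and>
        \<kappa> = (\<lambda>i j P Q. \<Sum>k<n. \<sigma> k i P * cnj (\<sigma> k j Q)))"

definition kernel_norm ::
    "'i line_bundle \<Rightarrow> ('i \<Rightarrow> complex set \<Rightarrow> real) \<Rightarrow>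
     ('i \<Rightarrow> 'i \<Rightarrow> complex set \<Rightarrow> complex set \<Rightarrow> complex) \<Rightarrow> complex set \<Rightarrow> real" where
  "kernel_norm L h \<kappa> P = (let i = frame_at L P in h i P * cmod (\<kappa> i i P P))"


section \<open>Green function and logarithmic capacity\<close>

text \<open>
  The current equation is tested against smooth \<open>\<phi>\<close>; by the formula above
  \<open>(\<i>/\<pi>) \<partial>\<partial>\<^sup>- \<phi>\<close> has density \<open>torus_laplacian \<tau> \<phi> / (2 * pi)\<close>. The asymptotic condition at
  \<open>q = proj \<tau> z\<close> is read in the coordinate \<open>w\<close> near \<open>z\<close>. No normalization of the additive
  constant beyond \<open>G < 0\<close> is imposed, and no symmetry.
\<close>

definition green_function :: "complex \<Rightarrow> (complex set \<Rightarrow> complex set \<Rightarrow> ereal) \<Rightarrow> bool" where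
  "green_function \<tau> G \<longleftrightarrow>
     (\<forall>P\<in>torus \<tau>. \<forall>Q\<in>torus \<tau>. G P Q < 0 \<and> (G P Q = -\<infinity> \<longleftrightarrow> P = Q)) \<and>
     (\<exists>a>0. torus_integral \<tau> (\<lambda>_. a) = 1 \<and>
       (\<forall>Q\<in>torus \<tau>.
         torus_Ck_on \<tau> 2 (torus \<tau> - {Q}) (\<lambda>P. real_of_ereal (G P Q)) \<and>
         (\<forall>P \<in> torus \<tau> - {Q}.
            torus_laplacian \<tau> (\<lambda>P. real_of_ereal (G P Q)) P / (2 * pi) = - a) \<and>
         (\<forall>\<phi>. torus_smooth_on \<tau> (torus \<tau>) \<phi> \<longrightarrow>
            torus_integral \<tau> (\<lambda>P. real_of_ereal (G P Q) * (torus_laplacian \<tau> \<phi> P / (2 * pi)))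
              = \<phi> Q - torus_integral \<tau> (\<lambda>P. a * \<phi> P)))) \<and>
     (\<forall>z. (\<lambda>w. real_of_ereal (G (proj \<tau> w) (proj \<tau> z))
                 - ln (torus_dist \<tau> (proj \<tau> w) (proj \<tau> z))) \<in> O[at z](\<lambda>_. 1))"

text \<open>
  \<open>c P = exp (lim (G P Q - ln (dist P Q)))\<close> as \<open>Q \<rightarrow> P\<close>, with \<open>P = proj \<tau> z\<close>, \<open>Q = proj \<tau> w\<close>;
  this includes the existence of the limit, without which the capacity is not defined.
\<close>

definition is_log_capacity ::
    "complex \<Rightarrow> (complex set \<Rightarrow> complex set \<Rightarrow> ereal) \<Rightarrow> (complex set \<Rightarrow> real) \<Rightarrow> bool" where
  "is_log_capacity \<tau> G c \<longleftrightarrow>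
     (\<forall>z. \<exists>l. ((\<lambda>w. real_of_ereal (G (proj \<tau> z) (proj \<tau> w))
                    - ln (torus_dist \<tau> (proj \<tau> z) (proj \<tau> w))) \<longlongrightarrow> l) (at z) \<and>
             c (proj \<tau> z) = exp l)"

end

theory Submission
  imports Defs "HOL-Probability.Distributions"
begin

text \<open>
  Both sides are computed on the universal cover, where they become statements about theta series,
  and the inequality turns out to hold with room to spare.

  \<^bold>\<open>Reduction of the lattice.\<close> Let \<open>w\<^sub>1\<close> be a shortest nonzero lattice vector and \<open>w\<^sub>1 \<tau>'\<close> a
  second basis vector with \<open>\<bar>Re \<tau>'\<bar> \<le> 1/2\<close>. Then \<open>T = Im \<tau>' \<ge> \<surd>3/2\<close>
  (\<open>reduced_basis_exists\<close>), so the theta series of \<open>\<tau>'\<close> are dominated by one or two terms. All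
  quantities of the theorem are invariant under the rescaling \<open>z = w\<^sub>1 \<zeta>\<close>.

  \<^bold>\<open>Upper bound of the capacity.\<close> Let \<open>\<theta>\<close> be the odd theta series of \<open>\<tau>'\<close> and
  \<open>N(z) = \<bar>\<theta>(\<zeta>)\<bar> exp (- \<pi> (Im \<zeta>)\<^sup>2 / T)\<close>, which is a function on the torus. Off the pole
  \<open>q\<close>, the function \<open>log N(z - q) - G(z, q)\<close> is locally \<open>log \<bar>F\<bar>\<close> with \<open>F\<close> holomorphic, and it is
  bounded above at \<open>q\<close>. The maximum principle makes it constant (\<open>periodic_modulus_constant\<close>); since
  \<open>G < 0\<close>, the constant is at least \<open>log N(z\<^sub>0)\<close> for every \<open>z\<^sub>0\<close>. Letting \<open>q\<close> tend to \<open>p\<close> gives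
  \<open>c\<^sub>X(p) \<le> \<surd>T \<bar>\<theta>'(0)\<bar> / N(z\<^sub>0)\<close> (\<open>log_capacity_bound\<close>). At the half period
  \<open>\<zeta> = (1 + \<tau>') / 2\<close> this is \<open>c\<^sub>X\<^sup>2 \<le> 4 \<pi>\<^sup>2 T exp (- \<pi> T / 2)\<close> up to a factor close to 1.

  \<^bold>\<open>Lower bound of the Bergman kernel.\<close> By the extremal property of the kernel
  (\<open>bergman_kernel_extremal\<close>) it is enough to exhibit one section that is large at \<open>p\<close> compared
  with its norm. Integrating the curvature gives \<open>b = d\<close>. As the curvature is constant, the pullback
  of \<open>L\<close> to the plane has a holomorphic frame \<open>e\<close> with \<open>\<bar>e\<bar>\<^sup>2 = exp (- \<pi> d \<bar>z\<bar>\<^sup>2 / Im \<tau>)\<close>: locally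
  because a harmonic function is the real part of a holomorphic one, and globally because two such
  frames on a connected set differ by a unimodular constant, so that frames on overlapping rectangles
  can be glued (\<open>flat_frame_global\<close>). Lattice translations act on \<open>e\<close> by explicit multipliers,
  and theta series with characteristics transform by the inverse multipliers, so they define sections
  of \<open>L\<close> (\<open>theta_section_exists\<close>). One of the \<open>d\<close> admissible characteristics puts the maximum of the
  leading Gaussian within \<open>1 / (2 d)\<close> of \<open>p\<close>, measured in the direction of \<open>\<tau>'\<close>. The norm of the
  section is bounded by unfolding the integral of a squared sum of Gaussians. The outcome is
  \<open>\<kappa>(p) \<ge> \<surd>(2 d T) exp (- \<pi> T / (2 d))\<close>, again up to a factor close to 1.

  \<^bold>\<open>Comparison.\<close> It remains to check
  \<open>4 \<pi> T (d - 2) / d \<le> \<surd>(2 d T) exp (\<pi> T / 2 - \<pi> T / (2 d))\<close> with some margin for \<open>T \<ge> \<surd>3/2\<close>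
  and \<open>d \<ge> 3\<close> (\<open>capacity_versus_kernel_numerics\<close>). The tightest cases are the hexagonal lattice with
  \<open>d = 4\<close> and \<open>d = 5\<close>, where the two sides differ by a factor of about \<open>1.3\<close>.
\<close>

section \<open>Harmonic functions as real parts of holomorphic functions\<close>

lemma directional_derivative:
  fixes f :: "complex \<Rightarrow> real"
  assumes "f differentiable at (z + of_real t * v)"
  shows "((\<lambda>t. f (z + of_real t * v)) has_real_derivative
           frechet_derivative f (at (z + of_real t * v)) v) (at t)"
proof -
  let ?D = "frechet_derivative f (at (z + of_real t * v))"
  have D: "(f has_derivative ?D) (at (z + of_real t * v))"
    using assms frechet_derivative_works by blast
  have lin: "linear ?D" using assms by (rule linear_frechet_derivative)
  have g: "((\<lambda>t. z + of_real t * v) has_derivative (\<lambda>h. of_real h * v)) (at t)"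
    by (auto intro!: derivative_eq_intros)
  have "((\<lambda>t. f (z + of_real t * v)) has_derivative (\<lambda>h. ?D (of_real h * v))) (at t)"
    using has_derivative_compose[OF g D] .
  moreover have "(\<lambda>h. ?D (of_real h * v)) = (\<lambda>h. ?D v * h)"
    using linear_scale[OF lin] by (auto simp: scaleR_conv_of_real[symmetric])
  ultimately show ?thesis by (simp add: has_field_derivative_def)
qed

text \<open>
  The second difference over the square spanned by \<open>v\<close> and \<open>w\<close> is symmetric in the two directions.
  Writing it as a mixed derivative by two applications of the mean value theorem, once in either
  order, is what proves that mixed derivatives commute.
\<close>

lemma second_difference_mvt:
  fixes f :: "complex \<Rightarrow> real"
  assumes h: "h > 0"
    and d1: "\<And>s t. s \<in> {0..h} \<Longrightarrow> t \<in> {0..h} \<Longrightarrow> f differentiable at (z + of_real s * v + of_real t * w)"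
    and d2: "\<And>s t. s \<in> {0..h} \<Longrightarrow> t \<in> {0..h} \<Longrightarrow>
              (\<lambda>x. frechet_derivative f (at x) v) differentiable at (z + of_real s * v + of_real t * w)"
  obtains s t where "s \<in> {0..h}" "t \<in> {0..h}"
    "f (z + of_real h * v + of_real h * w) - f (z + of_real h * v) - f (z + of_real h * w) + f z =
     h * (h * frechet_derivative (\<lambda>x. frechet_derivative f (at x) v) (at (z + of_real s * v + of_real t * w)) w)"
proof -
  let ?g = "\<lambda>x. frechet_derivative f (at x) v"
  define \<phi> where "\<phi> s = f ((z + of_real h * w) + of_real s * v) - f (z + of_real s * v)" for s :: real
  have "(\<phi> has_real_derivative ?g ((z + of_real h * w) + of_real s * v) - ?g (z + of_real s * v)) (at s)"
    if "s \<in> {0..h}" for s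
    unfolding \<phi>_def using d1[of s h] d1[of s 0] that h
    by (intro DERIV_diff directional_derivative) (auto simp: algebra_simps)
  then obtain s where s: "0 < s" "s < h"
      "\<phi> h - \<phi> 0 = h * (?g ((z + of_real h * w) + of_real s * v) - ?g (z + of_real s * v))"
    using MVT2[OF h, of \<phi> "\<lambda>s. ?g ((z + of_real h * w) + of_real s * v) - ?g (z + of_real s * v)"]
    by auto
  have "((\<lambda>t. ?g ((z + of_real s * v) + of_real t * w)) has_real_derivative
         frechet_derivative ?g (at ((z + of_real s * v) + of_real t * w)) w) (at t)"
    if "t \<in> {0..h}" for t
    using d2[of s t] that s by (intro directional_derivative) auto
  then obtain t where t: "0 < t" "t < h"
      "?g ((z + of_real s * v) + of_real h * w) - ?g ((z + of_real s * v) + of_real 0 * w) =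
        h * frechet_derivative ?g (at ((z + of_real s * v) + of_real t * w)) w"
    using MVT2[OF h, of "\<lambda>t. ?g ((z + of_real s * v) + of_real t * w)"
        "\<lambda>t. frechet_derivative ?g (at ((z + of_real s * v) + of_real t * w)) w"]
    by auto
  show ?thesis
  proof (rule that[of s t])
    show "f (z + of_real h * v + of_real h * w) - f (z + of_real h * v) - f (z + of_real h * w) + f z =
     h * (h * frechet_derivative ?g (at (z + of_real s * v + of_real t * w)) w)"
      using s(3) t(3) by (simp add: \<phi>_def algebra_simps)
  qed (use s t in auto)
qed

lemma second_derivatives_commute:
  fixes f :: "complex \<Rightarrow> real"
  assumes C2: "Ck_on 2 S f" and S: "open S" "z \<in> S"
  shows "frechet_derivative (\<lambda>w. frechet_derivative f (at w) 1) (at z) \<i> =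
         frechet_derivative (\<lambda>w. frechet_derivative f (at w) \<i>) (at z) 1"
    (is "?A z = ?B z")
proof -
  have D: "f differentiable at w" "(\<lambda>w. frechet_derivative f (at w) 1) differentiable at w"
      "(\<lambda>w. frechet_derivative f (at w) \<i>) differentiable at w" if "w \<in> S" for w
    using C2 that by (auto simp: numeral_2_eq_2)
  have cont: "continuous_on S ?A" "continuous_on S ?B"
    using C2 by (auto simp: numeral_2_eq_2)
  have "dist (?A z) (?B z) < 2 * e" if e: "e > 0" for e
  proof -
    have ev: "\<forall>\<^sub>F w in nhds z. dist (F w) (F z) < e" if "continuous_on S F" for F :: "complex \<Rightarrow> real"
    proof -
      have "isCont F z" using that S continuous_on_eq_continuous_at by blast
      then have "(F \<longlongrightarrow> F z) (nhds z)" by (simp add: isCont_def tendsto_at_iff_tendsto_nhds)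
      then show ?thesis using e tendstoD by blast
    qed
    have "\<forall>\<^sub>F w in nhds z. dist (?A w) (?A z) < e \<and> dist (?B w) (?B z) < e \<and> w \<in> S"
      using ev[OF cont(1)] ev[OF cont(2)] eventually_nhds_in_open[OF S] by eventually_elim auto
    then obtain d where d: "d > 0"
      and dA: "\<And>w. dist w z < d \<Longrightarrow> dist (?A w) (?A z) < e \<and> dist (?B w) (?B z) < e \<and> w \<in> S"
      by (auto simp: eventually_nhds_metric)
    define h where "h = d / 3"
    have h: "h > 0" using d by (simp add: h_def)
    have near: "dist (z + of_real s * 1 + of_real t * \<i>) z < d" if "s \<in> {0..h}" "t \<in> {0..h}" for s t
    proof -
      have "cmod (of_real s + of_real t * \<i>) \<le> \<bar>s\<bar> + \<bar>t\<bar>"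
        using norm_triangle_ineq[of "of_real s" "of_real t * \<i>"] by (simp add: norm_mult)
      then show ?thesis using that d by (auto simp: h_def dist_norm add.assoc)
    qed
    have near': "dist (z + of_real t * \<i> + of_real s * 1) z < d" if "s \<in> {0..h}" "t \<in> {0..h}" for s t
      using near[OF that] by (simp add: add.assoc add.commute[of "of_real t * \<i>"])
    have inS: "z + of_real s * 1 + of_real t * \<i> \<in> S" "z + of_real t * \<i> + of_real s * 1 \<in> S"
      if "s \<in> {0..h}" "t \<in> {0..h}" for s t
      using dA[OF near[OF that]] dA[OF near'[OF that]] by blast+
    obtain s t where st: "s \<in> {0..h}" "t \<in> {0..h}"
      "f (z + of_real h * 1 + of_real h * \<i>) - f (z + of_real h * 1) - f (z + of_real h * \<i>) + f z =
        h * (h * ?A (z + of_real s * 1 + of_real t * \<i>))"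
      by (rule second_difference_mvt[of h f z 1 \<i>, OF h D(1)[OF inS(1)] D(2)[OF inS(1)]])
         (assumption | rule that, assumption+)+
    obtain s' t' where st': "s' \<in> {0..h}" "t' \<in> {0..h}"
      "f (z + of_real h * \<i> + of_real h * 1) - f (z + of_real h * \<i>) - f (z + of_real h * 1) + f z =
        h * (h * ?B (z + of_real s' * \<i> + of_real t' * 1))"
      by (rule second_difference_mvt[of h f z \<i> 1, OF h D(1)[OF inS(2)] D(3)[OF inS(2)]])
         (assumption | rule that, assumption+)+
    have "h * (h * ?A (z + of_real s * 1 + of_real t * \<i>)) = h * (h * ?B (z + of_real s' * \<i> + of_real t' * 1))"
    proof -
      have "z + of_real h * \<i> + of_real h * 1 = z + of_real h * 1 + of_real h * \<i>" by simp
      then show ?thesis using st(3) st'(3) by (smt (verit))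
    qed
    then have eq: "?A (z + of_real s * 1 + of_real t * \<i>) = ?B (z + of_real s' * \<i> + of_real t' * 1)"
      using h by simp
    have "dist (?A (z + of_real s * 1 + of_real t * \<i>)) (?A z) < e"
      "dist (?B (z + of_real s' * \<i> + of_real t' * 1)) (?B z) < e"
      using dA[OF near[OF st(1,2)]] dA[OF near'[OF st'(2,1)]] by auto
    then show ?thesis using eq by (auto simp: dist_real_def)
  qed
  from this[of "dist (?A z) (?B z) / 4"] show ?thesis
    by (cases "?A z = ?B z") auto
qed

text \<open>
  The Cauchy--Riemann equations for \<open>f\<^sub>x - \<i> f\<^sub>y\<close> are the symmetry of the second derivatives together
  with harmonicity. A primitive of this function on the convex set has real part \<open>f\<close> up to a constant.
\<close>

theorem harmonic_is_Re_holomorphic: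
  fixes f :: "complex \<Rightarrow> real"
  assumes C2: "Ck_on 2 S f" and S: "open S" "convex S"
    and lap: "\<And>z. z \<in> S \<Longrightarrow> laplacian f z = 0"
  obtains F where "F holomorphic_on S" "\<And>z. z \<in> S \<Longrightarrow> f z = Re (F z)"
proof (cases "S = {}")
  case True
  then show ?thesis using that[of "\<lambda>_. 0"] by auto
next
  case False
  then obtain z0 where z0: "z0 \<in> S" by blast
  define fx where "fx w = frechet_derivative f (at w) 1" for w
  define fy where "fy w = frechet_derivative f (at w) \<i>" for w
  have D: "f differentiable at w" "fx differentiable at w" "fy differentiable at w" if "w \<in> S" for w
    using C2 that by (auto simp: numeral_2_eq_2 fx_def[abs_def] fy_def[abs_def])
  define g where "g w = of_real (fx w) - \<i> * of_real (fy w)" for w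
  have "g field_differentiable at z" if z: "z \<in> S" for z
  proof -
    let ?X = "frechet_derivative fx (at z)" and ?Y = "frechet_derivative fy (at z)"
    have X: "(fx has_derivative ?X) (at z)" and Y: "(fy has_derivative ?Y) (at z)"
      using D[OF z] frechet_derivative_works by blast+
    have lin: "linear ?X" "linear ?Y" using D[OF z] by (auto intro: linear_frechet_derivative)
    have expand: "L h = Re h * L 1 + Im h * L \<i>" if "linear L" for L :: "complex \<Rightarrow> real" and h
    proof -
      have "h = Re h *\<^sub>R 1 + Im h *\<^sub>R \<i>" by (simp add: complex_eq_iff)
      then have "L h = L (Re h *\<^sub>R 1 + Im h *\<^sub>R \<i>)" by simp
      also have "\<dots> = Re h * L 1 + Im h * L \<i>"
        using that by (simp add: linear_add linear_scale)
      finally show ?thesis .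
    qed
    have sym: "?X \<i> = ?Y 1"
      using second_derivatives_commute[OF C2 S(1) z] by (simp add: fx_def[abs_def] fy_def[abs_def])
    have har: "?X 1 = - ?Y \<i>"
      using lap[OF z] by (simp add: laplacian_def fx_def[abs_def] fy_def[abs_def])
    have "(g has_derivative (\<lambda>h. of_real (?X h) - \<i> * of_real (?Y h))) (at z)"
      unfolding g_def[abs_def] using X Y by (auto intro!: derivative_eq_intros)
    also have "(\<lambda>h. of_real (?X h) - \<i> * of_real (?Y h)) = (*) (of_real (?X 1) - \<i> * of_real (?Y 1))"
    proof
      fix h show "of_real (?X h) - \<i> * of_real (?Y h) = (of_real (?X 1) - \<i> * of_real (?Y 1)) * h"
        unfolding expand[OF lin(1), of h] expand[OF lin(2), of h] sym har
        by (simp add: complex_eq_iff algebra_simps)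
    qed
    finally show ?thesis by (auto simp: field_differentiable_def has_field_derivative_def)
  qed
  then have "g holomorphic_on S"
    by (simp add: holomorphic_on_def field_differentiable_at_within)
  then obtain F0 where F0: "\<And>x. x \<in> S \<Longrightarrow> (F0 has_field_derivative g x) (at x within S)"
    using holomorphic_convex_primitive'[OF S(2,1)] by blast
  define u where "u w = f w - Re (F0 w)" for w
  have "(u has_derivative (\<lambda>h. 0)) (at x within S)" if x: "x \<in> S" for x
  proof -
    have lin: "linear (frechet_derivative f (at x))" using D[OF x] by (auto intro: linear_frechet_derivative)
    have 1: "(f has_derivative frechet_derivative f (at x)) (at x within S)"
      using D(1)[OF x] frechet_derivative_works has_derivative_at_withinI by blast
    have 2: "((\<lambda>w. Re (F0 w)) has_derivative (\<lambda>h. Re (g x * h))) (at x within S)"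
      using F0[OF x] bounded_linear.has_derivative[OF bounded_linear_Re]
      unfolding has_field_derivative_def by blast
    have "frechet_derivative f (at x) h = Re (g x * h)" for h
    proof -
      have "h = Re h *\<^sub>R 1 + Im h *\<^sub>R \<i>" by (simp add: complex_eq_iff)
      then have "frechet_derivative f (at x) h = frechet_derivative f (at x) (Re h *\<^sub>R 1 + Im h *\<^sub>R \<i>)" by simp
      also have "\<dots> = Re h * fx x + Im h * fy x"
        using lin by (simp add: linear_add linear_scale fx_def fy_def)
      also have "\<dots> = Re (g x * h)" by (simp add: g_def algebra_simps)
      finally show ?thesis .
    qed
    then show ?thesis unfolding u_def[abs_def] using has_derivative_diff[OF 1 2] by simp
  qed
  then have c: "u x = u z0" if "x \<in> S" for x
    using has_derivative_zero_constant[OF S(2)] z0 that by metis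
  show ?thesis
  proof (rule that[of "\<lambda>w. F0 w + of_real (u z0)"])
    have "F0 holomorphic_on S"
      using F0 by (auto simp: holomorphic_on_def field_differentiable_def)
    then show "(\<lambda>w. F0 w + of_real (u z0)) holomorphic_on S" by (intro holomorphic_intros)
    show "f z = Re (F0 z + of_real (u z0))" if "z \<in> S" for z
      using c[OF that] by (simp add: u_def)
  qed
qed

section \<open>Calculus of C^k functions\<close>

lemma has_derivative_frechet: "(f has_derivative D) (at x) \<Longrightarrow> frechet_derivative f (at x) = D"
  using frechet_derivative_at by metis

lemma Ck_on_cong:
  assumes "open S" "\<And>z. z \<in> S \<Longrightarrow> f z = g z" "Ck_on k S f"
  shows "Ck_on k S g"
  using assms
proof (induction k arbitrary: f g)
  case 0
  then show ?case by (simp cong: continuous_on_cong)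
next
  case (Suc k)
  have D: "(g has_derivative frechet_derivative f (at z)) (at z)" if "z \<in> S" for z
    using Suc.prems that frechet_derivative_works[of f "at z"]
    by (auto intro: has_derivative_transform_within_open[of f _ z UNIV S])
  have eq: "frechet_derivative f (at z) = frechet_derivative g (at z)" if "z \<in> S" for z
    using has_derivative_frechet[OF D[OF that]] by simp
  have "Ck_on k S (\<lambda>z. frechet_derivative g (at z) v)" if "v \<in> {1, \<i>}" for v
    by (rule Suc.IH[of "\<lambda>z. frechet_derivative f (at z) v"]) (use Suc.prems eq that in auto)
  then show ?case using D by (auto simp: differentiable_def)
qed

text \<open>
  The iterated derivatives in the definition of \<open>Ck_on\<close> are Hilbert choices. This rule lets an
  explicitly known derivative take their place.
\<close>

lemma Ck_on_SucI:
  assumes S: "open S" and D: "\<And>z. z \<in> S \<Longrightarrow> (f has_derivative D z) (at z)"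
    and "Ck_on k S (\<lambda>z. D z 1)" "Ck_on k S (\<lambda>z. D z \<i>)"
  shows "Ck_on (Suc k) S f"
proof -
  have "Ck_on k S (\<lambda>z. frechet_derivative f (at z) v)" if "Ck_on k S (\<lambda>z. D z v)" for v
    by (rule Ck_on_cong[OF S _ that]) (simp add: has_derivative_frechet[OF D])
  then show ?thesis using assms by (auto simp: differentiable_def)
qed

lemma Ck_on_SucD:
  assumes "Ck_on (Suc k) S f" "z \<in> S"
  shows "(f has_derivative frechet_derivative f (at z)) (at z)"
  using assms frechet_derivative_works by auto

lemma Ck_on_Suc_imp: "Ck_on (Suc k) S f \<Longrightarrow> Ck_on k S f"
proof (induction k arbitrary: f)
  case 0
  then show ?case
    by (auto simp: differentiable_imp_continuous_within intro!: continuous_at_imp_continuous_on)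
next
  case (Suc k)
  then show ?case by (metis Ck_on.simps(2))
qed

lemma Ck_on_subset: "Ck_on k S f \<Longrightarrow> A \<subseteq> S \<Longrightarrow> Ck_on k A f"
  by (induction k arbitrary: f) (auto intro: continuous_on_subset)

lemma Ck_on_const: "open S \<Longrightarrow> Ck_on k S (\<lambda>_. c)"
  by (induction k arbitrary: c) simp_all

lemma Ck_on_add: "open S \<Longrightarrow> Ck_on k S f \<Longrightarrow> Ck_on k S g \<Longrightarrow> Ck_on k S (\<lambda>z. f z + g z)"
proof (induction k arbitrary: f g)
  case 0
  then show ?case by (auto intro: continuous_intros)
next
  case (Suc k)
  show ?case
    by (rule Ck_on_SucI[OF Suc.prems(1) has_derivative_add[OF Ck_on_SucD[OF Suc.prems(2)] Ck_on_SucD[OF Suc.prems(3)]]])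
       (use Suc in auto)
qed

lemma Ck_on_mult: "open S \<Longrightarrow> Ck_on k S f \<Longrightarrow> Ck_on k S g \<Longrightarrow> Ck_on k S (\<lambda>z. f z * g z)"
proof (induction k arbitrary: f g)
  case 0
  then show ?case by (auto intro: continuous_intros)
next
  case (Suc k)
  note fg = Ck_on_Suc_imp[OF Suc.prems(2)] Ck_on_Suc_imp[OF Suc.prems(3)]
  show ?case
    by (rule Ck_on_SucI[OF Suc.prems(1) has_derivative_mult[OF Ck_on_SucD[OF Suc.prems(2)] Ck_on_SucD[OF Suc.prems(3)]]])
       (use Suc fg in \<open>auto intro!: Ck_on_add\<close>)
qed

lemma Ck_on_inverse:
  assumes S: "open S" and nz: "\<And>z. z \<in> S \<Longrightarrow> f z \<noteq> 0"
  shows "Ck_on k S f \<Longrightarrow> Ck_on k S (\<lambda>z. inverse (f z))"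
proof (induction k)
  case 0
  then show ?case using nz by (auto intro!: continuous_intros)
next
  case (Suc k)
  have D: "((\<lambda>z. inverse (f z)) has_derivative (\<lambda>h. - 1 * (inverse (f z) * frechet_derivative f (at z) h * inverse (f z)))) (at z)"
    if "z \<in> S" for z
    using Deriv.has_derivative_inverse[OF nz[OF that] Ck_on_SucD[OF Suc.prems that]] by simp
  note IH = Suc.IH[OF Ck_on_Suc_imp[OF Suc.prems]]
  have "Ck_on k S (\<lambda>z. - 1 * (inverse (f z) * frechet_derivative f (at z) v * inverse (f z)))" if "v \<in> {1, \<i>}" for v
    by (intro Ck_on_mult Ck_on_const S IH) (use Suc.prems that in auto)
  then show ?case by (intro Ck_on_SucI[OF S D]) blast+
qed

lemma Ck_on_ln:
  assumes S: "open S" and pos: "\<And>z. z \<in> S \<Longrightarrow> f z > 0" and f: "Ck_on k S f"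
  shows "Ck_on k S (\<lambda>z. ln (f z))"
proof (cases k)
  case 0
  then show ?thesis using f pos by (force intro!: continuous_intros)
next
  case (Suc j)
  have D: "((\<lambda>z. ln (f z)) has_derivative (\<lambda>h. frechet_derivative f (at z) h * inverse (f z))) (at z)"
    if "z \<in> S" for z
    using has_derivative_ln[OF pos[OF that] Ck_on_SucD[OF f[unfolded Suc] that]] .
  have "Ck_on j S (\<lambda>z. inverse (f z))"
    using Ck_on_inverse[OF S _ Ck_on_Suc_imp[OF f[unfolded Suc]]] pos by force
  then show ?thesis unfolding Suc
    by (intro Ck_on_SucI[OF S D]) (use f Suc in \<open>auto intro!: Ck_on_mult S\<close>)
qed

lemma Ck_on_Re_holomorphic:
  assumes S: "open S" and F: "F holomorphic_on S"
  shows "Ck_on k S (\<lambda>z. Re (F z))"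
  using F
proof (induction k arbitrary: F)
  case 0
  then show ?case by (auto intro!: continuous_intros holomorphic_on_imp_continuous_on)
next
  case (Suc k)
  have D: "((\<lambda>z. Re (F z)) has_derivative (\<lambda>h. Re (deriv F z * h))) (at z)" if "z \<in> S" for z
    using holomorphic_derivI[OF Suc.prems S that] bounded_linear.has_derivative[OF bounded_linear_Re]
    unfolding has_field_derivative_def by blast
  have "Ck_on k S (\<lambda>z. Re (deriv F z))" "Ck_on k S (\<lambda>z. Re (deriv F z * \<i>))"
    by (intro Suc.IH holomorphic_intros Suc.prems S)+
  then show ?case by (intro Ck_on_SucI[OF S D]) simp_all
qed

lemma laplacian_cong:
  assumes S: "open S" "z \<in> S" and eq: "\<And>w. w \<in> S \<Longrightarrow> f w = g w" and f: "Ck_on 2 S f"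
  shows "laplacian f z = laplacian g z"
proof -
  have f': "Ck_on (Suc 0) S (\<lambda>w. frechet_derivative f (at w) v)" if "v \<in> {1, \<i>}" for v
    using f that by (auto simp: numeral_2_eq_2)
  have eq': "frechet_derivative f (at w) = frechet_derivative g (at w)" if "w \<in> S" for w
    using f that S eq frechet_derivative_transform_within_open[of f w S g] by (auto simp: numeral_2_eq_2)
  have "frechet_derivative (\<lambda>w. frechet_derivative f (at w) v) (at z) =
        frechet_derivative (\<lambda>w. frechet_derivative g (at w) v) (at z)" if "v \<in> {1, \<i>}" for v
    by (rule frechet_derivative_transform_within_open[of _ z S]) (use f'[OF that] S eq' in auto)
  then show ?thesis by (simp add: laplacian_def)
qed

text \<open>
  The counterpart of \<open>Ck_on_SucI\<close> for the Laplacian: any derivative that is known on a neighbourhood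
  may be used to compute it.
\<close>

lemma laplacian_of_derivatives:
  assumes S: "open S" "z \<in> S"
    and D: "\<And>w. w \<in> S \<Longrightarrow> (f has_derivative D w) (at w)"
    and X: "((\<lambda>w. D w 1) has_derivative X) (at z)" and Y: "((\<lambda>w. D w \<i>) has_derivative Y) (at z)"
  shows "laplacian f z = X 1 + Y \<i>"
proof -
  have "((\<lambda>w. frechet_derivative f (at w) 1) has_derivative X) (at z)"
    by (rule has_derivative_transform_within_open[OF X S]) (simp add: has_derivative_frechet[OF D])
  moreover have "((\<lambda>w. frechet_derivative f (at w) \<i>) has_derivative Y) (at z)"
    by (rule has_derivative_transform_within_open[OF Y S]) (simp add: has_derivative_frechet[OF D])
  ultimately show ?thesis by (simp add: laplacian_def has_derivative_frechet)
qed

lemma laplacian_add: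
  assumes S: "open S" "z \<in> S" and f: "Ck_on 2 S f" and g: "Ck_on 2 S g"
  shows "laplacian (\<lambda>w. f w + g w) z = laplacian f z + laplacian g z"
proof -
  let ?f = "\<lambda>w. frechet_derivative f (at w)" and ?g = "\<lambda>w. frechet_derivative g (at w)"
  have D: "((\<lambda>w. f w + g w) has_derivative (\<lambda>h. ?f w h + ?g w h)) (at w)" if "w \<in> S" for w
    using f g that by (intro has_derivative_add Ck_on_SucD[where k = 1 and S = S]) (auto simp: numeral_2_eq_2)
  have "((\<lambda>w. ?f w v + ?g w v) has_derivative
      (\<lambda>h. frechet_derivative (\<lambda>w. ?f w v) (at z) h + frechet_derivative (\<lambda>w. ?g w v) (at z) h)) (at z)"
    if "v \<in> {1, \<i>}" for v
    using f g that S by (intro has_derivative_add Ck_on_SucD[where k = 0 and S = S]) (auto simp: numeral_2_eq_2)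
  from laplacian_of_derivatives[OF S D this this] show ?thesis by (simp add: laplacian_def)
qed

lemma laplacian_Re_holomorphic:
  assumes S: "open S" "z \<in> S" and F: "F holomorphic_on S"
  shows "laplacian (\<lambda>w. Re (F w)) z = 0"
proof -
  have R: "((\<lambda>w. Re (G w)) has_derivative (\<lambda>h. Re (deriv G w * h))) (at w)"
    if "G holomorphic_on S" "w \<in> S" for G w
    using holomorphic_derivI[OF that(1) S(1) that(2)] bounded_linear.has_derivative[OF bounded_linear_Re]
    unfolding has_field_derivative_def by blast
  have F': "deriv F holomorphic_on S" by (intro holomorphic_intros F S)
  have 1: "((\<lambda>w. Re (deriv F w * 1)) has_derivative (\<lambda>h. Re (deriv (deriv F) z * h))) (at z)"
    using R[OF F' S(2)] by simp
  have "deriv (\<lambda>w. deriv F w * \<i>) z = deriv (deriv F) z * \<i>"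
    using holomorphic_derivI[OF F' S] by (auto intro!: DERIV_imp_deriv derivative_eq_intros)
  moreover have "(\<lambda>w. deriv F w * \<i>) holomorphic_on S" by (intro holomorphic_intros F' S)
  ultimately have 2: "((\<lambda>w. Re (deriv F w * \<i>)) has_derivative (\<lambda>h. Re (deriv (deriv F) z * \<i> * h))) (at z)"
    using R[OF _ S(2), of "\<lambda>w. deriv F w * \<i>"] by simp
  show ?thesis using laplacian_of_derivatives[OF S R[OF F] 1 2] by simp
qed

lemma Ck_on_norm_squared: "open S \<Longrightarrow> Ck_on k S (\<lambda>z. c * (cmod (z - q))\<^sup>2)"
proof -
  assume S: "open S"
  have re: "Ck_on k S (\<lambda>z. Re (z - q))" and im: "Ck_on k S (\<lambda>z. Re (- \<i> * (z - q)))"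
    by (intro Ck_on_Re_holomorphic S holomorphic_intros)+
  have "Ck_on k S (\<lambda>z. c * (Re (z - q) * Re (z - q) + Re (- \<i> * (z - q)) * Re (- \<i> * (z - q))))"
    by (intro Ck_on_add Ck_on_mult Ck_on_const re im S)
  then show ?thesis
    by (rule Ck_on_cong[OF S, rotated]) (simp only: cmod_power2, simp add: power2_eq_square)
qed

lemma laplacian_norm_squared: "laplacian (\<lambda>z. c * (cmod (z - q))\<^sup>2) z = 4 * c"
proof -
  have D: "((\<lambda>w. c * (cmod (w - q))\<^sup>2) has_derivative (\<lambda>h. 2 * c * (Re (w - q) * Re h + Im (w - q) * Im h))) (at w)" for w
    unfolding cmod_power2
    by (auto intro!: derivative_eq_intros simp: algebra_simps)
  have "((\<lambda>w. 2 * c * (Re (w - q) * Re 1 + Im (w - q) * Im 1)) has_derivative (\<lambda>h. 2 * c * Re h)) (at z)"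
    "((\<lambda>w. 2 * c * (Re (w - q) * Re \<i> + Im (w - q) * Im \<i>)) has_derivative (\<lambda>h. 2 * c * Im h)) (at z)"
    by (auto intro!: derivative_eq_intros)
  from laplacian_of_derivatives[OF open_UNIV UNIV_I D this] show ?thesis by simp
qed

section \<open>Theta series with characteristics\<close>

lemma int_has_sumI:
  fixes f :: "int \<Rightarrow> 'a::{real_normed_vector}"
  assumes "((\<lambda>n. f (int n)) has_sum a) UNIV" "((\<lambda>n. f (- int n - 1)) has_sum b) UNIV"
  shows "(f has_sum (a + b)) UNIV"
proof -
  have 1: "(f has_sum a) (range int)"
    using has_sum_reindex[of int UNIV f a] assms(1) by (simp add: o_def)
  have "inj (\<lambda>n. - int n - 1)" by (auto intro: injI)
  then have 2: "(f has_sum b) (range (\<lambda>n. - int n - 1))"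
    using has_sum_reindex[of "\<lambda>n. - int n - 1" UNIV f b] assms(2) by (simp add: o_def)
  have "m \<in> range int \<union> range (\<lambda>n. - int n - 1)" for m :: int
  proof (cases "m \<ge> 0")
    case True
    then have "m = int (nat m)" by simp
    then show ?thesis by blast
  next
    case False
    then have "m = - int (nat (- m - 1)) - 1" by simp
    then show ?thesis by blast
  qed
  then have U: "range int \<union> range (\<lambda>n. - int n - 1) = UNIV" by blast
  have "range int \<inter> range (\<lambda>n. - int n - 1) = {}" by auto
  from has_sum_Un_disjoint[OF 1 2 this] show ?thesis by (simp add: U)
qed

lemma geometric_has_sum:
  fixes x :: real
  assumes "0 \<le> x" "x < 1"
  shows "((\<lambda>n. x ^ n) has_sum (1 / (1 - x))) UNIV"
  by (rule norm_summable_imp_has_sum)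
     (use assms geometric_sums[of x] in \<open>auto simp: power_abs summable_geometric\<close>)

lemma int_geometric_has_sum:
  fixes x :: real
  assumes "0 \<le> x" "x < 1"
  shows "((\<lambda>m::int. x ^ nat \<bar>m\<bar>) has_sum ((1 + x) / (1 - x))) UNIV"
proof -
  have "((\<lambda>n. x ^ nat \<bar>- int n - 1\<bar>) has_sum (x * (1 / (1 - x)))) UNIV"
  proof -
    have "x ^ nat \<bar>- int n - 1\<bar> = x * x ^ n" for n
      by (simp add: nat_add_distrib flip: power_Suc)
    then show ?thesis using has_sum_cmult_right[OF geometric_has_sum[OF assms]] by simp
  qed
  moreover have "((\<lambda>n. x ^ nat \<bar>int n\<bar>) has_sum (1 / (1 - x))) UNIV"
    using geometric_has_sum[OF assms] by simp
  ultimately show ?thesis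
    using int_has_sumI[of "\<lambda>m. x ^ nat \<bar>m\<bar>" "1 / (1 - x)" "x * (1 / (1 - x))"]
    by (simp add: add_divide_distrib)
qed

lemma int_geometric_punctured_has_sum:
  fixes x :: real
  assumes "0 \<le> x" "x < 1"
  shows "((\<lambda>m::int. x ^ nat \<bar>m\<bar>) has_sum (2 * x / (1 - x))) (UNIV - {0})"
proof -
  have "((\<lambda>m::int. x ^ nat \<bar>m\<bar>) has_sum ((1 + x) / (1 - x) - 1)) (UNIV - {0})"
    using has_sum_Diff[OF int_geometric_has_sum[OF assms], of "{0}" 1]
      has_sum_finite[of "{0}" "\<lambda>m::int. x ^ nat \<bar>m\<bar>"] by simp
  moreover have "(1 + x) / (1 - x) - 1 = 2 * x / (1 - x)"
    using assms by (simp add: field_simps)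
  ultimately show ?thesis by simp
qed

lemma norm_infsum_minus_term_0_le:
  fixes f :: "int \<Rightarrow> complex"
  assumes x: "0 \<le> x" "x < 1"
    and f: "\<And>m. cmod (f m) \<le> C * x ^ nat \<bar>m\<bar>"
  shows "cmod (infsum f UNIV - f 0) \<le> C * (2 * x / (1 - x))"
proof -
  note g = has_sum_cmult_right[OF int_geometric_has_sum[OF x], of C]
  note g' = has_sum_cmult_right[OF int_geometric_punctured_has_sum[OF x], of C]
  have n: "(\<lambda>m. cmod (f m)) summable_on UNIV"
    by (rule summable_on_comparison_test[OF has_sum_imp_summable[OF g]]) (use f in auto)
  then have s: "f summable_on UNIV" by (rule abs_summable_summable)
  have n': "(\<lambda>m. cmod (f m)) summable_on (UNIV - {0})"
    using n by (rule summable_on_subset_banach) auto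
  have "infsum f UNIV - f 0 = infsum f (UNIV - {0})"
    using infsum_Diff[OF s, of "{0}"] by simp
  also have "cmod \<dots> \<le> infsum (\<lambda>m. cmod (f m)) (UNIV - {0})" by (rule norm_infsum_bound) (use n' in simp)
  also have "\<dots> \<le> C * (2 * x / (1 - x))"
    using infsum_mono[OF n' has_sum_imp_summable[OF g'] f] infsumI[OF g'] by simp
  finally show ?thesis .
qed

text \<open>
  With \<open>q = exp (\<pi> \<i> \<tau>)\<close> this is the general term of the classical series
  \<open>\<Sum>m. q ^ (d (m + s) ^ 2) exp (2 \<pi> \<i> d (m + s) z + 2 \<pi> \<i> m \<beta>)\<close> of level \<open>d\<close> with real characteristics
  \<open>s\<close> and \<open>\<beta>\<close>. The level is an integer so that translation by \<open>1\<close> multiplies all terms by the same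
  factor.
\<close>

definition theta_term :: "int \<Rightarrow> real \<Rightarrow> real \<Rightarrow> complex \<Rightarrow> int \<Rightarrow> complex \<Rightarrow> complex" where
  "theta_term d s \<beta> \<tau> m z =
     exp (of_real pi * \<i> * of_int d * (\<tau> * (of_int m + of_real s)\<^sup>2 + 2 * (of_int m + of_real s) * z)
          + 2 * of_real pi * \<i> * of_int m * of_real \<beta>)"

definition theta :: "int \<Rightarrow> real \<Rightarrow> real \<Rightarrow> complex \<Rightarrow> complex \<Rightarrow> complex" where
  "theta d s \<beta> \<tau> z = infsum (\<lambda>m. theta_term d s \<beta> \<tau> m z) UNIV"

text \<open>
  The Gaussian weight makes the modulus of the series doubly periodic; this is the pointwise norm of
  the corresponding section.
\<close>

definition theta_norm :: "int \<Rightarrow> real \<Rightarrow> real \<Rightarrow> complex \<Rightarrow> complex \<Rightarrow> real" where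
  "theta_norm d s \<beta> \<tau> z = cmod (theta d s \<beta> \<tau> z) * exp (- pi * of_int d * (Im z)\<^sup>2 / Im \<tau>)"

lemma norm_theta_term:
  "cmod (theta_term d s \<beta> \<tau> m z) =
     exp (- pi * of_int d * (Im \<tau> * (of_int m + s)\<^sup>2 + 2 * (of_int m + s) * Im z))"
proof -
  have "of_int m + of_real s = complex_of_real (of_int m + s)" by simp
  then show ?thesis
    unfolding theta_term_def norm_exp_eq_Re
    by (simp only: of_real_power[symmetric]) (simp add: algebra_simps)
qed

text \<open>
  Completing the square: in the invariant norm the terms are the values at the shifted integers of one
  Gaussian, with centre depending on \<open>z\<close> only through \<open>Im z / Im \<tau>\<close>.
\<close>

lemma norm_theta_term_gauss:
  assumes "Im \<tau> > 0"
  shows "cmod (theta_term d s \<beta> \<tau> m z) * exp (- pi * of_int d * (Im z)\<^sup>2 / Im \<tau>) =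
     exp (- pi * of_int d * Im \<tau> * (of_int m + (s + Im z / Im \<tau>))\<^sup>2)"
  unfolding norm_theta_term exp_add[symmetric] using assms
  by (simp add: power2_eq_square field_simps)

text \<open>
  A majorant that is uniform on horizontal strips. The quadratic exponent dominates
  \<open>\<bar>m\<bar>\<close> up to the constant found by completing the square.
\<close>

lemma norm_theta_term_le:
  assumes "Im \<tau> > 0" "d > 0" "\<bar>Im z\<bar> \<le> R"
  shows "cmod (theta_term d s \<beta> \<tau> m z) \<le>
     exp (pi * of_int d * ((2 * R + 1)\<^sup>2 / (4 * Im \<tau>) + \<bar>s\<bar>)) * exp (- pi * of_int d) ^ nat \<bar>m\<bar>"
proof -
  define T where "T = Im \<tau>"
  define u where "u = of_int m + s"
  have T: "T > 0" using assms by (simp add: T_def)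
  (* This square says T u^2 >= (2 R + 1) |u| - (2 R + 1)^2 / (4 T); of the 2 R + 1 multiples of |u|,
     2 R absorb the term linear in Im z and one is left for convergence. *)
  have "0 \<le> (2 * T * \<bar>u\<bar> - (2 * R + 1))\<^sup>2 / (4 * T)" using T by simp
  also have "\<dots> = T * \<bar>u\<bar>\<^sup>2 - (2 * R + 1) * \<bar>u\<bar> + (2 * R + 1)\<^sup>2 / (4 * T)"
    using T by (simp add: power2_eq_square field_simps)
  finally have 1: "- (T * u\<^sup>2) + 2 * (\<bar>u\<bar> * R) \<le> (2 * R + 1)\<^sup>2 / (4 * T) - \<bar>u\<bar>"
    by (simp add: algebra_simps)
  have "u * Im z \<ge> - (\<bar>u\<bar> * R)"
    using assms(3) mult_mono[of "\<bar>u\<bar>" "\<bar>u\<bar>" "\<bar>Im z\<bar>" R] abs_ge_minus_self[of "u * Im z"]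
    by (simp add: abs_mult)
  moreover have "\<bar>u\<bar> \<ge> of_int \<bar>m\<bar> - \<bar>s\<bar>" by (simp add: u_def)
  moreover have "T * u\<^sup>2 + 2 * u * Im z = T * u\<^sup>2 + 2 * (u * Im z)" by simp
  ultimately have "- (T * u\<^sup>2 + 2 * u * Im z) \<le> (2 * R + 1)\<^sup>2 / (4 * T) + \<bar>s\<bar> - of_int \<bar>m\<bar>"
    using 1 by linarith
  then have "pi * of_int d * - (T * u\<^sup>2 + 2 * u * Im z) \<le>
      pi * of_int d * ((2 * R + 1)\<^sup>2 / (4 * T) + \<bar>s\<bar> - of_int \<bar>m\<bar>)"
    using assms(2) by (intro mult_left_mono) auto
  then have "exp (- pi * of_int d * (T * u\<^sup>2 + 2 * u * Im z)) \<le>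
      exp (pi * of_int d * ((2 * R + 1)\<^sup>2 / (4 * T) + \<bar>s\<bar>) + of_nat (nat \<bar>m\<bar>) * (- pi * of_int d))"
    by (simp add: algebra_simps)
  then show ?thesis
    unfolding norm_theta_term T_def[symmetric] u_def[symmetric] by (simp only: exp_add exp_of_nat_mult)
qed

lemma theta_term_abs_summable:
  assumes "Im \<tau> > 0" "d > 0"
  shows "(\<lambda>m. cmod (theta_term d s \<beta> \<tau> m z)) summable_on UNIV"
proof -
  have x: "0 \<le> exp (- pi * of_int d)" "exp (- pi * of_int d) < 1" using assms by auto
  show ?thesis
    by (rule summable_on_comparison_test[OF has_sum_imp_summable[OF
          has_sum_cmult_right[OF int_geometric_has_sum[OF x]]] norm_theta_term_le[OF assms order_refl]]) auto
qed

text \<open>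
  Differentiation under the sum, by the Weierstrass theorem on uniform limits of holomorphic functions.
\<close>

lemma theta_has_field_derivative:
  assumes "Im \<tau> > 0" "d > 0"
  obtains D where "(theta d s \<beta> \<tau> has_field_derivative D) (at z)"
    "((\<lambda>m. 2 * of_real pi * \<i> * of_int d * (of_int m + of_real s) * theta_term d s \<beta> \<tau> m z) has_sum D) UNIV"
proof -
  have x: "0 \<le> exp (- pi * of_int d)" "exp (- pi * of_int d) < 1" using assms by auto
  let ?C = "exp (pi * of_int d * ((2 * (\<bar>Im z\<bar> + 1) + 1)\<^sup>2 / (4 * Im \<tau>) + \<bar>s\<bar>))"
  let ?t' = "\<lambda>m w. 2 * of_real pi * \<i> * of_int d * (of_int m + of_real s) * theta_term d s \<beta> \<tau> m w"
  have im: "\<bar>Im w\<bar> \<le> \<bar>Im z\<bar> + 1" if "w \<in> cball z 1" for w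
    using that abs_Im_le_cmod[of "z - w"] by (simp add: dist_norm)
  have ul: "uniform_limit (cball z 1) (\<lambda>X w. \<Sum>m\<in>X. theta_term d s \<beta> \<tau> m w) (theta d s \<beta> \<tau>)
      (finite_subsets_at_top UNIV)"
    unfolding theta_def
    by (rule Weierstrass_m_test_general[where M = "\<lambda>m. ?C * exp (- pi * of_int d) ^ nat \<bar>m\<bar>"])
       (rule norm_theta_term_le[OF assms im]
          has_sum_imp_summable[OF has_sum_cmult_right[OF int_geometric_has_sum[OF x]]] | assumption)+
  have der: "((\<lambda>w. theta_term d s \<beta> \<tau> m w) has_field_derivative ?t' m w) (at w)" for m w
    unfolding theta_term_def by (auto intro!: derivative_eq_intros)
  have "\<forall>\<^sub>F X in finite_subsets_at_top UNIV.
      continuous_on (cball z 1) (\<lambda>w. \<Sum>m\<in>X. theta_term d s \<beta> \<tau> m w) \<and>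
      (\<forall>w\<in>ball z 1. ((\<lambda>w. \<Sum>m\<in>X. theta_term d s \<beta> \<tau> m w) has_field_derivative (\<Sum>m\<in>X. ?t' m w)) (at w))"
    by (intro always_eventually allI conjI ballI DERIV_sum der)
       (auto simp: theta_term_def intro!: continuous_intros)
  then obtain g' where g': "\<And>w. w \<in> ball z 1 \<Longrightarrow> (theta d s \<beta> \<tau> has_field_derivative g' w) (at w) \<and>
      ((\<lambda>X. \<Sum>m\<in>X. ?t' m w) \<longlongrightarrow> g' w) (finite_subsets_at_top UNIV)"
    using has_complex_derivative_uniform_limit[OF _ ul, of "\<lambda>X w. \<Sum>m\<in>X. ?t' m w"] by auto
  show ?thesis using g'[of z] by (intro that[of "g' z"]) (auto simp: has_sum_def)
qed

lemma theta_holomorphic: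
  assumes "Im \<tau> > 0" "d > 0"
  shows "theta d s \<beta> \<tau> holomorphic_on S"
  using theta_has_field_derivative[OF assms]
  by (metis field_differentiable_at_within field_differentiable_def holomorphic_on_def)

lemma theta_plus_1:
  "theta d s \<beta> \<tau> (z + 1) = exp (2 * of_real pi * \<i> * of_int d * of_real s) * theta d s \<beta> \<tau> z"
proof -
  have "theta_term d s \<beta> \<tau> m (z + 1) = exp (2 * of_real pi * \<i> * of_int d * of_real s) * theta_term d s \<beta> \<tau> m z" for m
  proof -
    have "theta_term d s \<beta> \<tau> m (z + 1) =
        exp (2 * of_real pi * \<i> * of_int d * of_real s) * theta_term d s \<beta> \<tau> m z *
        exp (of_int (d * m) * (of_real (2 * pi) * \<i>))"
      unfolding theta_term_def exp_add[symmetric] by (simp add: algebra_simps)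
    moreover have "exp (of_int (d * m) * (of_real (2 * pi) * \<i>)) = 1"
      by (auto simp: exp_eq_1 intro!: exI[of _ "d * m"])
    ultimately show ?thesis by simp
  qed
  then show ?thesis unfolding theta_def by (simp add: infsum_cmult_right')
qed

lemma theta_plus_tau:
  "theta d s \<beta> \<tau> (z + \<tau>) =
     exp (- of_real pi * \<i> * of_int d * (\<tau> + 2 * z) - 2 * of_real pi * \<i> * of_real \<beta>) * theta d s \<beta> \<tau> z"
    (is "_ = ?c * _")
proof -
  have "theta_term d s \<beta> \<tau> m (z + \<tau>) = ?c * theta_term d s \<beta> \<tau> (m + 1) z" for m
    unfolding theta_term_def exp_add[symmetric] by (simp add: algebra_simps power2_eq_square)
  then have "theta d s \<beta> \<tau> (z + \<tau>) = ?c * infsum ((\<lambda>m. theta_term d s \<beta> \<tau> m z) \<circ> (\<lambda>m. m + 1)) UNIV"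
    unfolding theta_def by (simp add: infsum_cmult_right' o_def)
  also have "infsum ((\<lambda>m. theta_term d s \<beta> \<tau> m z) \<circ> (\<lambda>m. m + 1)) UNIV = theta d s \<beta> \<tau> z"
    unfolding theta_def by (subst infsum_reindex[symmetric]) (auto simp: surj_plus_right)
  finally show ?thesis .
qed

lemma theta_norm_nonneg: "theta_norm d s \<beta> \<tau> z \<ge> 0"
  by (simp add: theta_norm_def)

lemma theta_norm_plus_1: "theta_norm d s \<beta> \<tau> (z + 1) = theta_norm d s \<beta> \<tau> z"
  by (simp add: theta_norm_def theta_plus_1 norm_mult)

lemma theta_norm_plus_tau:
  assumes "Im \<tau> > 0"
  shows "theta_norm d s \<beta> \<tau> (z + \<tau>) = theta_norm d s \<beta> \<tau> z"
proof -
  have "exp (pi * of_int d * (Im \<tau> + 2 * Im z)) * exp (- pi * of_int d * (Im z + Im \<tau>)\<^sup>2 / Im \<tau>) =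
      exp (- pi * of_int d * (Im z)\<^sup>2 / Im \<tau>)"
    unfolding exp_add[symmetric] using assms by (simp add: power2_eq_square field_simps)
  moreover have "theta_norm d s \<beta> \<tau> (z + \<tau>) = cmod (theta d s \<beta> \<tau> z) *
      (exp (pi * of_int d * (Im \<tau> + 2 * Im z)) * exp (- pi * of_int d * (Im z + Im \<tau>)\<^sup>2 / Im \<tau>))"
    unfolding theta_norm_def theta_plus_tau by (simp add: norm_mult algebra_simps)
  ultimately show ?thesis by (simp add: theta_norm_def)
qed

text \<open>
  If the centre of the Gaussian is within \<open>1 / (2 d)\<close> of the integer \<open>0\<close>, the term \<open>m = 0\<close> dominates:
  \<open>d ((m + \<delta>)\<^sup>2 - \<delta>\<^sup>2) \<ge> d m\<^sup>2 - \<bar>m\<bar> \<ge> (d - 1) \<bar>m\<bar>\<close>, so the other terms are smaller by the factors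
  \<open>Y\<^bsup>\<bar>m\<bar>\<^esup>\<close>.
\<close>

lemma theta_norm_lower_bound:
  fixes d :: int and s \<beta> :: real
  assumes T: "Im \<tau> > 0" and d: "d \<ge> 2"
    and \<delta>: "\<bar>s + Im z / Im \<tau>\<bar> \<le> 1 / (2 * of_int d)"
  defines "Y \<equiv> exp (- pi * Im \<tau> * (of_int d - 1))"
  shows "theta_norm d s \<beta> \<tau> z \<ge>
    exp (- pi * of_int d * Im \<tau> * (s + Im z / Im \<tau>)\<^sup>2) * (1 - 2 * Y / (1 - Y))"
proof -
  define \<delta>' where "\<delta>' = s + Im z / Im \<tau>"
  define E where "E = exp (- pi * of_int d * (Im z)\<^sup>2 / Im \<tau>)"
  have E: "E > 0" by (simp add: E_def)
  have g: "cmod (theta_term d s \<beta> \<tau> m z) * E = exp (- pi * of_int d * Im \<tau> * (of_int m + \<delta>')\<^sup>2)" for m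
    using norm_theta_term_gauss[OF T] by (simp add: E_def \<delta>'_def)
  have Y: "0 \<le> Y" "Y < 1" using T d by (auto simp: Y_def mult_less_0_iff)
  have le: "cmod (theta_term d s \<beta> \<tau> m z) \<le> cmod (theta_term d s \<beta> \<tau> 0 z) * Y ^ nat \<bar>m\<bar>" for m
  proof -
    have d2: "2 * of_int d * \<bar>\<delta>'\<bar> \<le> 1" using \<delta> d by (simp add: \<delta>'_def field_simps)
    have "of_int d * (2 * of_int m * \<delta>') \<ge> - (\<bar>real_of_int m\<bar> * (2 * of_int d * \<bar>\<delta>'\<bar>))"
      using abs_ge_minus_self[of "of_int d * (2 * of_int m * \<delta>')"] d by (simp add: abs_mult mult_ac)
    moreover have "\<bar>real_of_int m\<bar> * (2 * of_int d * \<bar>\<delta>'\<bar>) \<le> \<bar>real_of_int m\<bar> * 1"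
      using d2 by (intro mult_left_mono) auto
    moreover have "of_int d * \<bar>real_of_int m\<bar> \<le> of_int d * (real_of_int m)\<^sup>2"
    proof -
      have "\<bar>m\<bar> * 1 \<le> \<bar>m\<bar> * \<bar>m\<bar>"
      proof (cases "m = 0")
        case False
        then show ?thesis by (intro mult_left_mono) linarith+
      qed simp
      then have "\<bar>m\<bar> \<le> m\<^sup>2" by (simp add: power2_eq_square)
      then have "\<bar>real_of_int m\<bar> \<le> (real_of_int m)\<^sup>2" by (metis of_int_abs of_int_le_iff of_int_power)
      then show ?thesis using d by (intro mult_left_mono) auto
    qed
    ultimately have "(of_int d - 1) * \<bar>real_of_int m\<bar> \<le> of_int d * ((of_int m + \<delta>')\<^sup>2 - \<delta>'\<^sup>2)"
      by (simp add: power2_eq_square algebra_simps)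
    then have "pi * Im \<tau> * ((of_int d - 1) * \<bar>real_of_int m\<bar>) \<le> pi * Im \<tau> * (of_int d * ((of_int m + \<delta>')\<^sup>2 - \<delta>'\<^sup>2))"
      using T by (intro mult_left_mono) auto
    then have "exp (- pi * of_int d * Im \<tau> * (of_int m + \<delta>')\<^sup>2) \<le>
        exp (- pi * of_int d * Im \<tau> * \<delta>'\<^sup>2 + of_nat (nat \<bar>m\<bar>) * (- pi * Im \<tau> * (of_int d - 1)))"
      by (simp add: algebra_simps)
    also have "\<dots> = exp (- pi * of_int d * Im \<tau> * \<delta>'\<^sup>2) * Y ^ nat \<bar>m\<bar>"
      unfolding Y_def by (simp only: exp_add exp_of_nat_mult)
    finally have "cmod (theta_term d s \<beta> \<tau> m z) * E \<le> (cmod (theta_term d s \<beta> \<tau> 0 z) * E) * Y ^ nat \<bar>m\<bar>"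
      unfolding g by simp
    then have "cmod (theta_term d s \<beta> \<tau> m z) * E \<le> (cmod (theta_term d s \<beta> \<tau> 0 z) * Y ^ nat \<bar>m\<bar>) * E"
      by (simp only: mult_ac)
    then show ?thesis using E by simp
  qed
  have "cmod (theta d s \<beta> \<tau> z - theta_term d s \<beta> \<tau> 0 z) \<le> cmod (theta_term d s \<beta> \<tau> 0 z) * (2 * Y / (1 - Y))"
    unfolding theta_def by (rule norm_infsum_minus_term_0_le[OF Y le])
  then have "cmod (theta d s \<beta> \<tau> z) \<ge> cmod (theta_term d s \<beta> \<tau> 0 z) * (1 - 2 * Y / (1 - Y))"
    using norm_triangle_ineq2[of "theta_term d s \<beta> \<tau> 0 z" "theta d s \<beta> \<tau> z"]
    by (simp add: norm_minus_commute algebra_simps)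
  then have "theta_norm d s \<beta> \<tau> z \<ge> cmod (theta_term d s \<beta> \<tau> 0 z) * (1 - 2 * Y / (1 - Y)) * E"
    unfolding theta_norm_def E_def by (intro mult_right_mono) auto
  then have "theta_norm d s \<beta> \<tau> z \<ge> (cmod (theta_term d s \<beta> \<tau> 0 z) * E) * (1 - 2 * Y / (1 - Y))"
    by (simp only: mult_ac)
  then show ?thesis unfolding g by (simp add: \<delta>'_def)
qed

abbreviation "odd_theta \<equiv> theta 1 (1/2) (1/2)"
abbreviation "odd_theta_norm \<equiv> theta_norm 1 (1/2) (1/2)"

text \<open>
  The reflection \<open>m \<mapsto> - 1 - m\<close> preserves the exponents \<open>(m + 1/2)\<^sup>2\<close> and changes the sign of the
  terms.
\<close>

lemma odd_theta_0: "odd_theta \<tau> 0 = 0"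
proof -
  have "theta_term 1 (1/2) (1/2) \<tau> (- 1 - m) 0 = - theta_term 1 (1/2) (1/2) \<tau> m 0" for m
  proof -
    have "theta_term 1 (1/2) (1/2) \<tau> (- 1 - m) 0 = theta_term 1 (1/2) (1/2) \<tau> m 0 *
        exp (- \<i> * of_real pi) * exp (of_int (- m) * (of_real (2 * pi) * \<i>))"
      unfolding theta_term_def exp_add[symmetric] by (simp add: algebra_simps power2_eq_square)
    moreover have "exp (of_int (- m) * (of_real (2 * pi) * \<i>)) = 1"
      by (auto simp: exp_eq_1 intro!: exI[of _ "- m"])
    moreover have "exp (- \<i> * of_real pi) = -1"
      by (simp add: exp_eq_polar complex_eq_iff exp_minus cis.ctr)
    ultimately show ?thesis by simp
  qed
  then have "infsum ((\<lambda>m. theta_term 1 (1/2) (1/2) \<tau> m 0) \<circ> (\<lambda>m. - 1 - m)) UNIV = - odd_theta \<tau> 0"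
    by (simp add: theta_def o_def infsum_uminus)
  moreover have "surj (\<lambda>m::int. - 1 - m)" by (rule surjI[of _ "\<lambda>m. - 1 - m"]) simp
  then have "infsum ((\<lambda>m. theta_term 1 (1/2) (1/2) \<tau> m 0) \<circ> (\<lambda>m. - 1 - m)) UNIV = odd_theta \<tau> 0"
    unfolding theta_def by (subst infsum_reindex[symmetric]) (auto intro: injI)
  ultimately show ?thesis by simp
qed

text \<open>
  The derivative at \<open>0\<close> is a series in \<open>r = \<bar>q\<bar>\<^sup>2\<close>, namely
  \<open>2 \<pi> \<bar>q\<bar>\<^bsup>1/4\<^esup> (1 - 3 r + 5 r\<^sup>3 - \<dots>)\<close> in modulus when \<open>q > 0\<close>. Its terms are compared
  with those of the geometric series of \<open>3 r\<close>.
\<close>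

lemma odd_theta_deriv_bound:
  assumes T: "Im \<tau> > 0" and r: "3 * exp (- 2 * pi * Im \<tau>) < 1"
  obtains D where "(odd_theta \<tau> has_field_derivative D) (at 0)"
    "cmod D \<le> 2 * pi * exp (- pi * Im \<tau> / 4) / (1 - 3 * exp (- 2 * pi * Im \<tau>))"
proof -
  define r where "r = exp (- 2 * pi * Im \<tau>)"
  define t where "t m = 2 * of_real pi * \<i> * of_int 1 * (of_int m + of_real (1/2)) * theta_term 1 (1/2) (1/2) \<tau> m 0" for m
  obtain D where D: "(odd_theta \<tau> has_field_derivative D) (at 0)" and s: "(t has_sum D) UNIV"
    using theta_has_field_derivative[of \<tau> 1 "1/2" "1/2" 0] T unfolding t_def by auto
  have n: "cmod (t m) = pi * \<bar>2 * of_int m + 1\<bar> * exp (- pi * Im \<tau> * (of_int m + 1/2)\<^sup>2)" for m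
  proof -
    have "of_int m + of_real (1/2) = complex_of_real ((2 * of_int m + 1) / 2)" by simp
    then have "cmod (of_int m + of_real (1/2)) = \<bar>(2 * of_int m + 1) / 2\<bar>" by (simp only: norm_of_real)
    then show ?thesis
      unfolding t_def norm_mult norm_theta_term by (simp add: mult_ac)
  qed
  have b: "pi * (2 * real k + 1) * exp (- pi * Im \<tau> * (real k + 1/2)\<^sup>2) \<le> pi * exp (- pi * Im \<tau> / 4) * (3 * r) ^ k" for k
  proof -
    have "(2 * real k + 1) \<le> 3 ^ k" using Bernoulli_inequality[of "2::real" k] by (simp add: mult.commute)
    moreover have "exp (- pi * Im \<tau> * (real k + 1/2)\<^sup>2) \<le> exp (- pi * Im \<tau> / 4) * r ^ k"
    proof -
      have "k * 1 \<le> k * k" by (cases k) auto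
      then have "2 * real k \<le> (real k + 1/2)\<^sup>2 - 1/4"
        unfolding power2_eq_square by (simp add: algebra_simps flip: of_nat_mult)
      then have "pi * Im \<tau> * (2 * real k) \<le> pi * Im \<tau> * ((real k + 1/2)\<^sup>2 - 1/4)"
        using T by (intro mult_left_mono) auto
      then have "exp (- pi * Im \<tau> * (real k + 1/2)\<^sup>2) \<le> exp (- pi * Im \<tau> / 4 + real k * (- 2 * pi * Im \<tau>))"
        by (simp add: algebra_simps)
      then show ?thesis by (simp only: exp_add exp_of_nat_mult r_def)
    qed
    ultimately have "(2 * real k + 1) * exp (- pi * Im \<tau> * (real k + 1/2)\<^sup>2) \<le> 3 ^ k * (exp (- pi * Im \<tau> / 4) * r ^ k)"
      by (intro mult_mono) auto
    then show ?thesis by (simp add: power_mult_distrib mult_ac)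
  qed
  define g where "g m = pi * exp (- pi * Im \<tau> / 4) * (3 * r) ^ (if m \<ge> 0 then nat m else nat (- 1 - m))" for m
  have x: "0 \<le> 3 * r" "3 * r < 1" using r by (auto simp: r_def)
  have g: "(g has_sum (pi * exp (- pi * Im \<tau> / 4) * (1 / (1 - 3 * r)) + pi * exp (- pi * Im \<tau> / 4) * (1 / (1 - 3 * r)))) UNIV"
    unfolding g_def
    by (rule int_has_sumI) (use has_sum_cmult_right[OF geometric_has_sum[OF x]] in simp_all)
  have tg: "cmod (t m) \<le> g m" for m
  proof (cases "m \<ge> 0")
    case True
    then show ?thesis using b[of "nat m"] by (simp add: n g_def)
  next
    case False
    define k where "k = nat (- 1 - m)"
    have m: "real_of_int m = - 1 - real k" using False by (simp add: k_def)
    have "cmod (t m) = pi * (2 * real k + 1) * exp (- pi * Im \<tau> * (real k + 1/2)\<^sup>2)"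
      unfolding n m by (simp add: power2_eq_square algebra_simps)
    also have "\<dots> \<le> g m" using b[of k] False by (simp add: g_def k_def[symmetric])
    finally show ?thesis .
  qed
  have "(\<lambda>m. cmod (t m)) summable_on UNIV"
    by (rule summable_on_comparison_test[OF has_sum_imp_summable[OF g] tg]) auto
  then have "cmod D \<le> infsum (\<lambda>m. cmod (t m)) UNIV" "infsum (\<lambda>m. cmod (t m)) UNIV \<le> infsum g UNIV"
    using norm_infsum_bound[of t UNIV] infsumI[OF s]
    by (auto intro!: infsum_mono has_sum_imp_summable[OF g] tg)
  then have "cmod D \<le> 2 * pi * exp (- pi * Im \<tau> / 4) / (1 - 3 * r)"
    using infsumI[OF g] by simp
  then show ?thesis using that D by (simp add: r_def)
qed

text \<open>
  At the half period \<open>(1 + \<tau>) / 2\<close> the series becomes \<open>\<Sum>k. exp (\<pi> \<i> \<tau> k\<^sup>2)\<close>, up to a factor that the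
  Gaussian weight of the norm turns into a unit. The terms \<open>k = 1\<close> and \<open>k = -1\<close> are of size
  \<open>exp (- \<pi> Im \<tau>)\<close>, too large to be thrown away, but for \<open>\<bar>Re \<tau>\<bar> \<le> 1/2\<close> their real parts are
  nonnegative. This is why the half period \<open>(1 + \<tau>) / 2\<close> is used and not \<open>\<tau> / 2\<close>, where they enter with
  the opposite sign.
\<close>

lemma odd_theta_half_period_bound:
  assumes T: "Im \<tau> > 0" and re: "\<bar>Re \<tau>\<bar> \<le> 1/2"
  defines "r \<equiv> exp (- 2 * pi * Im \<tau>)"
  shows "odd_theta_norm \<tau> ((1 + \<tau>) / 2) \<ge> 1 - 2 * r\<^sup>2 / (1 - r)"
proof -
  have r: "0 \<le> r" "r < 1" using T by (auto simp: r_def)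
  define a where "a k = exp (of_real pi * \<i> * \<tau> * (of_int k)\<^sup>2)" for k
  define c where "c = exp (of_real pi * \<i> / 2) * exp (- of_real pi * \<i> * \<tau> / 4)"
  have tm: "theta_term 1 (1/2) (1/2) \<tau> m ((1 + \<tau>) / 2) = c * a (m + 1)" for m
  proof -
    have "theta_term 1 (1/2) (1/2) \<tau> m ((1 + \<tau>) / 2) = c * a (m + 1) * exp (of_int m * (of_real (2 * pi) * \<i>))"
      unfolding theta_term_def c_def a_def exp_add[symmetric]
      by (rule arg_cong[where f = exp]) (simp add: field_simps power2_eq_square)
    moreover have "exp (of_int m * (of_real (2 * pi) * \<i>)) = 1"
      by (auto simp: exp_eq_1 intro!: exI[of _ m])
    ultimately show ?thesis by simp
  qed
  have na: "cmod (a k) = exp (- pi * Im \<tau> * (of_int k)\<^sup>2)" for k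
    unfolding a_def norm_exp_eq_Re
    by (simp only: of_int_power[symmetric]) (simp add: algebra_simps)
  have "odd_theta \<tau> ((1 + \<tau>) / 2) = c * infsum (a \<circ> (\<lambda>m. m + 1)) UNIV"
    unfolding theta_def tm by (simp add: infsum_cmult_right' o_def)
  also have "infsum (a \<circ> (\<lambda>m. m + 1)) UNIV = infsum a UNIV"
    by (subst infsum_reindex[symmetric]) (auto simp: surj_plus_right)
  finally have th: "odd_theta \<tau> ((1 + \<tau>) / 2) = c * infsum a UNIV" .
  have "cmod c = exp (pi * Im \<tau> / 4)"
    unfolding c_def norm_mult norm_exp_eq_Re by simp
  moreover have "exp (pi * Im \<tau> / 4) * exp (- pi * (Im \<tau> / 2)\<^sup>2 / Im \<tau>) = 1"
    unfolding exp_add[symmetric] using T by (simp add: power2_eq_square field_simps)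
  ultimately have nrm: "odd_theta_norm \<tau> ((1 + \<tau>) / 2) = cmod (infsum a UNIV)"
    unfolding theta_norm_def th norm_mult by simp
  have far: "cmod (a k) \<le> r ^ nat \<bar>k\<bar>" if "k \<notin> {0, 1, -1}" for k
  proof -
    have "2 * \<bar>k\<bar> \<le> \<bar>k\<bar> * \<bar>k\<bar>" using that by (intro mult_right_mono) auto
    then have "2 * \<bar>k\<bar> \<le> k\<^sup>2" by (simp add: power2_eq_square)
    then have "2 * \<bar>real_of_int k\<bar> \<le> (real_of_int k)\<^sup>2"
      using of_int_le_iff[of "2 * \<bar>k\<bar>" "k\<^sup>2", where 'a = real] by simp
    then have "pi * Im \<tau> * (2 * \<bar>real_of_int k\<bar>) \<le> pi * Im \<tau> * (real_of_int k)\<^sup>2"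
      using T by (intro mult_left_mono) auto
    then have "cmod (a k) \<le> exp (of_nat (nat \<bar>k\<bar>) * (- 2 * pi * Im \<tau>))"
      by (simp add: na algebra_simps)
    then show ?thesis by (simp only: exp_of_nat_mult r_def)
  qed
  have g: "((\<lambda>m::int. r ^ nat \<bar>m\<bar>) has_sum ((1 + r) / (1 - r) - (1 + 2 * r))) (UNIV - {0, 1, -1})"
    using has_sum_Diff[OF int_geometric_has_sum[OF r], of "{0, 1, -1}"]
      has_sum_finite[of "{0, 1, -1}" "\<lambda>m::int. r ^ nat \<bar>m\<bar>"] by simp
  have sn': "(\<lambda>k. cmod (a k)) summable_on (UNIV - {0, 1, -1})"
    by (rule summable_on_comparison_test[OF has_sum_imp_summable[OF g]]) (use far in auto)
  have s': "a summable_on (UNIV - {0, 1, -1})" using sn' by (rule abs_summable_summable)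
  have "infsum a ({0, 1, -1} \<union> (UNIV - {0, 1, -1})) = infsum a {0, 1, -1} + infsum a (UNIV - {0, 1, -1})"
    by (rule infsum_Un_disjoint) (use s' in auto)
  then have split: "infsum a UNIV = a 0 + a 1 + a (-1) + infsum a (UNIV - {0, 1, -1})"
    by (simp add: insert_UNIV)
  have "cmod (infsum a (UNIV - {0, 1, -1})) \<le> infsum (\<lambda>k. cmod (a k)) (UNIV - {0, 1, -1})"
    by (rule norm_infsum_bound) (use sn' in simp)
  also have "\<dots> \<le> infsum (\<lambda>m::int. r ^ nat \<bar>m\<bar>) (UNIV - {0, 1, -1})"
    by (rule infsum_mono[OF sn' has_sum_imp_summable[OF g]]) (use far in auto)
  also have "\<dots> = 2 * r\<^sup>2 / (1 - r)"
    using infsumI[OF g] r by (simp add: field_simps power2_eq_square)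
  finally have rest: "cmod (infsum a (UNIV - {0, 1, -1})) \<le> 2 * r\<^sup>2 / (1 - r)" .
  have "\<bar>pi * Re \<tau>\<bar> \<le> pi / 2" using re by (simp add: abs_mult)
  then have "- (pi / 2) \<le> pi * Re \<tau>" "pi * Re \<tau> \<le> pi / 2" unfolding abs_le_iff by linarith+
  then have "cos (pi * Re \<tau>) \<ge> 0" using cos_ge_zero by blast
  then have "Re (a 1) \<ge> 0" "Re (a (-1)) \<ge> 0" by (simp_all add: a_def Re_exp)
  moreover have "a 0 = 1" by (simp add: a_def)
  ultimately have "Re (infsum a UNIV) \<ge> 1 - 2 * r\<^sup>2 / (1 - r)"
    unfolding split using rest abs_Re_le_cmod[of "infsum a (UNIV - {0, 1, -1})"] by simp
  then show ?thesis unfolding nrm using complex_Re_le_cmod[of "infsum a UNIV"] by linarith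
qed

section \<open>Square integrals of sums of Gaussians\<close>

lemma nn_integral_gaussian:
  fixes b \<mu> :: real
  assumes b: "b > 0"
  shows "(\<integral>\<^sup>+ x. ennreal (exp (- b * (x - \<mu>)\<^sup>2)) \<partial>lborel) = ennreal (sqrt (pi / b))"
proof -
  define \<sigma> where "\<sigma> = 1 / sqrt (2 * b)"
  have \<sigma>: "\<sigma> > 0" using b by (simp add: \<sigma>_def)
  have s2: "2 * \<sigma>\<^sup>2 = 1 / b" using b by (simp add: \<sigma>_def power_divide)
  interpret prob_space "density lborel (normal_density \<mu> \<sigma>)"
    by (rule prob_space_normal_density[OF \<sigma>])
  have 1: "(\<integral>\<^sup>+ x. ennreal (normal_density \<mu> \<sigma> x) \<partial>lborel) = 1"
    using emeasure_space_1 by (simp add: emeasure_density)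
  have "normal_density \<mu> \<sigma> x * sqrt (pi / b) = exp (- b * (x - \<mu>)\<^sup>2)" for x
  proof -
    have "2 * pi * \<sigma>\<^sup>2 = pi / b" using s2 by (simp add: field_simps)
    moreover have "- (x - \<mu>)\<^sup>2 / (2 * \<sigma>\<^sup>2) = - b * (x - \<mu>)\<^sup>2" unfolding s2 by simp
    moreover have "sqrt (pi / b) > 0" using b by simp
    ultimately show ?thesis unfolding normal_density_def using b by simp
  qed
  then have "ennreal (exp (- b * (x - \<mu>)\<^sup>2)) = ennreal (sqrt (pi / b)) * ennreal (normal_density \<mu> \<sigma> x)" for x
    using b by (simp add: ennreal_mult'[symmetric] mult.commute)
  then show ?thesis by (simp add: nn_integral_cmult 1)
qed

lemma nn_integral_translate:
  fixes f :: "real \<Rightarrow> ennreal"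
  assumes [measurable]: "f \<in> borel_measurable borel"
  shows "(\<integral>\<^sup>+ x. f (c + x) \<partial>lborel) = (\<integral>\<^sup>+ x. f x \<partial>lborel)"
  using nn_integral_real_affine[OF assms, of 1 c] by simp

text \<open>
  Unfolding: the translates of \<open>[0, 1)\<close> by integers tile the line.
\<close>

lemma nn_integral_unfold_integers:
  fixes f :: "real \<Rightarrow> ennreal"
  assumes [measurable]: "f \<in> borel_measurable borel"
  shows "(\<integral>\<^sup>+ t\<in>{0..<1}. (\<integral>\<^sup>+ m. f (of_int m + t) \<partial>count_space (UNIV :: int set)) \<partial>lborel) =
         (\<integral>\<^sup>+ t. f t \<partial>lborel)"
proof -
  have ind: "(\<integral>\<^sup>+ m. indicator {0..<1} (- of_int m + t) \<partial>count_space (UNIV :: int set)) = (1 :: ennreal)" for t :: real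
  proof -
    have "indicator {0..<1} (- of_int m + t) = (indicator {\<lfloor>t\<rfloor>} m :: ennreal)" for m :: int
      by (auto simp: indicator_def) linarith+
    then show ?thesis by (simp add: nn_integral_indicator_singleton)
  qed
  have "(\<integral>\<^sup>+ t\<in>{0..<1}. (\<integral>\<^sup>+ m. f (of_int m + t) \<partial>count_space (UNIV :: int set)) \<partial>lborel) =
        (\<integral>\<^sup>+ t. (\<integral>\<^sup>+ m. f (of_int m + t) * indicator {0..<1} t \<partial>count_space (UNIV :: int set)) \<partial>lborel)"
    by (simp add: nn_integral_multc)
  also have "\<dots> = (\<integral>\<^sup>+ m. (\<integral>\<^sup>+ t. f (of_int m + t) * indicator {0..<1} t \<partial>lborel) \<partial>count_space (UNIV :: int set))"
    by (rule nn_integral_count_space_nn_integral) auto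
  also have "\<dots> = (\<integral>\<^sup>+ m. (\<integral>\<^sup>+ t. f t * indicator {0..<1} (- of_int m + t) \<partial>lborel) \<partial>count_space (UNIV :: int set))"
  proof (rule nn_integral_cong)
    fix m :: int
    have "(\<integral>\<^sup>+ t. f (of_int m + t) * indicator {0..<1} t \<partial>lborel) =
          (\<integral>\<^sup>+ t. (\<lambda>x. f x * indicator {0..<1} (- of_int m + x)) (of_int m + t) \<partial>lborel)" by simp
    also have "\<dots> = (\<integral>\<^sup>+ t. f t * indicator {0..<1} (- of_int m + t) \<partial>lborel)"
      by (rule nn_integral_translate) measurable
    finally show "(\<integral>\<^sup>+ t. f (of_int m + t) * indicator {0..<1} t \<partial>lborel) =
          (\<integral>\<^sup>+ t. f t * indicator {0..<1} (- of_int m + t) \<partial>lborel)" .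
  qed
  also have "\<dots> = (\<integral>\<^sup>+ t. (\<integral>\<^sup>+ m. f t * indicator {0..<1} (- of_int m + t) \<partial>count_space (UNIV :: int set)) \<partial>lborel)"
    by (rule nn_integral_count_space_nn_integral[symmetric]) auto
  also have "\<dots> = (\<integral>\<^sup>+ t. f t \<partial>lborel)"
    using ind by (simp add: nn_integral_cmult)
  finally show ?thesis .
qed

definition gauss_sum :: "real \<Rightarrow> real \<Rightarrow> ennreal" where
  "gauss_sum a t = (\<integral>\<^sup>+ m. ennreal (exp (- a * (of_int m + t)\<^sup>2)) \<partial>count_space (UNIV :: int set))"

lemma gauss_sum_measurable [measurable]: "gauss_sum a \<in> borel_measurable borel"
proof -
  have "gauss_sum a = (\<lambda>t. \<Sum>n. ennreal (exp (- a * (of_int (from_nat_into UNIV n) + t)\<^sup>2)))"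
    unfolding gauss_sum_def
    by (simp add: fun_eq_iff nn_integral_bij_count_space[symmetric, OF bij_betw_from_nat_into[of "UNIV :: int set"]]
          nn_integral_count_space_nat infinite_UNIV_int)
  then show ?thesis by simp
qed

lemma gauss_sum_plus_int: "gauss_sum a (of_int k + t) = gauss_sum a t"
proof -
  have bij: "bij (\<lambda>m. m + k)" for k :: int by (rule bij_betwI[of _ _ _ "\<lambda>m. m - k"]) auto
  have "gauss_sum a t = (\<integral>\<^sup>+ m. ennreal (exp (- a * (of_int (m + k) + t)\<^sup>2)) \<partial>count_space (UNIV :: int set))"
    unfolding gauss_sum_def
    by (rule nn_integral_bij_count_space[symmetric, of "\<lambda>m. m + k" UNIV UNIV, OF bij])
  then show ?thesis by (simp add: gauss_sum_def add.assoc)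
qed

text \<open>
  One factor of the square is unfolded against the other, which is periodic. The resulting integrals
  over the line are Gaussian, because the product of two equal Gaussians with distance \<open>j\<close> between
  their centres is the Gaussian of twice the exponent at the midpoint, times \<open>exp (- a j\<^sup>2 / 2)\<close>.
\<close>

lemma gauss_sum_sq_integral:
  assumes a: "a > 0"
  shows "(\<integral>\<^sup>+ t\<in>{0..<1}. (gauss_sum a t)\<^sup>2 \<partial>lborel) =
    (\<integral>\<^sup>+ j. ennreal (sqrt (pi / (2 * a)) * exp (- a / 2 * (of_int j)\<^sup>2)) \<partial>count_space (UNIV :: int set))"
proof -
  have "(gauss_sum a t)\<^sup>2 =
      (\<integral>\<^sup>+ m. (\<lambda>x. ennreal (exp (- a * x\<^sup>2)) * gauss_sum a x) (of_int m + t) \<partial>count_space (UNIV :: int set))" for t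
    by (subst power2_eq_square, subst (1) gauss_sum_def) (simp add: nn_integral_multc gauss_sum_plus_int)
  then have "(\<integral>\<^sup>+ t\<in>{0..<1}. (gauss_sum a t)\<^sup>2 \<partial>lborel) =
      (\<integral>\<^sup>+ t. ennreal (exp (- a * t\<^sup>2)) * gauss_sum a t \<partial>lborel)"
    using nn_integral_unfold_integers[of "\<lambda>x. ennreal (exp (- a * x\<^sup>2)) * gauss_sum a x"] by simp
  also have "\<dots> = (\<integral>\<^sup>+ t. (\<integral>\<^sup>+ j. ennreal (exp (- a * t\<^sup>2)) * ennreal (exp (- a * (of_int j + t)\<^sup>2))
      \<partial>count_space (UNIV :: int set)) \<partial>lborel)"
    unfolding gauss_sum_def by (simp add: nn_integral_cmult)
  also have "\<dots> = (\<integral>\<^sup>+ j. (\<integral>\<^sup>+ t. ennreal (exp (- a * t\<^sup>2)) * ennreal (exp (- a * (of_int j + t)\<^sup>2)) \<partial>lborel)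
      \<partial>count_space (UNIV :: int set))"
    by (rule nn_integral_count_space_nn_integral) auto
  also have "\<dots> = (\<integral>\<^sup>+ j. ennreal (sqrt (pi / (2 * a)) * exp (- a / 2 * (of_int j)\<^sup>2)) \<partial>count_space (UNIV :: int set))"
  proof (rule nn_integral_cong)
    fix j :: int
    have "exp (- a * t\<^sup>2) * exp (- a * (of_int j + t)\<^sup>2) =
        exp (- a / 2 * (of_int j)\<^sup>2) * exp (- (2 * a) * (t - (- of_int j / 2))\<^sup>2)" for t
      unfolding exp_add[symmetric] by (simp add: power2_eq_square algebra_simps)
    then have "(\<integral>\<^sup>+ t. ennreal (exp (- a * t\<^sup>2)) * ennreal (exp (- a * (of_int j + t)\<^sup>2)) \<partial>lborel) =
        (\<integral>\<^sup>+ t. ennreal (exp (- a / 2 * (of_int j)\<^sup>2)) * ennreal (exp (- (2 * a) * (t - (- of_int j / 2))\<^sup>2)) \<partial>lborel)"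
      by (simp add: ennreal_mult[symmetric])
    also have "\<dots> = ennreal (exp (- a / 2 * (of_int j)\<^sup>2)) *
        (\<integral>\<^sup>+ t. ennreal (exp (- (2 * a) * (t - (- of_int j / 2))\<^sup>2)) \<partial>lborel)"
      by (rule nn_integral_cmult) measurable
    also have "\<dots> = ennreal (sqrt (pi / (2 * a)) * exp (- a / 2 * (of_int j)\<^sup>2))"
      using a by (subst nn_integral_gaussian) (auto simp: ennreal_mult[symmetric] mult.commute)
    finally show "(\<integral>\<^sup>+ t. ennreal (exp (- a * t\<^sup>2)) * ennreal (exp (- a * (of_int j + t)\<^sup>2)) \<partial>lborel) =
      ennreal (sqrt (pi / (2 * a)) * exp (- a / 2 * (of_int j)\<^sup>2))" .
  qed
  finally show ?thesis .
qed

lemma nn_integral_count_space_infsum: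
  fixes f :: "'a \<Rightarrow> real"
  assumes "f summable_on A" "\<And>x. f x \<ge> 0"
  shows "(\<integral>\<^sup>+ x. ennreal (f x) \<partial>count_space A) = ennreal (infsum f A)"
proof -
  have "Infinite_Set_Sum.abs_summable_on f A"
    using assms by (subst abs_summable_equivalent[symmetric]) simp
  then show ?thesis using assms by (simp add: nn_integral_conv_infsetsum infsetsum_infsum)
qed

lemma theta_norm_le_gauss_sum:
  assumes "Im \<tau> > 0" "d > 0"
  shows "ennreal (theta_norm d s \<beta> \<tau> z) \<le> gauss_sum (pi * of_int d * Im \<tau>) (s + Im z / Im \<tau>)"
proof -
  define E where "E = exp (- pi * of_int d * (Im z)\<^sup>2 / Im \<tau>)"
  let ?t = "\<lambda>m. theta_term d s \<beta> \<tau> m z"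
  have sm: "(\<lambda>m. cmod (?t m)) summable_on UNIV" by (rule theta_term_abs_summable[OF assms])
  have "theta_norm d s \<beta> \<tau> z \<le> infsum (\<lambda>m. cmod (?t m)) UNIV * E"
    unfolding theta_norm_def E_def theta_def by (intro mult_right_mono norm_infsum_bound) (use sm in auto)
  also have "\<dots> = infsum (\<lambda>m. cmod (?t m) * E) UNIV" by (simp add: infsum_cmult_left')
  finally have "ennreal (theta_norm d s \<beta> \<tau> z) \<le> ennreal (infsum (\<lambda>m. cmod (?t m) * E) UNIV)"
    by (rule ennreal_leI)
  also have "\<dots> = (\<integral>\<^sup>+ m. ennreal (cmod (?t m) * E) \<partial>count_space UNIV)"
    by (rule nn_integral_count_space_infsum[symmetric]) (auto intro!: summable_on_cmult_left sm simp: E_def)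
  also have "\<dots> = gauss_sum (pi * of_int d * Im \<tau>) (s + Im z / Im \<tau>)"
    unfolding gauss_sum_def E_def norm_theta_term_gauss[OF assms(1)] by simp
  finally show ?thesis .
qed

lemma gauss_sum_sq_integral_le:
  assumes a: "a > 0"
  shows "(\<integral>\<^sup>+ t\<in>{0..<1}. (gauss_sum a t)\<^sup>2 \<partial>lborel) \<le>
    ennreal (sqrt (pi / (2 * a)) * ((1 + exp (- a / 2)) / (1 - exp (- a / 2))))"
proof -
  define x where "x = exp (- a / 2)"
  have x: "0 \<le> x" "x < 1" using a by (auto simp: x_def)
  have "exp (- a / 2 * (of_int j)\<^sup>2) \<le> x ^ nat \<bar>j\<bar>" for j :: int
  proof -
    have "\<bar>j\<bar> * 1 \<le> \<bar>j\<bar> * \<bar>j\<bar>"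
    proof (cases "j = 0")
      case False
      then show ?thesis by (intro mult_left_mono) linarith+
    qed simp
    then have "\<bar>real_of_int j\<bar> \<le> (real_of_int j)\<^sup>2"
      using of_int_le_iff[of "\<bar>j\<bar>" "j\<^sup>2", where 'a = real] by (simp add: power2_eq_square)
    then have "a / 2 * \<bar>real_of_int j\<bar> \<le> a / 2 * (real_of_int j)\<^sup>2" using a by (intro mult_left_mono) auto
    then have "exp (- a / 2 * (of_int j)\<^sup>2) \<le> exp (of_nat (nat \<bar>j\<bar>) * (- a / 2))" by (simp add: mult.commute)
    then show ?thesis by (simp only: exp_of_nat_mult x_def)
  qed
  then have "(\<integral>\<^sup>+ t\<in>{0..<1}. (gauss_sum a t)\<^sup>2 \<partial>lborel) \<le>
      (\<integral>\<^sup>+ j. ennreal (sqrt (pi / (2 * a)) * x ^ nat \<bar>j\<bar>) \<partial>count_space (UNIV :: int set))"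
    unfolding gauss_sum_sq_integral[OF a]
    by (intro nn_integral_mono ennreal_leI mult_left_mono) (use a in auto)
  also have "\<dots> = ennreal (infsum (\<lambda>j::int. sqrt (pi / (2 * a)) * x ^ nat \<bar>j\<bar>) UNIV)"
    by (rule nn_integral_count_space_infsum)
       (use a x has_sum_imp_summable[OF has_sum_cmult_right[OF int_geometric_has_sum[OF x]]] in auto)
  also have "infsum (\<lambda>j::int. sqrt (pi / (2 * a)) * x ^ nat \<bar>j\<bar>) UNIV = sqrt (pi / (2 * a)) * ((1 + x) / (1 - x))"
    by (rule infsumI) (rule has_sum_cmult_right[OF int_geometric_has_sum[OF x]])
  finally show ?thesis by (simp add: x_def)
qed

text \<open>
  A general unfolding principle: a weight whose sum over integer translates is a constant \<open>N\<close> counts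
  every period \<open>N\<close> times.
\<close>

lemma nn_integral_weight_periodic:
  fixes W h :: "real \<Rightarrow> ennreal"
  assumes [measurable]: "W \<in> borel_measurable borel" "h \<in> borel_measurable borel"
    and per: "\<And>k t. W (of_int k + t) = W t"
    and h: "\<And>t. (\<integral>\<^sup>+ m. h (of_int m + t) \<partial>count_space (UNIV :: int set)) = N"
  shows "(\<integral>\<^sup>+ t. h t * W t \<partial>lborel) = N * (\<integral>\<^sup>+ t\<in>{0..<1}. W t \<partial>lborel)"
proof -
  have "(\<integral>\<^sup>+ t. h t * W t \<partial>lborel) =
     (\<integral>\<^sup>+ t\<in>{0..<1}. (\<integral>\<^sup>+ m. h (of_int m + t) * W (of_int m + t) \<partial>count_space (UNIV :: int set)) \<partial>lborel)"
    by (rule nn_integral_unfold_integers[symmetric]) measurable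
  also have "\<dots> = (\<integral>\<^sup>+ t\<in>{0..<1}. N * W t \<partial>lborel)"
    by (simp add: per nn_integral_multc h)
  also have "\<dots> = N * (\<integral>\<^sup>+ t\<in>{0..<1}. W t \<partial>lborel)"
    by (simp add: mult.assoc nn_integral_cmult)
  finally show ?thesis .
qed

text \<open>
  The interval from \<open>c\<close> to \<open>c + n\<close> (half open) contains exactly \<open>\<bar>n\<bar>\<close> points of each coset of the integers, so
  its indicator is a weight in the sense of the preceding lemma.
\<close>

lemma nn_integral_periodic_dilation:
  fixes W :: "real \<Rightarrow> ennreal" and n :: int
  assumes W [measurable]: "W \<in> borel_measurable borel"
    and per: "\<And>k t. W (of_int k + t) = W t" and n: "n \<noteq> 0"
  shows "(\<integral>\<^sup>+ s\<in>{0..<1}. W (of_int n * s + c) \<partial>lborel) = (\<integral>\<^sup>+ t\<in>{0..<1}. W t \<partial>lborel)"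
proof -
  define N where "N = \<bar>n\<bar>"
  define h where "h x = (indicator {0..<1} ((x - c) / of_int n) :: ennreal)" for x :: real
  have [measurable]: "h \<in> borel_measurable borel" unfolding h_def by measurable
  have "(\<integral>\<^sup>+ m. h (of_int m + t) \<partial>count_space (UNIV :: int set)) = ennreal (of_int N)" for t
  proof -
    have "\<exists>A. finite A \<and> card A = nat N \<and> (\<forall>m::int. h (of_int m + t) = indicator A m)"
    proof (cases "n > 0")
      case True
      then have "h (of_int m + t) = indicator {\<lceil>c - t\<rceil>..<\<lceil>c - t\<rceil> + n} m" for m
        unfolding h_def indicator_def by (auto simp: field_simps ceiling_le_iff not_less) linarith+
      then show ?thesis using True
        by (intro exI[of _ "{\<lceil>c - t\<rceil>..<\<lceil>c - t\<rceil> + n}"]) (auto simp: N_def)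
    next
      case False
      then have "n < 0" using n by simp
      then have "h (of_int m + t) = indicator {\<lfloor>c - t\<rfloor> + n<..\<lfloor>c - t\<rfloor>} m" for m
        unfolding h_def indicator_def by (auto simp: field_simps le_floor_iff not_less) linarith+
      then show ?thesis using \<open>n < 0\<close>
        by (intro exI[of _ "{\<lfloor>c - t\<rfloor> + n<..\<lfloor>c - t\<rfloor>}"]) (auto simp: N_def)
    qed
    then obtain A where A: "finite A" "card A = nat N" "\<And>m::int. h (of_int m + t) = indicator A m" by blast
    then show ?thesis by (simp add: N_def ennreal_of_nat_eq_real_of_nat)
  qed
  note weight = nn_integral_weight_periodic[OF W \<open>h \<in> borel_measurable borel\<close> per this]
  have "ennreal (of_int N) * (\<integral>\<^sup>+ s\<in>{0..<1}. W (of_int n * s + c) \<partial>lborel) =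
      ennreal \<bar>of_int n\<bar> * (\<integral>\<^sup>+ s. h (c + of_int n * s) * W (c + of_int n * s) \<partial>lborel)"
    using n by (simp add: N_def h_def mult.commute add.commute)
  also have "\<dots> = (\<integral>\<^sup>+ t. h t * W t \<partial>lborel)"
    by (rule nn_integral_real_affine[symmetric]) (use n in auto)
  also have "\<dots> = ennreal (of_int N) * (\<integral>\<^sup>+ t\<in>{0..<1}. W t \<partial>lborel)" by (rule weight)
  finally show ?thesis
    using n by (simp add: ennreal_mult_cancel_left N_def)
qed

text \<open>
  This compares integrals over fundamental domains of different lattice bases: in terms of the
  coordinates \<open>(s, v)\<close> of one basis, a coordinate of another basis is an integral linear form.
\<close>

lemma nn_integral_periodic_on_square:
  fixes W :: "real \<Rightarrow> ennreal" and m n :: int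
  assumes W [measurable]: "W \<in> borel_measurable borel"
    and per: "\<And>k t. W (of_int k + t) = W t" and mn: "m \<noteq> 0 \<or> n \<noteq> 0"
  shows "(\<integral>\<^sup>+ v\<in>{0..<1}. (\<integral>\<^sup>+ s\<in>{0..<1}. W (of_int m * s + of_int n * v + c) \<partial>lborel) \<partial>lborel) =
         (\<integral>\<^sup>+ t\<in>{0..<1}. W t \<partial>lborel)"
proof (cases "m = 0")
  case False
  have "(\<integral>\<^sup>+ s\<in>{0..<1}. W (of_int m * s + of_int n * v + c) \<partial>lborel) = (\<integral>\<^sup>+ t\<in>{0..<1}. W t \<partial>lborel)" for v
    using nn_integral_periodic_dilation[OF W per False, of "of_int n * v + c"] by (simp add: add.assoc)
  then show ?thesis by (simp add: nn_integral_cmult_indicator)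
next
  case True
  then have "n \<noteq> 0" using mn by simp
  then show ?thesis
    using nn_integral_periodic_dilation[OF W per, of n c] True by (simp add: nn_integral_cmult_indicator)
qed

section \<open>Lebesgue measure on the complex plane\<close>

lemma lborel_complex: "(lborel :: complex measure) = distr (lborel \<Otimes>\<^sub>M lborel) borel (\<lambda>(x, y). Complex x y)"
proof (rule lborel_eqI)
  have [measurable]: "(\<lambda>(x, y). Complex x y) \<in> lborel \<Otimes>\<^sub>M lborel \<rightarrow>\<^sub>M borel"
    unfolding Complex_eq by measurable
  fix l u :: complex
  assume le: "\<And>b. b \<in> Basis \<Longrightarrow> l \<bullet> b \<le> u \<bullet> b"
  then have le': "Re l \<le> Re u" "Im l \<le> Im u" 
    using le[of 1] le[of \<i>] by (auto simp: Basis_complex_def inner_complex_def)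
  have "(\<lambda>(x, y). Complex x y) -` box l u \<inter> space (lborel \<Otimes>\<^sub>M lborel) = {Re l<..<Re u} \<times> {Im l<..<Im u}"
    by (auto simp: box_def Basis_complex_def inner_complex_def space_pair_measure)
  then have "emeasure (distr (lborel \<Otimes>\<^sub>M lborel) borel (\<lambda>(x, y). Complex x y)) (box l u) =
      emeasure (lborel \<Otimes>\<^sub>M lborel) ({Re l<..<Re u} \<times> {Im l<..<Im u})"
    by (simp add: emeasure_distr)
  also have "\<dots> = ennreal (Re u - Re l) * ennreal (Im u - Im l)"
    using le' by (subst lborel.emeasure_pair_measure_Times) auto
  finally show "emeasure (distr (lborel \<Otimes>\<^sub>M lborel) borel (\<lambda>(x, y). Complex x y)) (box l u) =
      ennreal (\<Prod>b\<in>Basis. (u - l) \<bullet> b)"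
    using le' by (simp add: Basis_complex_def inner_complex_def ennreal_mult)
qed simp

lemma nn_integral_lborel_complex:
  fixes f :: "complex \<Rightarrow> ennreal"
  assumes [measurable]: "f \<in> borel_measurable borel"
  shows "(\<integral>\<^sup>+ z. f z \<partial>lborel) = (\<integral>\<^sup>+ y. (\<integral>\<^sup>+ x. f (Complex x y) \<partial>lborel) \<partial>lborel)"
proof -
  have [measurable]: "(\<lambda>(x, y). Complex x y) \<in> lborel \<Otimes>\<^sub>M lborel \<rightarrow>\<^sub>M borel"
    unfolding Complex_eq by measurable
  have "(\<integral>\<^sup>+ z. f z \<partial>lborel) = (\<integral>\<^sup>+ p. f (Complex (fst p) (snd p)) \<partial>(lborel \<Otimes>\<^sub>M lborel))"
    by (subst lborel_complex) (simp add: nn_integral_distr case_prod_beta')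
  also have "\<dots> = (\<integral>\<^sup>+ y. (\<integral>\<^sup>+ x. f (Complex x y) \<partial>lborel) \<partial>lborel)"
    by (subst lborel_pair.nn_integral_snd[symmetric]) (simp_all add: Complex_eq)
  finally show ?thesis .
qed

lemma fund_parallelogram_iff:
  assumes "Im \<tau> > 0"
  shows "z \<in> fund_parallelogram \<tau> \<longleftrightarrow>
    Im z / Im \<tau> \<in> {0..<1} \<and> Re z - Im z / Im \<tau> * Re \<tau> \<in> {0..<1}"
proof
  assume "z \<in> fund_parallelogram \<tau>"
  then show "Im z / Im \<tau> \<in> {0..<1} \<and> Re z - Im z / Im \<tau> * Re \<tau> \<in> {0..<1}"
    using assms by (auto simp: fund_parallelogram_def)
next
  assume *: "Im z / Im \<tau> \<in> {0..<1} \<and> Re z - Im z / Im \<tau> * Re \<tau> \<in> {0..<1}"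
  have "z = of_real (Re z - Im z / Im \<tau> * Re \<tau>) + of_real (Im z / Im \<tau>) * \<tau>"
    using assms by (simp add: complex_eq_iff)
  with * show "z \<in> fund_parallelogram \<tau>" unfolding fund_parallelogram_def by blast
qed

lemma fund_parallelogram_measurable [measurable]:
  assumes "Im \<tau> > 0"
  shows "fund_parallelogram \<tau> \<in> sets borel"
proof -
  have "fund_parallelogram \<tau> = {z. Im z / Im \<tau> \<in> {0..<1} \<and> Re z - Im z / Im \<tau> * Re \<tau> \<in> {0..<1}}"
    using fund_parallelogram_iff[OF assms] by blast
  also have "\<dots> \<in> sets borel"
  proof -
    have [measurable]: "Re \<in> borel_measurable borel" "Im \<in> borel_measurable borel"
      by (auto intro!: borel_measurable_continuous_onI continuous_intros)
    show ?thesis by measurable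
  qed
  finally show ?thesis .
qed

text \<open>
  The coordinates \<open>(s, v)\<close> of the parallelogram arise from \<open>(x, y)\<close> by a dilation in \<open>y\<close> and a shear in
  \<open>x\<close>; the latter is a translation for fixed \<open>y\<close>, so only one-dimensional substitutions are needed.
\<close>

lemma nn_integral_fund_parallelogram:
  fixes g :: "complex \<Rightarrow> ennreal"
  assumes T: "Im \<tau> > 0" and [measurable]: "g \<in> borel_measurable borel"
  shows "(\<integral>\<^sup>+ z\<in>fund_parallelogram \<tau>. g z \<partial>lborel) =
    ennreal (Im \<tau>) * (\<integral>\<^sup>+ v\<in>{0..<1}. (\<integral>\<^sup>+ s\<in>{0..<1}. g (of_real s + of_real v * \<tau>) \<partial>lborel) \<partial>lborel)"
proof -
  note [measurable] = fund_parallelogram_measurable[OF T]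
  define k where "k z = g z * indicator (fund_parallelogram \<tau>) z" for z
  have [measurable]: "k \<in> borel_measurable borel" unfolding k_def by measurable
  have [measurable]: "(\<lambda>p. Complex (fst p) (snd p)) \<in> borel_measurable (borel \<Otimes>\<^sub>M borel)"
    unfolding Complex_eq by measurable
  have "(\<integral>\<^sup>+ z. k z \<partial>lborel) = (\<integral>\<^sup>+ y. (\<integral>\<^sup>+ x. k (Complex x y) \<partial>lborel) \<partial>lborel)"
    by (rule nn_integral_lborel_complex) measurable
  also have "\<dots> = ennreal \<bar>Im \<tau>\<bar> * (\<integral>\<^sup>+ v. (\<integral>\<^sup>+ x. k (Complex x (0 + Im \<tau> * v)) \<partial>lborel) \<partial>lborel)"
    using T by (intro nn_integral_real_affine) (auto simp: Complex_eq)
  also have "\<dots> = ennreal (Im \<tau>) * (\<integral>\<^sup>+ v. (\<integral>\<^sup>+ s. k (of_real s + of_real v * \<tau>) \<partial>lborel) \<partial>lborel)"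
  proof -
    have "(\<integral>\<^sup>+ x. k (Complex x (0 + Im \<tau> * v)) \<partial>lborel) = (\<integral>\<^sup>+ s. k (of_real s + of_real v * \<tau>) \<partial>lborel)" for v
    proof -
      have "(\<integral>\<^sup>+ x. k (Complex x (0 + Im \<tau> * v)) \<partial>lborel) =
          (\<integral>\<^sup>+ s. k (Complex (v * Re \<tau> + s) (0 + Im \<tau> * v)) \<partial>lborel)"
        by (rule nn_integral_translate[symmetric]) (simp add: Complex_eq)
      also have "\<dots> = (\<integral>\<^sup>+ s. k (of_real s + of_real v * \<tau>) \<partial>lborel)"
        by (intro nn_integral_cong arg_cong[of _ _ k]) (simp add: complex_eq_iff mult.commute)
      finally show ?thesis .
    qed
    then show ?thesis using T by simp
  qed
  also have "(\<integral>\<^sup>+ v. (\<integral>\<^sup>+ s. k (of_real s + of_real v * \<tau>) \<partial>lborel) \<partial>lborel) =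
      (\<integral>\<^sup>+ v\<in>{0..<1}. (\<integral>\<^sup>+ s\<in>{0..<1}. g (of_real s + of_real v * \<tau>) \<partial>lborel) \<partial>lborel)"
  proof -
    have "k (of_real s + of_real v * \<tau>) = g (of_real s + of_real v * \<tau>) * indicator {0..<1} s * indicator {0..<1} v" for s v
      using T by (auto simp: k_def fund_parallelogram_iff[OF T] indicator_def)
    then show ?thesis by (simp add: nn_integral_multc)
  qed
  finally show ?thesis by (simp add: k_def)
qed

section \<open>The torus\<close>

lemma zero_in_lattice: "0 \<in> lattice \<tau>"
  unfolding lattice_def by (auto intro!: exI[of _ 0])

lemma lattice_add: "a \<in> lattice \<tau> \<Longrightarrow> b \<in> lattice \<tau> \<Longrightarrow> a + b \<in> lattice \<tau>"
proof -
  assume "a \<in> lattice \<tau>" "b \<in> lattice \<tau>"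
  then obtain m n m' n' :: int where "a = of_int m + of_int n * \<tau>" "b = of_int m' + of_int n' * \<tau>"
    unfolding lattice_def by blast
  then have "a + b = of_int (m + m') + of_int (n + n') * \<tau>" by (simp add: algebra_simps)
  then show "a + b \<in> lattice \<tau>" unfolding lattice_def by blast
qed

lemma lattice_uminus: "a \<in> lattice \<tau> \<Longrightarrow> - a \<in> lattice \<tau>"
proof -
  assume "a \<in> lattice \<tau>"
  then obtain m n :: int where "a = of_int m + of_int n * \<tau>" unfolding lattice_def by blast
  then have "- a = of_int (- m) + of_int (- n) * \<tau>" by simp
  then show "- a \<in> lattice \<tau>" unfolding lattice_def by blast
qed

lemma mem_proj_iff: "w \<in> proj \<tau> z \<longleftrightarrow> w - z \<in> lattice \<tau>"
  by (force simp: proj_def)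

lemma proj_self: "z \<in> proj \<tau> z"
  by (simp add: mem_proj_iff zero_in_lattice)

lemma proj_eq_iff: "proj \<tau> z = proj \<tau> w \<longleftrightarrow> w - z \<in> lattice \<tau>"
proof
  assume "proj \<tau> z = proj \<tau> w"
  then have "w \<in> proj \<tau> z" by (simp add: proj_self)
  then show "w - z \<in> lattice \<tau>" by (simp add: mem_proj_iff)
next
  assume *: "w - z \<in> lattice \<tau>"
  have "u - z \<in> lattice \<tau> \<longleftrightarrow> u - w \<in> lattice \<tau>" for u
    using lattice_add[OF _ *, of "u - w"] lattice_add[OF _ lattice_uminus[OF *], of "u - z"] by auto
  then show "proj \<tau> z = proj \<tau> w" by (auto simp: mem_proj_iff)
qed

lemma proj_add_lattice: "l \<in> lattice \<tau> \<Longrightarrow> proj \<tau> (z + l) = proj \<tau> z"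
  using proj_eq_iff[of \<tau> z "z + l"] by simp

lemma proj_in_torus: "proj \<tau> z \<in> torus \<tau>"
  by (simp add: torus_def)

lemma proj_some: "proj \<tau> (SOME w. w \<in> proj \<tau> z) = proj \<tau> z"
proof -
  have "(SOME w. w \<in> proj \<tau> z) \<in> proj \<tau> z" using proj_self by (rule someI)
  then show ?thesis by (metis proj_eq_iff mem_proj_iff)
qed

lemma frechet_derivative_translate:
  fixes f :: "complex \<Rightarrow> real"
  shows "frechet_derivative (\<lambda>w. f (w + l)) (at z) = frechet_derivative f (at (z + l))"
proof -
  have "((\<lambda>w. f (w + l)) has_derivative D) (at z)" if "(f has_derivative D) (at (z + l))" for f :: "complex \<Rightarrow> real" and D l z
    using has_derivative_compose[of "\<lambda>w. w + l" "\<lambda>h. h" z UNIV f D] that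
    by (simp add: has_derivative_add_const[OF has_derivative_ident, unfolded])
  from this[of f _ z l] this[of "\<lambda>w. f (w + l)" _ "z + l" "- l"] show ?thesis
    unfolding frechet_derivative_def by (intro arg_cong[where f = Eps] ext) auto
qed

lemma laplacian_translate: "laplacian (\<lambda>w. f (w + l)) z = laplacian f (z + l)"
  by (simp add: laplacian_def frechet_derivative_translate
        frechet_derivative_translate[where f = "\<lambda>w. frechet_derivative f (at w) _"])

text \<open>
  By periodicity the representative chosen in \<open>torus_laplacian\<close> may be replaced by any other one.
\<close>

lemma torus_laplacian_proj:
  "torus_laplacian \<tau> u (proj \<tau> z) = Im \<tau> * laplacian (\<lambda>w. u (proj \<tau> w)) z"
proof -
  define z' where "z' = (SOME w. w \<in> proj \<tau> z)"
  have l: "z' - z \<in> lattice \<tau>" using proj_some[of \<tau> z] proj_eq_iff[of \<tau> z z'] by (simp add: z'_def)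
  have "laplacian (\<lambda>w. u (proj \<tau> w)) z' = laplacian (\<lambda>w. u (proj \<tau> (w + (z' - z)))) z"
    using laplacian_translate[of "\<lambda>w. u (proj \<tau> w)" "z' - z" z] by simp
  also have "(\<lambda>w. u (proj \<tau> (w + (z' - z)))) = (\<lambda>w. u (proj \<tau> w))"
    by (simp add: proj_add_lattice[OF l])
  finally show ?thesis by (simp add: torus_laplacian_def z'_def)
qed

lemma fund_parallelogram_bounded:
  assumes "Im \<tau> > 0"
  shows "fund_parallelogram \<tau> \<subseteq> cball 0 (1 + cmod \<tau>)"
proof
  fix z assume "z \<in> fund_parallelogram \<tau>"
  then obtain s t :: real where z: "z = of_real s + of_real t * \<tau>" "s \<in> {0..<1}" "t \<in> {0..<1}"
    unfolding fund_parallelogram_def by blast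
  have "cmod z \<le> \<bar>s\<bar> + \<bar>t\<bar> * cmod \<tau>"
    unfolding z(1) using norm_triangle_ineq[of "of_real s" "of_real t * \<tau>"] by (simp add: norm_mult)
  also have "\<dots> \<le> 1 + 1 * cmod \<tau>" using z by (intro add_mono mult_right_mono) auto
  finally show "z \<in> cball 0 (1 + cmod \<tau>)" by simp
qed

lemma continuous_set_integrable_fund_parallelogram:
  fixes f :: "complex \<Rightarrow> complex"
  assumes "Im \<tau> > 0" "continuous_on UNIV f"
  shows "set_integrable lborel (fund_parallelogram \<tau>) f"
proof (rule set_integrable_subset)
  show "set_integrable lborel (cball 0 (1 + cmod \<tau>)) f"
    unfolding set_integrable_def
    by (rule borel_integrable_compact) (auto intro: continuous_on_subset[OF assms(2)])
qed (use assms fund_parallelogram_measurable fund_parallelogram_bounded in auto)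

lemma emeasure_fund_parallelogram:
  assumes "Im \<tau> > 0"
  shows "emeasure lborel (fund_parallelogram \<tau>) = ennreal (Im \<tau>)"
proof -
  have "emeasure lborel (fund_parallelogram \<tau>) = (\<integral>\<^sup>+ z\<in>fund_parallelogram \<tau>. 1 \<partial>lborel)"
    using fund_parallelogram_measurable[OF assms] by simp
  also have "\<dots> = ennreal (Im \<tau>)"
    by (subst nn_integral_fund_parallelogram[OF assms]) auto
  finally show ?thesis .
qed

lemma torus_integral_const:
  fixes c :: real
  assumes "Im \<tau> > 0"
  shows "torus_integral \<tau> (\<lambda>_. c) = c"
  using assms emeasure_fund_parallelogram[OF assms] fund_parallelogram_measurable[OF assms]
  by (simp add: torus_integral_def set_lebesgue_integral_def measure_def)

lemma torus_integral_nonneg_le: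
  fixes f :: "complex \<Rightarrow> real"
  assumes T: "Im \<tau> > 0" and f: "\<And>z. F (proj \<tau> z) = complex_of_real (f z)" "\<And>z. f z \<ge> 0"
    and cont: "continuous_on UNIV f"
    and le: "(\<integral>\<^sup>+ z\<in>fund_parallelogram \<tau>. ennreal (f z) \<partial>lborel) \<le> ennreal (Im \<tau> * B)" and B: "B \<ge> 0"
  shows "Re (torus_integral \<tau> F) \<le> B"
proof -
  note fund_parallelogram_measurable[OF T, measurable]
  have [measurable]: "f \<in> borel_measurable borel" using cont by (rule borel_measurable_continuous_onI)
  let ?g = "\<lambda>z. indicator (fund_parallelogram \<tau>) z * f z"
  have int: "integrable lborel ?g"
    using continuous_set_integrable_fund_parallelogram[OF T, of "\<lambda>z. complex_of_real (f z)"] cont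
    unfolding set_integrable_def
    by (auto dest!: integrable_Re intro!: continuous_intros)
  have "torus_integral \<tau> F = of_real (integral\<^sup>L lborel ?g) /\<^sub>R Im \<tau>"
  proof -
    have "indicator (fund_parallelogram \<tau>) z *\<^sub>R complex_of_real (f z) = complex_of_real (?g z)" for z
      by (simp add: scaleR_conv_of_real)
    then show ?thesis
      unfolding torus_integral_def set_lebesgue_integral_def f(1) by (simp only: integral_complex_of_real)
  qed
  moreover have "ennreal (integral\<^sup>L lborel ?g) \<le> ennreal (Im \<tau> * B)"
  proof -
    have "ennreal (integral\<^sup>L lborel ?g) = (\<integral>\<^sup>+ z. ennreal (?g z) \<partial>lborel)"
      by (rule nn_integral_eq_integral[OF int, symmetric]) (use f(2) in auto)
    also have "\<dots> = (\<integral>\<^sup>+ z\<in>fund_parallelogram \<tau>. ennreal (f z) \<partial>lborel)"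
      by (intro nn_integral_cong) (auto simp: indicator_def)
    finally show ?thesis using le by simp
  qed
  then have "integral\<^sup>L lborel ?g \<le> Im \<tau> * B" using T B by (simp add: ennreal_le_iff)
  ultimately show ?thesis using T by (simp add: field_simps)
qed

section \<open>Extremal property of the Bergman kernel\<close>

text \<open>
  This class is closed under the twist by the flat metric of the canonical bundle, and continuity already
  makes the pairings of holomorphic sections integrable over the torus.
\<close>

definition continuous_metric ::
    "complex \<Rightarrow> 'i line_bundle \<Rightarrow> ('i \<Rightarrow> complex set \<Rightarrow> real) \<Rightarrow> bool" where
  "continuous_metric \<tau> L h \<longleftrightarrow>
     (\<forall>i\<in>bindex L. torus_open \<tau> (bdom L i)) \<and> (\<Union>i\<in>bindex L. bdom L i) = torus \<tau> \<and>
     (\<forall>i\<in>bindex L. continuous_on (proj \<tau> -` bdom L i) (\<lambda>z. h i (proj \<tau> z)) \<and> (\<forall>P\<in>bdom L i. h i P > 0)) \<and>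
     (\<forall>i\<in>bindex L. \<forall>j\<in>bindex L. \<forall>P \<in> bdom L i \<inter> bdom L j.
        h j P = (cmod (btrans L i j P))\<^sup>2 * h i P)"

lemma frame_at:
  assumes "continuous_metric \<tau> L h" "P \<in> torus \<tau>"
  shows "frame_at L P \<in> bindex L" "P \<in> bdom L (frame_at L P)"
proof -
  have "\<exists>i. i \<in> bindex L \<and> P \<in> bdom L i"
    using assms unfolding continuous_metric_def by blast
  from someI_ex[OF this] show "frame_at L P \<in> bindex L" "P \<in> bdom L (frame_at L P)"
    unfolding frame_at_def by auto
qed

lemma pairing_frame_independent:
  assumes M: "continuous_metric \<tau> L h" and s: "holomorphic_section \<tau> L s" and t: "holomorphic_section \<tau> L t"
    and ij: "i \<in> bindex L" "j \<in> bindex L" "P \<in> bdom L i" "P \<in> bdom L j"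
  shows "of_real (h i P) * s i P * cnj (t i P) = of_real (h j P) * s j P * cnj (t j P)"
proof -
  let ?g = "btrans L i j P"
  have "s i P = ?g * s j P" "t i P = ?g * t j P"
    using s t ij unfolding holomorphic_section_def by blast+
  moreover have "h j P = (cmod ?g)\<^sup>2 * h i P" using M ij unfolding continuous_metric_def by blast
  moreover have "of_real ((cmod ?g)\<^sup>2) = ?g * cnj ?g" by (rule complex_norm_square)
  ultimately show ?thesis by (simp add: mult_ac)
qed

text \<open>
  Near a point \<open>z\<close> the pairing may be computed in the frame chosen at \<open>z\<close>, although
  \<open>frame_at\<close> itself need not be locally constant.
\<close>

lemma pairing_continuous:
  assumes M: "continuous_metric \<tau> L h" and s: "holomorphic_section \<tau> L s" and t: "holomorphic_section \<tau> L t"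
  shows "continuous_on UNIV (\<lambda>z. let i = frame_at L (proj \<tau> z) in
           of_real (h i (proj \<tau> z)) * s i (proj \<tau> z) * cnj (t i (proj \<tau> z)))"
    (is "continuous_on UNIV ?f")
proof -
  have "isCont ?f z" for z
  proof -
    define i where "i = frame_at L (proj \<tau> z)"
    note i = frame_at[OF M proj_in_torus[of \<tau> z], folded i_def]
    define S where "S = proj \<tau> -` bdom L i"
    have S: "open S" "z \<in> S" using M i unfolding S_def continuous_metric_def torus_open_def by auto
    have "continuous_on S (\<lambda>z. of_real (h i (proj \<tau> z)) * s i (proj \<tau> z) * cnj (t i (proj \<tau> z)))"
    proof -
      have "continuous_on S (\<lambda>z. h i (proj \<tau> z))"
        using M i unfolding S_def continuous_metric_def by blast
      moreover have "continuous_on S (\<lambda>z. s i (proj \<tau> z))" "continuous_on S (\<lambda>z. t i (proj \<tau> z))"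
        using s t i unfolding S_def holomorphic_section_def torus_holomorphic_on_def
        by (blast intro: holomorphic_on_imp_continuous_on)+
      ultimately show ?thesis by (intro continuous_intros)
    qed
    moreover have "?f w = of_real (h i (proj \<tau> w)) * s i (proj \<tau> w) * cnj (t i (proj \<tau> w))" if "w \<in> S" for w
      unfolding Let_def
      by (rule pairing_frame_independent[OF M s t]) (use frame_at[OF M proj_in_torus] i that in \<open>auto simp: S_def\<close>)
    ultimately have "continuous_on S ?f" by (simp cong: continuous_on_cong)
    then show ?thesis using S continuous_on_eq_continuous_at by blast
  qed
  then show ?thesis by (simp add: continuous_at_imp_continuous_on)
qed

lemma section_inner_sum:
  assumes T: "Im \<tau> > 0" and M: "continuous_metric \<tau> L h"
    and \<sigma>: "\<And>k. k < n \<Longrightarrow> holomorphic_section \<tau> L (\<sigma> k)"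
    and s: "\<And>i P. i \<in> bindex L \<Longrightarrow> P \<in> bdom L i \<Longrightarrow> s i P = (\<Sum>k<n. a k * \<sigma> k i P)"
  shows "section_inner \<tau> L h s s = (\<Sum>k<n. \<Sum>l<n. a k * cnj (a l) * section_inner \<tau> L h (\<sigma> k) (\<sigma> l))"
proof -
  let ?F = "fund_parallelogram \<tau>"
  define f where "f k l z = (let i = frame_at L (proj \<tau> z) in
           of_real (h i (proj \<tau> z)) * \<sigma> k i (proj \<tau> z) * cnj (\<sigma> l i (proj \<tau> z)))" for k l z
  have int: "integrable lborel (\<lambda>z. indicator ?F z *\<^sub>R f k l z)" if "k < n" "l < n" for k l
    using continuous_set_integrable_fund_parallelogram[OF T pairing_continuous[OF M \<sigma> \<sigma>]] that
    unfolding set_integrable_def f_def by blast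
  have "(let i = frame_at L (proj \<tau> z) in of_real (h i (proj \<tau> z)) * s i (proj \<tau> z) * cnj (s i (proj \<tau> z))) =
      (\<Sum>k<n. \<Sum>l<n. a k * cnj (a l) * f k l z)" for z
  proof -
    define i where "i = frame_at L (proj \<tau> z)"
    have "of_real (h i (proj \<tau> z)) * s i (proj \<tau> z) * cnj (s i (proj \<tau> z)) = of_real (h i (proj \<tau> z)) *
        ((\<Sum>k<n. a k * \<sigma> k i (proj \<tau> z)) * (\<Sum>l<n. cnj (a l) * cnj (\<sigma> l i (proj \<tau> z))))"
      using frame_at[OF M proj_in_torus[of \<tau> z]] by (simp add: s i_def[symmetric] mult.assoc)
    also have "\<dots> = (\<Sum>k<n. \<Sum>l<n. a k * cnj (a l) * f k l z)"
      by (subst sum_product) (simp add: sum_distrib_left f_def Let_def i_def[symmetric] mult_ac)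
    finally show ?thesis by (simp add: Let_def i_def)
  qed
  moreover define g where "g k l z = indicator ?F z *\<^sub>R f k l z" for k l z
  ultimately have "section_inner \<tau> L h s s =
      (LINT z|lborel. (\<Sum>k<n. \<Sum>l<n. a k * cnj (a l) * g k l z)) /\<^sub>R Im \<tau>"
    unfolding section_inner_def torus_integral_def set_lebesgue_integral_def
    by (simp add: scaleR_sum_right)
  also have "(LINT z|lborel. (\<Sum>k<n. \<Sum>l<n. a k * cnj (a l) * g k l z)) =
      (\<Sum>k<n. \<Sum>l<n. a k * cnj (a l) * (LINT z|lborel. g k l z))"
  proof -
    have i: "integrable lborel (\<lambda>z. a k * cnj (a l) * g k l z)" if "k < n" "l < n" for k l
      using int[OF that] unfolding g_def by (rule integrable_mult_right)
    have "(LINT z|lborel. (\<Sum>k<n. \<Sum>l<n. a k * cnj (a l) * g k l z)) =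
        (\<Sum>k<n. LINT z|lborel. (\<Sum>l<n. a k * cnj (a l) * g k l z))"
      by (rule Bochner_Integration.integral_sum) (auto intro!: Bochner_Integration.integrable_sum i)
    also have "\<dots> = (\<Sum>k<n. \<Sum>l<n. (LINT z|lborel. a k * cnj (a l) * g k l z))"
      by (intro sum.cong refl Bochner_Integration.integral_sum) (auto intro: i)
    finally show ?thesis by simp
  qed
  also have "\<dots> /\<^sub>R Im \<tau> = (\<Sum>k<n. \<Sum>l<n. a k * cnj (a l) * section_inner \<tau> L h (\<sigma> k) (\<sigma> l))"
    unfolding section_inner_def torus_integral_def set_lebesgue_integral_def f_def g_def
    by (simp add: scaleR_sum_right)
  finally show ?thesis .
qed

text \<open>
  Expand \<open>s\<close> in the orthonormal basis: its squared norm is the sum of the squared coefficients, and the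
  claim is the Cauchy--Schwarz inequality for the value at \<open>P\<close>.
\<close>

theorem bergman_kernel_extremal:
  assumes T: "Im \<tau> > 0" and M: "continuous_metric \<tau> L h" and \<kappa>: "is_bergman_kernel \<tau> L h \<kappa>"
    and s: "holomorphic_section \<tau> L s" and P: "P \<in> torus \<tau>" "i \<in> bindex L" "P \<in> bdom L i"
  shows "h i P * (cmod (s i P))\<^sup>2 \<le> kernel_norm L h \<kappa> P * Re (section_inner \<tau> L h s s)"
proof -
  obtain n \<sigma> where on: "orthonormal_basis \<tau> L h n \<sigma>"
    and \<kappa>: "\<kappa> = (\<lambda>i j P Q. \<Sum>k<n. \<sigma> k i P * cnj (\<sigma> k j Q))"
    using \<kappa> unfolding is_bergman_kernel_def by blast
  then obtain a where a: "\<And>i P. i \<in> bindex L \<Longrightarrow> P \<in> bdom L i \<Longrightarrow> s i P = (\<Sum>k<n. a k * \<sigma> k i P)"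
    using s unfolding orthonormal_basis_def by blast
  define j where "j = frame_at L P"
  note j = frame_at[OF M P(1), folded j_def]
  have hj: "h j P > 0" using M j unfolding continuous_metric_def by blast
  have "section_inner \<tau> L h s s = (\<Sum>k<n. \<Sum>l<n. a k * cnj (a l) * section_inner \<tau> L h (\<sigma> k) (\<sigma> l))"
    by (rule section_inner_sum[OF T M _ a]) (use on in \<open>auto simp: orthonormal_basis_def\<close>)
  also have "\<dots> = (\<Sum>k<n. \<Sum>l<n. if k = l then a k * cnj (a l) else 0)"
    using on by (intro sum.cong) (auto simp: orthonormal_basis_def)
  also have "\<dots> = (\<Sum>k<n. of_real ((cmod (a k))\<^sup>2))"
    by (simp add: complex_norm_square del: of_real_power)
  finally have inner: "Re (section_inner \<tau> L h s s) = (\<Sum>k<n. (cmod (a k))\<^sup>2)" by simp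
  have "\<kappa> j j P P = of_real (\<Sum>k<n. (cmod (\<sigma> k j P))\<^sup>2)"
    unfolding \<kappa> of_real_sum by (simp only: complex_norm_square)
  then have K: "cmod (\<kappa> j j P P) = (\<Sum>k<n. (cmod (\<sigma> k j P))\<^sup>2)"
    by (simp only: norm_of_real) (simp add: sum_nonneg)
  have "of_real (h i P * (cmod (s i P))\<^sup>2) = complex_of_real (h j P * (cmod (s j P))\<^sup>2)"
    using pairing_frame_independent[OF M s s P(2) j(1) P(3) j(2)]
    by (simp only: of_real_mult complex_norm_square mult.assoc)
  then have "h i P * (cmod (s i P))\<^sup>2 = h j P * (cmod (s j P))\<^sup>2" by (simp only: of_real_eq_iff)
  also have "(cmod (s j P))\<^sup>2 \<le> (\<Sum>k<n. (cmod (a k))\<^sup>2) * (\<Sum>k<n. (cmod (\<sigma> k j P))\<^sup>2)"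
  proof -
    have "cmod (s j P) \<le> (\<Sum>k<n. cmod (a k) * cmod (\<sigma> k j P))"
      unfolding a[OF j] by (rule order_trans[OF norm_sum]) (simp add: norm_mult)
    then have "(cmod (s j P))\<^sup>2 \<le> (\<Sum>k<n. cmod (a k) * cmod (\<sigma> k j P))\<^sup>2"
      by (intro power_mono) auto
    also have "\<dots> \<le> (\<Sum>k<n. (cmod (a k))\<^sup>2) * (\<Sum>k<n. (cmod (\<sigma> k j P))\<^sup>2)"
      by (rule Cauchy_Schwarz_ineq_sum)
    finally show ?thesis .
  qed
  finally show ?thesis
    using hj by (simp add: kernel_norm_def Let_def j_def[symmetric] K inner mult_ac)
qed

section \<open>A global frame of constant curvature\<close>

text \<open>
  A holomorphic section \<open>u\<close> over \<open>A \<subseteq> \<complex>\<close> of the pullback of \<open>L\<close>, given by its coefficients in the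
  pulled back frames, whose squared norm is \<open>exp (- c \<bar>z\<bar>\<^sup>2)\<close>. With respect to it the metric becomes the
  standard Gaussian weight of constant curvature.
\<close>

definition flat_frame ::
    "complex \<Rightarrow> 'i line_bundle \<Rightarrow> ('i \<Rightarrow> complex set \<Rightarrow> real) \<Rightarrow> real \<Rightarrow> complex set \<Rightarrow>
     ('i \<Rightarrow> complex \<Rightarrow> complex) \<Rightarrow> bool" where
  "flat_frame \<tau> L h c A u \<longleftrightarrow>
     (\<forall>i\<in>bindex L. u i holomorphic_on (A \<inter> proj \<tau> -` bdom L i)) \<and>
     (\<forall>i\<in>bindex L. \<forall>j\<in>bindex L. \<forall>z\<in>A. proj \<tau> z \<in> bdom L i \<inter> bdom L j \<longrightarrow>
        u i z = btrans L i j (proj \<tau> z) * u j z) \<and>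
     (\<forall>i\<in>bindex L. \<forall>z\<in>A. proj \<tau> z \<in> bdom L i \<longrightarrow>
        (cmod (u i z))\<^sup>2 * h i (proj \<tau> z) = exp (- c * (cmod z)\<^sup>2))"

lemma line_bundleD:
  assumes "holomorphic_line_bundle \<tau> L"
  shows "\<And>i. i \<in> bindex L \<Longrightarrow> open (proj \<tau> -` bdom L i)"
    and "\<And>i. i \<in> bindex L \<Longrightarrow> torus_open \<tau> (bdom L i)"
    and "(\<Union>i\<in>bindex L. bdom L i) = torus \<tau>"
    and "\<And>i j. i \<in> bindex L \<Longrightarrow> j \<in> bindex L \<Longrightarrow>
           (\<lambda>z. btrans L i j (proj \<tau> z)) holomorphic_on (proj \<tau> -` (bdom L i \<inter> bdom L j))"
    and "\<And>i j P. i \<in> bindex L \<Longrightarrow> j \<in> bindex L \<Longrightarrow> P \<in> bdom L i \<inter> bdom L j \<Longrightarrow> btrans L i j P \<noteq> 0"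
    and "\<And>i j k P. i \<in> bindex L \<Longrightarrow> j \<in> bindex L \<Longrightarrow> k \<in> bindex L \<Longrightarrow>
           P \<in> bdom L i \<inter> bdom L j \<inter> bdom L k \<Longrightarrow> btrans L i j P * btrans L j k P = btrans L i k P"
  using assms unfolding holomorphic_line_bundle_def torus_open_def torus_holomorphic_on_def by blast+

lemma hermitian_metricD:
  assumes "hermitian_metric \<tau> L h"
  shows "\<And>i k. i \<in> bindex L \<Longrightarrow> Ck_on k (proj \<tau> -` bdom L i) (\<lambda>z. h i (proj \<tau> z))"
    and "\<And>i P. i \<in> bindex L \<Longrightarrow> P \<in> bdom L i \<Longrightarrow> h i P > 0"
    and "\<And>i j P. i \<in> bindex L \<Longrightarrow> j \<in> bindex L \<Longrightarrow> P \<in> bdom L i \<inter> bdom L j \<Longrightarrow>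
           h j P = (cmod (btrans L i j P))\<^sup>2 * h i P"
  using assms unfolding hermitian_metric_def torus_smooth_on_def torus_Ck_on_def by blast+

lemma flat_frameD:
  assumes "flat_frame \<tau> L h c A u"
  shows "\<And>i. i \<in> bindex L \<Longrightarrow> u i holomorphic_on (A \<inter> proj \<tau> -` bdom L i)"
    and "\<And>i j z. i \<in> bindex L \<Longrightarrow> j \<in> bindex L \<Longrightarrow> z \<in> A \<Longrightarrow> proj \<tau> z \<in> bdom L i \<Longrightarrow>
           proj \<tau> z \<in> bdom L j \<Longrightarrow> u i z = btrans L i j (proj \<tau> z) * u j z"
    and "\<And>i z. i \<in> bindex L \<Longrightarrow> z \<in> A \<Longrightarrow> proj \<tau> z \<in> bdom L i \<Longrightarrow>
           (cmod (u i z))\<^sup>2 * h i (proj \<tau> z) = exp (- c * (cmod z)\<^sup>2)"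
  using assms unfolding flat_frame_def by blast+

lemma hermitian_imp_continuous_metric:
  assumes "holomorphic_line_bundle \<tau> L" "hermitian_metric \<tau> L h"
  shows "continuous_metric \<tau> L h"
proof -
  have "continuous_on (proj \<tau> -` bdom L i) (\<lambda>z. h i (proj \<tau> z))" if "i \<in> bindex L" for i
    using hermitian_metricD(1)[OF assms(2) that, of 0] by simp
  then show ?thesis
    unfolding continuous_metric_def
    using line_bundleD(2,3)[OF assms(1)] hermitian_metricD(2,3)[OF assms(2)] by blast
qed

lemma log_metric_Ck:
  assumes "holomorphic_line_bundle \<tau> L" "hermitian_metric \<tau> L h" "i \<in> bindex L"
  shows "Ck_on k (proj \<tau> -` bdom L i) (\<lambda>z. ln (h i (proj \<tau> z)))"
  using hermitian_metricD[OF assms(2)] line_bundleD(1)[OF assms(1)] assms(3) by (intro Ck_on_ln) blast+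

text \<open>
  The Chern density is defined in the frame chosen at each point. Changing to frame \<open>i\<close> adds
  \<open>log \<bar>g\<bar>\<^sup>2\<close> with \<open>g\<close> holomorphic and nonzero, the real part of a local holomorphic
  logarithm, hence harmonic.
\<close>

lemma log_metric_laplacian:
  assumes T: "Im \<tau> > 0" and L: "holomorphic_line_bundle \<tau> L" and H: "hermitian_metric \<tau> L h"
    and curv: "\<forall>P\<in>torus \<tau>. c1_density \<tau> L h P = b"
    and i: "i \<in> bindex L" "proj \<tau> z \<in> bdom L i"
  shows "laplacian (\<lambda>w. ln (h i (proj \<tau> w))) z = - 4 * (pi * b / Im \<tau>)"
proof -
  define j where "j = frame_at L (proj \<tau> z)"
  note j = frame_at[OF hermitian_imp_continuous_metric[OF L H] proj_in_torus[of \<tau> z], folded j_def]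
  have "c1_density \<tau> L h (proj \<tau> z) = b" using curv proj_in_torus by blast
  then have lj: "laplacian (\<lambda>w. ln (h j (proj \<tau> w))) z = - 4 * (pi * b / Im \<tau>)"
    using T by (simp add: c1_density_def torus_laplacian_proj j_def[symmetric] field_simps)
  define S where "S = proj \<tau> -` bdom L i \<inter> proj \<tau> -` bdom L j"
  have S: "open S" "z \<in> S"
    using line_bundleD(1)[OF L] i j unfolding S_def by auto
  then obtain r where r: "r > 0" "ball z r \<subseteq> S" using open_contains_ball by blast
  define g where "g w = btrans L i j (proj \<tau> w)" for w
  have g: "g holomorphic_on ball z r" "\<And>w. w \<in> ball z r \<Longrightarrow> g w \<noteq> 0"
  proof -
    show "g holomorphic_on ball z r"
      unfolding g_def by (rule holomorphic_on_subset[OF line_bundleD(4)[OF L i(1) j(1)]]) (use r(2) in \<open>unfold S_def, blast\<close>)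
    show "g w \<noteq> 0" if "w \<in> ball z r" for w
      unfolding g_def by (rule line_bundleD(5)[OF L i(1) j(1)]) (use r(2) that in \<open>unfold S_def, blast\<close>)
  qed
  have "contractible (ball z r)" by (simp add: convex_imp_contractible)
  then obtain \<gamma> where \<gamma>: "\<gamma> holomorphic_on ball z r" "\<And>w. w \<in> ball z r \<Longrightarrow> g w = exp (\<gamma> w)"
    using contractible_imp_holomorphic_log[OF g(1)] g(2) by metis
  have eq: "ln (h j (proj \<tau> w)) = Re (2 * \<gamma> w) + ln (h i (proj \<tau> w))" if w: "w \<in> ball z r" for w
  proof -
    have P: "proj \<tau> w \<in> bdom L i \<inter> bdom L j" using w r(2) unfolding S_def by blast
    have "h j (proj \<tau> w) = (cmod (g w))\<^sup>2 * h i (proj \<tau> w)" "h i (proj \<tau> w) > 0"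
      using hermitian_metricD[OF H] i(1) j(1) P unfolding g_def by blast+
    moreover have "(cmod (g w))\<^sup>2 = exp (Re (2 * \<gamma> w))"
      using w by (simp add: \<gamma>(2) exp_double)
    ultimately show ?thesis by (simp add: ln_mult)
  qed
  have B: "open (ball z r)" "z \<in> ball z r" using r by auto
  have C: "Ck_on 2 (ball z r) (\<lambda>w. ln (h i (proj \<tau> w)))" "Ck_on 2 (ball z r) (\<lambda>w. ln (h j (proj \<tau> w)))"
    by (rule Ck_on_subset[OF log_metric_Ck[OF L H i(1)]], use r(2) in \<open>force simp: S_def\<close>)
       (rule Ck_on_subset[OF log_metric_Ck[OF L H j(1)]], use r(2) in \<open>force simp: S_def\<close>)
  have h2: "(\<lambda>w. 2 * \<gamma> w) holomorphic_on ball z r" by (intro holomorphic_intros \<gamma>)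
  have "laplacian (\<lambda>w. ln (h j (proj \<tau> w))) z = laplacian (\<lambda>w. Re (2 * \<gamma> w) + ln (h i (proj \<tau> w))) z"
    by (rule laplacian_cong[OF B eq C(2)])
  also have "\<dots> = laplacian (\<lambda>w. Re (2 * \<gamma> w)) z + laplacian (\<lambda>w. ln (h i (proj \<tau> w))) z"
    by (rule laplacian_add[OF B Ck_on_Re_holomorphic[OF B(1) h2] C(1)])
  also have "laplacian (\<lambda>w. Re (2 * \<gamma> w)) z = 0" by (rule laplacian_Re_holomorphic[OF B h2])
  finally show ?thesis using lj by simp
qed

text \<open>
  The function \<open>log h\<^sub>i + c \<bar>z\<bar>\<^sup>2\<close> is harmonic, hence \<open>Re F\<close> with \<open>F\<close> holomorphic, and
  \<open>exp (- F / 2)\<close> is the coefficient of the required section in frame \<open>i\<close>.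
\<close>

lemma flat_frame_local:
  assumes L: "holomorphic_line_bundle \<tau> L" and H: "hermitian_metric \<tau> L h"
    and lap: "\<And>z. proj \<tau> z \<in> bdom L i \<Longrightarrow> laplacian (\<lambda>w. ln (h i (proj \<tau> w))) z = - 4 * c"
    and i: "i \<in> bindex L" and B: "open B" "convex B" "B \<subseteq> proj \<tau> -` bdom L i"
  shows "\<exists>u. flat_frame \<tau> L h c B u"
proof -
  define \<rho> where "\<rho> z = ln (h i (proj \<tau> z)) + c * (cmod (z - 0))\<^sup>2" for z
  have C: "Ck_on 2 B (\<lambda>z. ln (h i (proj \<tau> z)))" by (rule Ck_on_subset[OF log_metric_Ck[OF L H i] B(3)])
  note N = Ck_on_norm_squared[OF B(1), of 2 c 0]
  have "Ck_on 2 B \<rho>" unfolding \<rho>_def by (intro Ck_on_add B C N)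
  moreover have "laplacian \<rho> z = 0" if "z \<in> B" for z
    using laplacian_add[OF B(1) that C N] lap[of z] that B(3)
    unfolding \<rho>_def laplacian_norm_squared by auto
  ultimately obtain F where F: "F holomorphic_on B" "\<And>z. z \<in> B \<Longrightarrow> \<rho> z = Re (F z)"
    using harmonic_is_Re_holomorphic[OF _ B(1,2)] by metis
  define u where "u j z = btrans L j i (proj \<tau> z) * exp (- F z / 2)" for j z
  have norm: "(cmod (u j z))\<^sup>2 * h j (proj \<tau> z) = exp (- c * (cmod z)\<^sup>2)"
    if j: "j \<in> bindex L" and z: "z \<in> B" "proj \<tau> z \<in> bdom L j" for j z
  proof -
    have P: "proj \<tau> z \<in> bdom L j \<inter> bdom L i" using z B(3) by blast
    have hi: "h i (proj \<tau> z) = (cmod (btrans L j i (proj \<tau> z)))\<^sup>2 * h j (proj \<tau> z)" "h i (proj \<tau> z) > 0"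
      using hermitian_metricD[OF H] i j P by blast+
    have "(cmod (exp (- F z / 2)))\<^sup>2 = exp (- Re (F z))"
      by (simp add: exp_double[symmetric] power2_eq_square exp_add[symmetric])
    then have "(cmod (u j z))\<^sup>2 * h j (proj \<tau> z) = h i (proj \<tau> z) * exp (- Re (F z))"
      by (simp add: u_def norm_mult power_mult_distrib hi(1) mult_ac del: norm_exp_eq_Re)
    also have "h i (proj \<tau> z) = exp (ln (h i (proj \<tau> z)))" using hi(2) by simp
    also have "\<dots> * exp (- Re (F z)) = exp (- c * (cmod z)\<^sup>2)"
      unfolding exp_add[symmetric] F(2)[OF z(1), symmetric] \<rho>_def by simp
    finally show ?thesis .
  qed
  have hol: "u j holomorphic_on (B \<inter> proj \<tau> -` bdom L j)" if j: "j \<in> bindex L" for j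
  proof -
    have "(\<lambda>z. btrans L j i (proj \<tau> z)) holomorphic_on (proj \<tau> -` (bdom L j \<inter> bdom L i))"
      by (rule line_bundleD(4)[OF L j i])
    then have "(\<lambda>z. btrans L j i (proj \<tau> z)) holomorphic_on (B \<inter> proj \<tau> -` bdom L j)"
      by (rule holomorphic_on_subset) (use B(3) in auto)
    moreover have "F holomorphic_on (B \<inter> proj \<tau> -` bdom L j)"
      using F(1) by (rule holomorphic_on_subset) auto
    ultimately show ?thesis unfolding u_def by (intro holomorphic_intros) auto
  qed
  have cocycle: "u j z = btrans L j k (proj \<tau> z) * u k z"
    if "j \<in> bindex L" "k \<in> bindex L" "z \<in> B" "proj \<tau> z \<in> bdom L j \<inter> bdom L k" for j k z
  proof -
    have "proj \<tau> z \<in> bdom L j \<inter> bdom L k \<inter> bdom L i" using that B(3) by blast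
    then have "btrans L j k (proj \<tau> z) * btrans L k i (proj \<tau> z) = btrans L j i (proj \<tau> z)"
      using line_bundleD(6)[OF L] i that by blast
    then show ?thesis by (simp add: u_def mult.assoc[symmetric])
  qed
  show ?thesis unfolding flat_frame_def using norm hol cocycle by blast
qed

lemma flat_frame_nonzero:
  assumes "flat_frame \<tau> L h c A u" "i \<in> bindex L" "z \<in> A" "proj \<tau> z \<in> bdom L i"
  shows "u i z \<noteq> 0"
proof
  assume "u i z = 0"
  moreover have "(cmod (u i z))\<^sup>2 * h i (proj \<tau> z) = exp (- c * (cmod z)\<^sup>2)"
    by (rule flat_frameD(3)[OF assms])
  ultimately show False by simp
qed

lemma flat_frame_mono: "flat_frame \<tau> L h c A u \<Longrightarrow> B \<subseteq> A \<Longrightarrow> flat_frame \<tau> L h c B u"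
  unfolding flat_frame_def by (blast intro: holomorphic_on_subset)

lemma flat_frame_scale:
  assumes "flat_frame \<tau> L h c A u" "cmod a = 1"
  shows "flat_frame \<tau> L h c A (\<lambda>i z. a * u i z)"
proof -
  have "(\<lambda>z. a * u i z) holomorphic_on (A \<inter> proj \<tau> -` bdom L i)" if "i \<in> bindex L" for i
    by (intro holomorphic_intros flat_frameD(1)[OF assms(1) that])
  moreover have "a * u i z = btrans L i j (proj \<tau> z) * (a * u j z)"
    if "i \<in> bindex L" "j \<in> bindex L" "z \<in> A" "proj \<tau> z \<in> bdom L i \<inter> bdom L j" for i j z
    using flat_frameD(2)[OF assms(1), of i j z] that by (simp add: mult.left_commute)
  moreover have "(cmod (a * u i z))\<^sup>2 * h i (proj \<tau> z) = exp (- c * (cmod z)\<^sup>2)"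
    if "i \<in> bindex L" "z \<in> A" "proj \<tau> z \<in> bdom L i" for i z
    using flat_frameD(3)[OF assms(1) that] assms(2) by (simp add: norm_mult)
  ultimately show ?thesis unfolding flat_frame_def by blast
qed

text \<open>
  The quotient of the two sections is independent of the frame in which it is computed, holomorphic, and
  of modulus one, hence constant by the maximum modulus principle.
\<close>

lemma flat_frame_unique:
  assumes M: "continuous_metric \<tau> L h" and u: "flat_frame \<tau> L h c A u" and v: "flat_frame \<tau> L h c A v"
    and A: "open A" "connected A"
  obtains a where "cmod a = 1"
    "\<And>i z. i \<in> bindex L \<Longrightarrow> z \<in> A \<Longrightarrow> proj \<tau> z \<in> bdom L i \<Longrightarrow> v i z = a * u i z"
proof (cases "A = {}")
  case True
  then show ?thesis using that[of 1] by simp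
next
  case False
  then obtain z0 where z0: "z0 \<in> A" by blast
  define r where "r z = (let i = frame_at L (proj \<tau> z) in v i z / u i z)" for z
  have r: "v i z = r z * u i z" if i: "i \<in> bindex L" and z: "z \<in> A" "proj \<tau> z \<in> bdom L i" for i z
  proof -
    define j where "j = frame_at L (proj \<tau> z)"
    note j = frame_at[OF M proj_in_torus[of \<tau> z], folded j_def]
    have "u i z = btrans L i j (proj \<tau> z) * u j z" "v i z = btrans L i j (proj \<tau> z) * v j z"
      using flat_frameD(2)[OF u] flat_frameD(2)[OF v] i j z by blast+
    then show ?thesis using flat_frame_nonzero[OF u j(1) z(1) j(2)]
      by (simp add: r_def Let_def j_def[symmetric])
  qed
  have nr: "cmod (r z) = 1" if z: "z \<in> A" for z
  proof -
    define j where "j = frame_at L (proj \<tau> z)"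
    note j = frame_at[OF M proj_in_torus[of \<tau> z], folded j_def]
    have "(cmod (v j z))\<^sup>2 * h j (proj \<tau> z) = (cmod (u j z))\<^sup>2 * h j (proj \<tau> z)"
      using flat_frameD(3)[OF u j(1) z j(2)] flat_frameD(3)[OF v j(1) z j(2)] by simp
    moreover have "h j (proj \<tau> z) > 0" using M j unfolding continuous_metric_def by blast
    ultimately have "cmod (v j z) = cmod (u j z)" by simp
    then show ?thesis using flat_frame_nonzero[OF u j(1) z j(2)]
      by (simp add: r_def Let_def j_def[symmetric] norm_divide)
  qed
  have "r field_differentiable at z" if z: "z \<in> A" for z
  proof -
    define j where "j = frame_at L (proj \<tau> z)"
    note j = frame_at[OF M proj_in_torus[of \<tau> z], folded j_def]
    define S where "S = A \<inter> proj \<tau> -` bdom L j"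
    have S: "open S" "z \<in> S"
      using M j z A unfolding S_def continuous_metric_def torus_open_def by blast+
    have "u j holomorphic_on S" "v j holomorphic_on S"
      using u v j unfolding flat_frame_def S_def by blast+
    moreover have nz: "u j w \<noteq> 0" if "w \<in> S" for w using flat_frame_nonzero[OF u j(1)] that by (auto simp: S_def)
    ultimately have "(\<lambda>w. v j w / u j w) holomorphic_on S" by (intro holomorphic_intros) auto
    moreover have "v j w / u j w = r w" if "w \<in> S" for w using r[OF j(1), of w] nz[OF that] that by (auto simp: S_def)
    ultimately have "r holomorphic_on S" by (simp cong: holomorphic_cong)
    then show ?thesis using S holomorphic_on_imp_differentiable_at by blast
  qed
  then have "r holomorphic_on A" using A(1) by (simp add: holomorphic_on_def field_differentiable_at_within)
  then have "r constant_on A"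
    using maximum_modulus_principle[OF _ A A(1) subset_refl z0, of r] nr z0 by simp
  then have "r z = r z0" if "z \<in> A" for z using z0 that unfolding constant_on_def by metis
  then show ?thesis using that[of "r z0"] nr[OF z0] r by metis
qed

text \<open>
  Connectedness of the overlap allows the second frame to be rescaled so as to agree with the first.
\<close>

lemma flat_frame_Un:
  assumes M: "continuous_metric \<tau> L h" and u: "flat_frame \<tau> L h c A u" and v: "flat_frame \<tau> L h c B v"
    and AB: "open A" "open B" "connected (A \<inter> B)"
  shows "\<exists>w. flat_frame \<tau> L h c (A \<union> B) w"
proof -
  obtain a where a: "cmod a = 1"
    "\<And>i z. i \<in> bindex L \<Longrightarrow> z \<in> A \<inter> B \<Longrightarrow> proj \<tau> z \<in> bdom L i \<Longrightarrow> u i z = a * v i z"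
    using flat_frame_unique[OF M flat_frame_mono[OF v] flat_frame_mono[OF u] _ AB(3)] AB(1,2) by auto
  define w where "w i z = (if z \<in> A then u i z else a * v i z)" for i z
  note v' = flat_frame_scale[OF v a(1)]
  have "w i holomorphic_on ((A \<union> B) \<inter> proj \<tau> -` bdom L i)" if i: "i \<in> bindex L" for i
  proof -
    let ?U = "proj \<tau> -` bdom L i"
    have U: "open ?U" using M i unfolding continuous_metric_def torus_open_def by blast
    have "(\<lambda>z. if z \<in> A \<inter> ?U then u i z else a * v i z) holomorphic_on (A \<inter> ?U) \<union> (B \<inter> ?U)"
      by (rule holomorphic_on_If_Un) (use flat_frameD(1)[OF u i] flat_frameD(1)[OF v' i] AB U a(2)[OF i] in auto)
    then show ?thesis
      by (rule holomorphic_transform[OF holomorphic_on_subset]) (auto simp: w_def)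
  qed
  moreover have "w i z = btrans L i j (proj \<tau> z) * w j z"
    if "i \<in> bindex L" "j \<in> bindex L" "z \<in> A \<union> B" "proj \<tau> z \<in> bdom L i \<inter> bdom L j" for i j z
    using flat_frameD(2)[OF u, of i j z] flat_frameD(2)[OF v', of i j z] that unfolding w_def by (cases "z \<in> A") auto
  moreover have "(cmod (w i z))\<^sup>2 * h i (proj \<tau> z) = exp (- c * (cmod z)\<^sup>2)"
    if "i \<in> bindex L" "z \<in> A \<union> B" "proj \<tau> z \<in> bdom L i" for i z
    using flat_frameD(3)[OF u, of i z] flat_frameD(3)[OF v', of i z] that unfolding w_def by (cases "z \<in> A") auto
  ultimately have "flat_frame \<tau> L h c (A \<union> B) w" unfolding flat_frame_def by blast
  then show ?thesis by blast
qed

text \<open>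
  A property of intervals that holds for short ones and can be glued along overlaps holds for all. It is
  applied twice below, first to extend frames horizontally and then to stack the strips.
\<close>

lemma interval_gluing_induct:
  fixes Q :: "real \<Rightarrow> real \<Rightarrow> bool"
  assumes e: "e > 0" and small: "\<And>a b. a < b \<Longrightarrow> b - a \<le> e \<Longrightarrow> Q a b"
    and glue: "\<And>a b c d. a < c \<Longrightarrow> c < b \<Longrightarrow> b < d \<Longrightarrow> Q a b \<Longrightarrow> Q c d \<Longrightarrow> Q a d"
    and ab: "a < b"
  shows "Q a b"
proof -
  have "a < b \<Longrightarrow> b - a \<le> real n * (e / 2) \<Longrightarrow> Q a b" for n a b
  proof (induction n arbitrary: b)
    case 0
    then show ?case by simp
  next
    case (Suc n)
    show ?case
    proof (cases "b - a \<le> e")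
      case True
      then show ?thesis using small Suc.prems by blast
    next
      case False
      have "Q a (b - e / 2)" using Suc False e by (intro Suc.IH) (auto simp: algebra_simps)
      moreover have "Q (b - e) b" using e by (intro small) auto
      ultimately show ?thesis using glue[of a "b - e" "b - e / 2" b] False e by simp
    qed
  qed
  moreover obtain n where "(b - a) / (e / 2) \<le> real n" using real_arch_simple by blast
  ultimately show ?thesis using ab e by (simp add: field_simps)
qed

lemma lattice_translate_to_fund_parallelogram:
  assumes "Im \<tau> > 0"
  obtains l where "l \<in> lattice \<tau>" "z - l \<in> fund_parallelogram \<tau>"
proof -
  define v where "v = Im z / Im \<tau>"
  define s where "s = Re z - v * Re \<tau>"
  define l where "l = of_int \<lfloor>s\<rfloor> + of_int \<lfloor>v\<rfloor> * \<tau>"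
  have "l \<in> lattice \<tau>" unfolding l_def lattice_def by blast
  have im: "Im (z - l) / Im \<tau> = v - of_int \<lfloor>v\<rfloor>" using assms by (simp add: l_def v_def field_simps)
  have re: "Re (z - l) - (v - of_int \<lfloor>v\<rfloor>) * Re \<tau> = s - of_int \<lfloor>s\<rfloor>"
    by (simp add: l_def s_def algebra_simps)
  have "z - l \<in> fund_parallelogram \<tau>"
    unfolding fund_parallelogram_iff[OF assms] im re
    using floor_correct[of s] floor_correct[of v] by simp linarith
  then show ?thesis using that \<open>l \<in> lattice \<tau>\<close> by blast
qed

text \<open>
  A Lebesgue number for a compact set containing a fundamental parallelogram serves the whole plane, by
  periodicity.
\<close>

lemma trivializing_radius:
  assumes T: "Im \<tau> > 0" and L: "holomorphic_line_bundle \<tau> L"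
  obtains e where "e > 0" "\<And>z. \<exists>i\<in>bindex L. ball z e \<subseteq> proj \<tau> -` bdom L i"
proof -
  let ?S = "cball 0 (2 + cmod \<tau>) :: complex set"
  let ?C = "(\<lambda>i. proj \<tau> -` bdom L i) ` bindex L"
  have cover: "\<Union>?C = UNIV"
  proof -
    have "z \<in> \<Union>?C" for z using line_bundleD(3)[OF L] proj_in_torus[of \<tau> z] by blast
    then show ?thesis by blast
  qed
  then have "?C \<noteq> {}" by blast
  then obtain \<delta> where \<delta>: "\<delta> > 0" "\<And>A. A \<subseteq> ?S \<Longrightarrow> diameter A < \<delta> \<Longrightarrow> \<exists>B\<in>?C. A \<subseteq> B"
    using Lebesgue_number_lemma[of ?S ?C] cover line_bundleD(1)[OF L] by (metis (no_types, lifting) compact_cball image_iff subset_UNIV)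
  define e where "e = min 1 (\<delta> / 4)"
  have e: "e > 0" "e \<le> 1" "2 * e < \<delta>" using \<delta>(1) by (auto simp: e_def)
  have "\<exists>i\<in>bindex L. ball z e \<subseteq> proj \<tau> -` bdom L i" for z
  proof -
    obtain l where l: "l \<in> lattice \<tau>" "z - l \<in> fund_parallelogram \<tau>"
      using lattice_translate_to_fund_parallelogram[OF T] by blast
    then have "cmod (z - l) \<le> 1 + cmod \<tau>" using fund_parallelogram_bounded[OF T] by auto
    then have "ball (z - l) e \<subseteq> ?S"
      using e(2) by (auto simp: dist_norm) (smt (verit) norm_minus_commute norm_triangle_sub)
    moreover have "diameter (ball (z - l) e) < \<delta>" using e by (simp add: diameter_ball)
    ultimately obtain i where i: "i \<in> bindex L" "ball (z - l) e \<subseteq> proj \<tau> -` bdom L i" using \<delta>(2) by blast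
    have "proj \<tau> w \<in> bdom L i" if "w \<in> ball z e" for w
    proof -
      have "w - l \<in> ball (z - l) e" using that by (simp add: dist_norm)
      then have "proj \<tau> (w - l) \<in> bdom L i" using i(2) by blast
      then show ?thesis using proj_add_lattice[OF lattice_uminus[OF l(1)], of w] by simp
    qed
    then show ?thesis using i(1) by blast
  qed
  then show ?thesis using that e(1) by blast
qed

lemma flat_frame_rectangle:
  assumes T: "Im \<tau> > 0" and L: "holomorphic_line_bundle \<tau> L" and H: "hermitian_metric \<tau> L h"
    and lap: "\<And>i z. i \<in> bindex L \<Longrightarrow> proj \<tau> z \<in> bdom L i \<Longrightarrow> laplacian (\<lambda>w. ln (h i (proj \<tau> w))) z = - 4 * c"
    and "x < x'" "y < y'"
  shows "\<exists>u. flat_frame \<tau> L h c (box (Complex x y) (Complex x' y')) u"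
proof -
  let ?F = "\<lambda>x x' y y'. \<exists>u. flat_frame \<tau> L h c (box (Complex x y) (Complex x' y')) u"
  note M = hermitian_imp_continuous_metric[OF L H]
  obtain e where e: "e > 0" "\<And>z. \<exists>i\<in>bindex L. ball z e \<subseteq> proj \<tau> -` bdom L i"
    using trivializing_radius[OF T L] by blast
  have small: "?F x x' y y'" if "x' - x \<le> e / 2" "y' - y \<le> e / 2" for x x' y y'
  proof -
    define m where "m = Complex ((x + x') / 2) ((y + y') / 2)"
    obtain i where i: "i \<in> bindex L" "ball m e \<subseteq> proj \<tau> -` bdom L i" using e(2) by blast
    have "box (Complex x y) (Complex x' y') \<subseteq> ball m e"
    proof
      fix z assume z: "z \<in> box (Complex x y) (Complex x' y')"
      then have "x < Re z" "Re z < x'" "y < Im z" "Im z < y'" by (auto simp: in_box_complex_iff)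
      then have "\<bar>Re z - (x + x') / 2\<bar> < e / 4 + e / 8" "\<bar>Im z - (y + y') / 2\<bar> < e / 4 + e / 8"
        using that e(1) by argo+
      then have "\<bar>Re (z - m)\<bar> < e / 4 + e / 8" "\<bar>Im (z - m)\<bar> < e / 4 + e / 8"
        by (simp_all add: m_def)
      then have "cmod (z - m) < e" using cmod_le[of "z - m"] e(1) by linarith
      then show "z \<in> ball m e" by (simp add: dist_norm norm_minus_commute)
    qed
    then have "box (Complex x y) (Complex x' y') \<subseteq> proj \<tau> -` bdom L i" using i(2) by blast
    then show ?thesis using flat_frame_local[OF L H lap[OF i(1)] i(1) open_box convex_box(2)] by blast
  qed
  have strip: "?F x x' y y'" if "x < x'" "y' - y \<le> e / 2" for x x' y y'
  proof (rule interval_gluing_induct[of "e / 2" "\<lambda>x x'. ?F x x' y y'"])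
    show "?F a d y y'" if "a < c" "c < b" "b < d" "?F a b y y'" "?F c d y y'" for a b c d
    proof -
      have "box (Complex a y) (Complex b y') \<inter> box (Complex c y) (Complex d y') = box (Complex c y) (Complex b y')"
        using that by (auto simp: in_box_complex_iff)
      then have "connected (box (Complex a y) (Complex b y') \<inter> box (Complex c y) (Complex d y'))"
        by (simp add: convex_connected)
      moreover have "box (Complex a y) (Complex b y') \<union> box (Complex c y) (Complex d y') = box (Complex a y) (Complex d y')"
        using that by (auto simp: in_box_complex_iff)
      ultimately show ?thesis using flat_frame_Un[OF M _ _ open_box open_box] that(4,5) by metis
    qed
  qed (use small e that in auto)
  show ?thesis
  proof (rule interval_gluing_induct[of "e / 2" "\<lambda>y y'. ?F x x' y y'"])
    show "?F x x' a d" if "a < c" "c < b" "b < d" "?F x x' a b" "?F x x' c d" for a b c d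
    proof -
      have "box (Complex x a) (Complex x' b) \<inter> box (Complex x c) (Complex x' d) = box (Complex x c) (Complex x' b)"
        using that by (auto simp: in_box_complex_iff)
      then have "connected (box (Complex x a) (Complex x' b) \<inter> box (Complex x c) (Complex x' d))"
        by (simp add: convex_connected)
      moreover have "box (Complex x a) (Complex x' b) \<union> box (Complex x c) (Complex x' d) = box (Complex x a) (Complex x' d)"
        using that by (auto simp: in_box_complex_iff)
      ultimately show ?thesis using flat_frame_Un[OF M _ _ open_box open_box] that(4,5) by metis
    qed
  qed (use strip e assms(5,6) in auto)
qed

text \<open>
  The plane is exhausted by squares. Frames on them are chosen successively, each rescaled to extend the
  preceding one.
\<close>

lemma flat_frame_global:
  assumes T: "Im \<tau> > 0" and L: "holomorphic_line_bundle \<tau> L" and H: "hermitian_metric \<tau> L h"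
    and lap: "\<And>i z. i \<in> bindex L \<Longrightarrow> proj \<tau> z \<in> bdom L i \<Longrightarrow> laplacian (\<lambda>w. ln (h i (proj \<tau> w))) z = - 4 * c"
  obtains u where "flat_frame \<tau> L h c UNIV u"
proof -
  note M = hermitian_imp_continuous_metric[OF L H]
  define S where "S n = box (Complex (- (real n + 1)) (- (real n + 1))) (Complex (real n + 1) (real n + 1))" for n
  have S: "open (S n)" "connected (S n)" for n unfolding S_def by (auto simp: convex_connected)
  have S_mono: "S m \<subseteq> S n" if "m \<le> n" for m n using that by (auto simp: S_def in_box_complex_iff)
  have ex: "\<exists>u. flat_frame \<tau> L h c (S n) u" for n
    unfolding S_def by (rule flat_frame_rectangle[OF T L H lap]) auto
  have "\<exists>U. \<forall>n. flat_frame \<tau> L h c (S n) (U n) \<and>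
      (\<forall>i\<in>bindex L. \<forall>z\<in>S n. proj \<tau> z \<in> bdom L i \<longrightarrow> U (Suc n) i z = U n i z)"
  proof (rule dependent_nat_choice[of "\<lambda>n. flat_frame \<tau> L h c (S n)"
        "\<lambda>n u v. \<forall>i\<in>bindex L. \<forall>z\<in>S n. proj \<tau> z \<in> bdom L i \<longrightarrow> v i z = u i z"])
    fix u n assume u: "flat_frame \<tau> L h c (S n) u"
    obtain v where v: "flat_frame \<tau> L h c (S (Suc n)) v" using ex by blast
    obtain a where a: "cmod a = 1"
      "\<And>i z. i \<in> bindex L \<Longrightarrow> z \<in> S n \<Longrightarrow> proj \<tau> z \<in> bdom L i \<Longrightarrow> u i z = a * v i z"
      using flat_frame_unique[OF M flat_frame_mono[OF v] u S] S_mono[of n "Suc n"] by auto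
    show "\<exists>w. flat_frame \<tau> L h c (S (Suc n)) w \<and>
        (\<forall>i\<in>bindex L. \<forall>z\<in>S n. proj \<tau> z \<in> bdom L i \<longrightarrow> w i z = u i z)"
      using flat_frame_scale[OF v a(1)] a(2) by (intro exI[of _ "\<lambda>i z. a * v i z"]) simp
  qed (rule ex)
  then obtain U where U: "\<And>n. flat_frame \<tau> L h c (S n) (U n)"
    "\<And>n i z. i \<in> bindex L \<Longrightarrow> z \<in> S n \<Longrightarrow> proj \<tau> z \<in> bdom L i \<Longrightarrow> U (Suc n) i z = U n i z"
    by blast
  have U_mono: "U n i z = U m i z" if "m \<le> n" "i \<in> bindex L" "z \<in> S m" "proj \<tau> z \<in> bdom L i" for m n i z
    using that(1)
  proof (induction n rule: dec_induct)
    case (step n)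
    then show ?case using U(2)[OF that(2) _ that(4), of n] S_mono[of m n] that(3) by auto
  qed simp
  define N where "N z = nat \<lceil>cmod z\<rceil>" for z
  have N: "z \<in> S (N z)" for z
  proof -
    have "cmod z \<le> real (N z)" unfolding N_def by linarith
    then show ?thesis using abs_Re_le_cmod[of z] abs_Im_le_cmod[of z]
      by (auto simp: S_def in_box_complex_iff)
  qed
  define w where "w i z = U (N z) i z" for i z
  have w: "w i z = U n i z" if "i \<in> bindex L" "z \<in> S n" "proj \<tau> z \<in> bdom L i" for n i z
    using U_mono[of n "N z" i z] U_mono[of "N z" n i z] that N[of z] unfolding w_def by (metis nat_le_linear)
  have "w i holomorphic_on (UNIV \<inter> proj \<tau> -` bdom L i)" if i: "i \<in> bindex L" for i
  proof -
    let ?V = "proj \<tau> -` bdom L i"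
    have op: "open ?V" by (rule line_bundleD(1)[OF L i])
    have "w i field_differentiable at z" if z: "z \<in> ?V" for z
    proof -
      have "U (N z) i holomorphic_on (S (N z) \<inter> ?V)" by (rule flat_frameD(1)[OF U(1) i])
      then have "w i holomorphic_on (S (N z) \<inter> ?V)"
        by (rule holomorphic_transform) (use w[OF i] in auto)
      moreover have "open (S (N z) \<inter> ?V)" "z \<in> S (N z) \<inter> ?V" using S op N z by auto
      ultimately show ?thesis using holomorphic_on_imp_differentiable_at by blast
    qed
    then show ?thesis by (simp add: holomorphic_on_def field_differentiable_at_within)
  qed
  moreover have "w i z = btrans L i j (proj \<tau> z) * w j z"
    if "i \<in> bindex L" "j \<in> bindex L" "proj \<tau> z \<in> bdom L i \<inter> bdom L j" for i j z
    using flat_frameD(2)[OF U(1) that(1,2) N[of z]] that(3) unfolding w_def by blast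
  moreover have "(cmod (w i z))\<^sup>2 * h i (proj \<tau> z) = exp (- c * (cmod z)\<^sup>2)"
    if "i \<in> bindex L" "proj \<tau> z \<in> bdom L i" for i z
    using flat_frameD(3)[OF U(1) that(1) N[of z] that(2)] unfolding w_def .
  ultimately have "flat_frame \<tau> L h c UNIV w" unfolding flat_frame_def by blast
  then show ?thesis by (rule that)
qed

text \<open>
  A translate of a flat frame has squared norm \<open>exp (- c \<bar>z + l\<bar>\<^sup>2)\<close>. Multiplied by the exponential of a linear
  function it is flat again, so it is a unimodular multiple of the original frame.
\<close>

lemma flat_frame_multiplier:
  assumes L: "holomorphic_line_bundle \<tau> L" and H: "hermitian_metric \<tau> L h"
    and u: "flat_frame \<tau> L h c UNIV u" and l: "l \<in> lattice \<tau>"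
  obtains a where "cmod a = 1"
    "\<And>i z. i \<in> bindex L \<Longrightarrow> proj \<tau> z \<in> bdom L i \<Longrightarrow>
        u i (z + l) = a * exp (- of_real c * (cnj l * z + of_real ((cmod l)\<^sup>2) / 2)) * u i z"
proof -
  note M = hermitian_imp_continuous_metric[OF L H]
  note pl = proj_add_lattice[OF l]
  define m where "m z = exp (of_real c * (cnj l * z + of_real ((cmod l)\<^sup>2) / 2))" for z
  define v where "v i z = m z * u i (z + l)" for i z
  have "v i holomorphic_on (UNIV \<inter> proj \<tau> -` bdom L i)" if i: "i \<in> bindex L" for i
  proof -
    let ?V = "proj \<tau> -` bdom L i"
    have "u i holomorphic_on ?V" using flat_frameD(1)[OF u i] by simp
    then have "(u i \<circ> (\<lambda>z. z + l)) holomorphic_on ?V"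
      by (intro holomorphic_on_compose_gen[of _ _ _ ?V] holomorphic_intros) (auto simp: pl)
    then have "(\<lambda>z. u i (z + l)) holomorphic_on ?V" by (simp add: o_def)
    then show ?thesis unfolding v_def m_def by (auto intro!: holomorphic_intros)
  qed
  moreover have "v i z = btrans L i j (proj \<tau> z) * v j z"
    if "i \<in> bindex L" "j \<in> bindex L" "proj \<tau> z \<in> bdom L i \<inter> bdom L j" for i j z
    using flat_frameD(2)[OF u that(1,2) UNIV_I, of "z + l"] that(3) by (simp add: v_def pl)
  moreover have "(cmod (v i z))\<^sup>2 * h i (proj \<tau> z) = exp (- c * (cmod z)\<^sup>2)"
    if i: "i \<in> bindex L" "proj \<tau> z \<in> bdom L i" for i z
  proof -
    have 1: "(cmod (u i (z + l)))\<^sup>2 * h i (proj \<tau> z) = exp (- c * (cmod (z + l))\<^sup>2)"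
      using flat_frameD(3)[OF u i(1) UNIV_I, of "z + l"] i(2) by (simp add: pl)
    have 2: "(cmod (m z))\<^sup>2 = exp (c * (2 * Re (cnj l * z) + (cmod l)\<^sup>2))"
      unfolding m_def norm_exp_eq_Re exp_double[symmetric] by (simp add: algebra_simps)
    have "(cmod (z + l))\<^sup>2 = (cmod z)\<^sup>2 + 2 * Re (cnj l * z) + (cmod l)\<^sup>2"
      unfolding cmod_power2 by (simp add: power2_eq_square algebra_simps)
    then have "exp (c * (2 * Re (cnj l * z) + (cmod l)\<^sup>2)) * exp (- c * (cmod (z + l))\<^sup>2) = exp (- c * (cmod z)\<^sup>2)"
      unfolding exp_add[symmetric] by (simp add: algebra_simps)
    then show ?thesis by (simp only: v_def norm_mult power_mult_distrib mult.assoc 1 2)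
  qed
  ultimately have "flat_frame \<tau> L h c UNIV v" unfolding flat_frame_def by blast
  then obtain a where a: "cmod a = 1"
    "\<And>i z. i \<in> bindex L \<Longrightarrow> proj \<tau> z \<in> bdom L i \<Longrightarrow> v i z = a * u i z"
    using flat_frame_unique[OF M u _ open_UNIV connected_UNIV] by (metis UNIV_I)
  have "u i (z + l) = a * exp (- of_real c * (cnj l * z + of_real ((cmod l)\<^sup>2) / 2)) * u i z"
    if "i \<in> bindex L" "proj \<tau> z \<in> bdom L i" for i z
  proof -
    have "exp (- of_real c * (cnj l * z + of_real ((cmod l)\<^sup>2) / 2)) * m z = 1"
      unfolding m_def exp_add[symmetric] by simp
    then have "u i (z + l) = exp (- of_real c * (cnj l * z + of_real ((cmod l)\<^sup>2) / 2)) * v i z"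
      unfolding v_def by (simp add: mult.assoc[symmetric])
    then show ?thesis using a(2)[OF that] by simp
  qed
  then show ?thesis using that a(1) by blast
qed

section \<open>Reduced lattice bases\<close>

lemma finite_lattice_ball:
  assumes "Im \<tau> > 0"
  shows "finite {v \<in> lattice \<tau>. cmod v \<le> R}"
proof -
  define B where "B = \<lceil>R / Im \<tau>\<rceil>"
  define A where "A = \<lceil>R + of_int B * cmod \<tau>\<rceil>"
  have "{v \<in> lattice \<tau>. cmod v \<le> R} \<subseteq> (\<lambda>(m, n). of_int m + of_int n * \<tau>) ` ({-A..A} \<times> {-B..B})"
  proof
    fix v assume "v \<in> {v \<in> lattice \<tau>. cmod v \<le> R}"
    then obtain m n :: int where v: "v = of_int m + of_int n * \<tau>" and R: "cmod v \<le> R"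
      unfolding lattice_def by blast
    have "\<bar>of_int n * Im \<tau>\<bar> \<le> R" using abs_Im_le_cmod[of v] R by (simp add: v)
    then have n: "\<bar>real_of_int n\<bar> \<le> R / Im \<tau>" using assms by (simp add: abs_mult field_simps)
    then have nB: "\<bar>n\<bar> \<le> B" unfolding B_def by linarith
    have "cmod (of_int m) \<le> cmod v + cmod (of_int n * \<tau>)"
      using norm_triangle_ineq4[of v "of_int n * \<tau>"] by (simp add: v)
    also have "cmod (of_int n * \<tau>) \<le> of_int B * cmod \<tau>"
      using nB by (simp add: norm_mult mult_right_mono flip: of_int_abs)
    finally have "\<bar>real_of_int m\<bar> \<le> R + of_int B * cmod \<tau>" using R by simp
    then have "\<bar>m\<bar> \<le> A" unfolding A_def by linarith
    with nB show "v \<in> (\<lambda>(m, n). of_int m + of_int n * \<tau>) ` ({-A..A} \<times> {-B..B})"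
      unfolding v by (intro image_eqI[of _ _ "(m, n)"]) auto
  qed
  then show ?thesis by (rule finite_subset) simp
qed

lemma shortest_lattice_vector:
  assumes T: "Im \<tau> > 0"
  obtains w where "w \<in> lattice \<tau>" "w \<noteq> 0" "\<And>v. v \<in> lattice \<tau> \<Longrightarrow> v \<noteq> 0 \<Longrightarrow> cmod w \<le> cmod v"
proof -
  define S where "S = {v \<in> lattice \<tau>. cmod v \<le> 1} - {0}"
  have fin: "finite S" unfolding S_def using finite_lattice_ball[OF T] by simp
  have "1 = of_int 1 + of_int 0 * \<tau>" by simp
  then have one: "1 \<in> lattice \<tau>" unfolding lattice_def by blast
  then have ne: "S \<noteq> {}" by (auto simp: S_def)
  define w where "w = arg_min_on cmod S"
  have w: "w \<in> S" "\<And>v. v \<in> S \<Longrightarrow> cmod w \<le> cmod v"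
    unfolding w_def using arg_min_if_finite(1)[OF fin ne] arg_min_least[OF fin ne] by blast+
  have "cmod w \<le> cmod v" if "v \<in> lattice \<tau>" "v \<noteq> 0" for v
  proof (cases "cmod v \<le> 1")
    case True
    then show ?thesis using w(2) that by (simp add: S_def)
  next
    case False
    then show ?thesis using w(1) by (simp add: S_def)
  qed
  moreover have "w \<in> lattice \<tau>" "w \<noteq> 0" using w(1) by (simp_all add: S_def)
  ultimately show ?thesis using that by blast
qed

text \<open>
  The basis consists of the shortest vector \<open>w1\<close> and of \<open>w1 * \<tau>'\<close>; the integers are the entries of the
  change of basis from \<open>1\<close> and \<open>\<tau>\<close>.
\<close>

locale reduced_basis =
  fixes \<tau> w1 \<tau>' :: complex and p q p' q' :: int
  assumes Im_pos: "Im \<tau> > 0"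
    and w1: "w1 = of_int p + of_int q * \<tau>"
    and w2: "w1 * \<tau>' = of_int p' + of_int q' * \<tau>"
    and det: "p * q' - q * p' = 1"
    and w1_nonzero: "w1 \<noteq> 0"
    and shortest: "\<And>v. v \<in> lattice \<tau> \<Longrightarrow> v \<noteq> 0 \<Longrightarrow> cmod w1 \<le> cmod v"
    and Re_reduced: "\<bar>Re \<tau>'\<bar> \<le> 1 / 2"
    and Im_reduced: "Im \<tau>' \<ge> sqrt 3 / 2"

text \<open>
  A shortest vector is primitive, so a Bezout identity completes it to a basis. Subtracting a multiple of
  it from the second vector makes \<open>\<bar>Re \<tau>'\<bar> \<le> 1/2\<close>, and minimality gives \<open>\<bar>\<tau>'\<bar> \<ge> 1\<close>; together these
  force \<open>Im \<tau>' \<ge> \<surd>3/2\<close>.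
\<close>

lemma reduced_basis_exists:
  assumes T: "Im \<tau> > 0"
  obtains w1 \<tau>' p q p' q' where "reduced_basis \<tau> w1 \<tau>' p q p' q'"
proof -
  obtain w where w: "w \<in> lattice \<tau>" "w \<noteq> 0" "\<And>v. v \<in> lattice \<tau> \<Longrightarrow> v \<noteq> 0 \<Longrightarrow> cmod w \<le> cmod v"
    using shortest_lattice_vector[OF T] by blast
  obtain p q :: int where pq: "w = of_int p + of_int q * \<tau>" using w(1) unfolding lattice_def by blast
  define g where "g = gcd p q"
  have g0: "g > 0" using w(2) pq by (auto simp: g_def)
  obtain p0 q0 where pq0: "p = g * p0" "q = g * q0"
    unfolding g_def by (metis dvdE gcd_dvd1 gcd_dvd2)
  have "w = of_int g * (of_int p0 + of_int q0 * \<tau>)" unfolding pq pq0 by (simp add: algebra_simps)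
  moreover have "of_int p0 + of_int q0 * \<tau> \<in> lattice \<tau>" unfolding lattice_def by blast
  ultimately have "cmod (of_int g) * cmod (of_int p0 + of_int q0 * \<tau>) \<le> 1 * cmod (of_int p0 + of_int q0 * \<tau>)"
    "cmod (of_int p0 + of_int q0 * \<tau>) > 0"
    using w(3)[of "of_int p0 + of_int q0 * \<tau>"] w(2) by (auto simp: norm_mult)
  then have "cmod (of_int g) \<le> 1" by (simp only: mult_le_cancel_right)
  then have g1: "g = 1" using g0 by simp
  obtain a b where ab: "a * p + b * q = 1"
    using bezout_int[of p q] g1 unfolding g_def by auto
  define k where "k = round (Re ((of_int (- b) + of_int a * \<tau>) / w))"
  define p' where "p' = - b - k * p"
  define q' where "q' = a - k * q"
  define w2 where "w2 = of_int p' + of_int q' * \<tau>"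
  define \<tau>' where "\<tau>' = w2 / w"
  have det: "p * q' - q * p' = 1" using ab by (simp add: p'_def q'_def algebra_simps)
  have w2: "w2 = of_int (- b) + of_int a * \<tau> - of_int k * w"
    by (simp add: w2_def p'_def q'_def pq algebra_simps)
  then have \<tau>': "\<tau>' = (of_int (- b) + of_int a * \<tau>) / w - of_int k"
    using w(2) by (simp add: \<tau>'_def diff_divide_distrib)
  have re: "\<bar>Re \<tau>'\<bar> \<le> 1 / 2"
    unfolding \<tau>' using of_int_round_abs_le[of "Re ((of_int (- b) + of_int a * \<tau>) / w)"]
    by (simp add: k_def abs_minus_commute)
  have "Im (w2 * cnj w) = of_int (p * q' - q * p') * Im \<tau>"
    by (simp add: w2_def pq algebra_simps)
  then have im: "Im \<tau>' = Im \<tau> / (cmod w)\<^sup>2"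
    unfolding \<tau>'_def complex_div_cnj[of w2 w] det by (simp add: Im_divide_of_real)
  then have impos: "Im \<tau>' > 0" using T w(2) by simp
  have "w2 \<in> lattice \<tau>" unfolding w2_def lattice_def by blast
  moreover have "w2 \<noteq> 0" using impos by (auto simp: \<tau>'_def)
  ultimately have "cmod \<tau>' \<ge> 1" using w(2,3) by (simp add: \<tau>'_def norm_divide)
  then have "1 \<le> (Re \<tau>')\<^sup>2 + (Im \<tau>')\<^sup>2" by (simp add: cmod_power2[symmetric])
  moreover have "(Re \<tau>')\<^sup>2 \<le> (1 / 2)\<^sup>2" using re by (subst abs_le_square_iff[symmetric]) simp
  ultimately have "(sqrt 3 / 2)\<^sup>2 \<le> (Im \<tau>')\<^sup>2" by (simp add: power_divide)
  then have "Im \<tau>' \<ge> sqrt 3 / 2" using impos by (simp add: power2_le_iff_abs_le)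
  then have "reduced_basis \<tau> w \<tau>' p q p' q'"
    using T pq w det re by unfold_locales (auto simp: \<tau>'_def w2_def)
  then show ?thesis by (rule that)
qed

context reduced_basis
begin

lemma Im_tau: "Im \<tau> = (cmod w1)\<^sup>2 * Im \<tau>'"
proof -
  have "Im (w1 * \<tau>' * cnj w1) = of_int (p * q' - q * p') * Im \<tau>"
    unfolding w2 by (simp add: w1 algebra_simps)
  moreover have "w1 * \<tau>' * cnj w1 = of_real ((cmod w1)\<^sup>2) * \<tau>'"
    by (simp only: complex_norm_square mult_ac)
  ultimately show ?thesis unfolding det by simp
qed

lemma Im_reduced_pos: "Im \<tau>' > 0"
  using Im_reduced by (smt (verit) divide_pos_pos real_sqrt_gt_zero)

lemma lattice_generated:
  assumes "v \<in> lattice \<tau>"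
  obtains m n :: int where "v = of_int m * w1 + of_int n * (w1 * \<tau>')"
proof -
  obtain a b :: int where v: "v = of_int a + of_int b * \<tau>" using assms unfolding lattice_def by blast
  have d: "of_int p * of_int q' - of_int q * of_int p' = (1 :: complex)"
    using det by (metis of_int_1 of_int_diff of_int_mult)
  have "v = of_int (a * q' - b * p') * w1 + of_int (b * p - a * q) * (w1 * \<tau>')"
  proof -
    have "of_int (a * q' - b * p') * w1 + of_int (b * p - a * q) * (w1 * \<tau>') =
        (of_int p * of_int q' - of_int q * of_int p') * (of_int a + of_int b * \<tau>)"
      unfolding w2 by (simp add: w1 algebra_simps)
    then show ?thesis by (simp add: d v)
  qed
  then show ?thesis by (rule that)
qed

lemma basis_in_lattice: "w1 \<in> lattice \<tau>" "w1 * \<tau>' \<in> lattice \<tau>"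
  unfolding w2 lattice_def by (auto simp: w1)

lemma lattice_invariant:
  assumes 1: "\<And>z. f (z + w1) = f z" and 2: "\<And>z. f (z + w1 * \<tau>') = f z" and l: "l \<in> lattice \<tau>"
  shows "f (z + l) = f z"
proof -
  have mult: "f (z + of_int m * w) = f z" if w: "\<And>z. f (z + w) = f z" for f :: "complex \<Rightarrow> 'a" and m z w
  proof (induction m rule: int_induct[where k = 0])
    case (step1 i)
    then show ?case using w[of "z + of_int i * w"] by (simp add: algebra_simps)
  next
    case (step2 i)
    then show ?case using w[of "z + of_int (i - 1) * w"] by (simp add: algebra_simps)
  qed simp
  obtain m n :: int where "l = of_int m * w1 + of_int n * (w1 * \<tau>')" using lattice_generated[OF l] by blast
  then show ?thesis
    using mult[of f w1 z m, OF 1] mult[of f "w1 * \<tau>'" "z + of_int m * w1" n, OF 2] by (simp add: add.assoc)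
qed

end

section \<open>A maximum principle for moduli of local holomorphic functions\<close>

text \<open>
  The local holomorphic functions need not fit together globally, which is why this notion is suited to \<open>exp u\<close> with \<open>u\<close> harmonic on a domain that is
  not simply connected.
\<close>

definition loc_hol_modulus :: "complex set \<Rightarrow> (complex \<Rightarrow> real) \<Rightarrow> bool" where
  "loc_hol_modulus S v \<longleftrightarrow>
     (\<forall>z\<in>S. \<exists>r>0. \<exists>F. F holomorphic_on ball z r \<and> (\<forall>w\<in>ball z r. v w = cmod (F w)))"

lemma loc_hol_modulus_subset: "loc_hol_modulus S v \<Longrightarrow> A \<subseteq> S \<Longrightarrow> loc_hol_modulus A v"
  unfolding loc_hol_modulus_def by blast

lemma loc_hol_modulus_mult:
  assumes "loc_hol_modulus S v" "loc_hol_modulus S w"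
  shows "loc_hol_modulus S (\<lambda>z. v z * w z)"
  unfolding loc_hol_modulus_def
proof
  fix z assume z: "z \<in> S"
  obtain r F where F: "r > 0" "F holomorphic_on ball z r" "\<And>x. x \<in> ball z r \<Longrightarrow> v x = cmod (F x)"
    using assms(1) z unfolding loc_hol_modulus_def by blast
  obtain s H where H: "s > 0" "H holomorphic_on ball z s" "\<And>x. x \<in> ball z s \<Longrightarrow> w x = cmod (H x)"
    using assms(2) z unfolding loc_hol_modulus_def by blast
  have "F holomorphic_on ball z (min r s)" "H holomorphic_on ball z (min r s)"
    using F(2) H(2) by (auto elim!: holomorphic_on_subset)
  then have "(\<lambda>x. F x * H x) holomorphic_on ball z (min r s)" by (intro holomorphic_intros)
  moreover have "\<forall>x\<in>ball z (min r s). v x * w x = cmod (F x * H x)"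
    using F(3) H(3) by (auto simp: norm_mult)
  ultimately show "\<exists>r>0. \<exists>F. F holomorphic_on ball z r \<and> (\<forall>x\<in>ball z r. v x * w x = cmod (F x))"
    using F(1) H(1) by (intro exI[of _ "min r s"] conjI exI[of _ "\<lambda>x. F x * H x"]) auto
qed

lemma loc_hol_modulus_continuous:
  assumes "loc_hol_modulus S v"
  shows "continuous_on S v"
proof -
  have "isCont v z" if z: "z \<in> S" for z
  proof -
    obtain r F where F: "r > 0" "F holomorphic_on ball z r" "\<And>x. x \<in> ball z r \<Longrightarrow> v x = cmod (F x)"
      using assms(1) z unfolding loc_hol_modulus_def by blast
    have "continuous_on (ball z r) (\<lambda>x. cmod (F x))"
      by (intro continuous_intros holomorphic_on_imp_continuous_on F)
    moreover have "continuous_on (ball z r) v \<longleftrightarrow> continuous_on (ball z r) (\<lambda>x. cmod (F x))"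
      by (rule continuous_on_cong) (use F(3) in auto)
    ultimately have "continuous_on (ball z r) v" by blast
    then show ?thesis using F(1) continuous_on_eq_continuous_at[OF open_ball] by (metis centre_in_ball)
  qed
  then show ?thesis by (simp add: continuous_at_imp_continuous_on)
qed

text \<open>
  The maximum is attained on an open set by the classical maximum modulus principle, and on a closed
  set by continuity.
\<close>

lemma loc_hol_modulus_max_principle:
  assumes v: "loc_hol_modulus S v" and S: "open S" "connected S"
    and \<xi>: "\<xi> \<in> S" "\<And>z. z \<in> S \<Longrightarrow> v z \<le> v \<xi>" and z: "z \<in> S"
  shows "v z = v \<xi>"
proof -
  define E where "E = {z \<in> S. v z = v \<xi>}"
  have "open E"
    unfolding open_contains_ball
  proof
    fix x assume x: "x \<in> E"
    then have xS: "x \<in> S" and vx: "v x = v \<xi>" by (auto simp: E_def)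
    obtain r F where F: "r > 0" "F holomorphic_on ball x r" "\<And>y. y \<in> ball x r \<Longrightarrow> v y = cmod (F y)"
      using v xS unfolding loc_hol_modulus_def by blast
    obtain s where s: "s > 0" "ball x s \<subseteq> S" using S(1) xS open_contains_ball by blast
    define t where "t = min r s"
    have t: "t > 0" "ball x t \<subseteq> S" "ball x t \<subseteq> ball x r" using F(1) s by (auto simp: t_def)
    have "F holomorphic_on ball x t" using F(2) t(3) by (rule holomorphic_on_subset)
    moreover have "x \<in> ball x t" using t(1) by simp
    moreover have "cmod (F y) \<le> cmod (F x)" if y: "y \<in> ball x t" for y
    proof -
      have "cmod (F y) = v y" "cmod (F x) = v x" using F(1,3) t(3) y by auto
      then show ?thesis using \<xi>(2)[of y] y t(2) vx by auto
    qed
    ultimately have "F constant_on ball x t"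
      using maximum_modulus_principle[OF _ open_ball connected_ball open_ball subset_refl] by blast
    then have "F y = F x" if "y \<in> ball x t" for y
      using that t(1) unfolding constant_on_def by (metis centre_in_ball)
    then have "v y = v \<xi>" if "y \<in> ball x t" for y
      using that F(1) F(3)[of y] F(3)[of x] t(3) vx by auto
    then show "\<exists>e>0. ball x e \<subseteq> E" using t by (auto simp: E_def)
  qed
  then have "openin (top_of_set S) E" unfolding openin_open E_def by blast
  moreover have "closedin (top_of_set S) E"
    unfolding E_def by (rule continuous_closedin_preimage_constant[OF loc_hol_modulus_continuous[OF v]])
  ultimately have "E = {} \<or> E = S" using S(2) connected_clopen by blast
  then show ?thesis using \<xi>(1) z by (auto simp: E_def)
qed

lemma loc_hol_modulus_powr:
  assumes "r > 0"
  shows "loc_hol_modulus (UNIV - {q}) (\<lambda>z. (cmod (z - q) / r) powr e)"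
  unfolding loc_hol_modulus_def
proof
  fix z assume z: "z \<in> UNIV - {q}"
  define d where "d = cmod (z - q)"
  have d: "d > 0" using z by (simp add: d_def)
  have nz: "(w - q) / of_real r \<noteq> 0" if "w \<in> ball z d" for w
    using that assms by (auto simp: d_def dist_norm)
  have "(\<lambda>w. (w - q) / of_real r) holomorphic_on ball z d" by (intro holomorphic_intros) (use assms in auto)
  then obtain g where g: "g holomorphic_on ball z d" "\<And>w. w \<in> ball z d \<Longrightarrow> (w - q) / of_real r = exp (g w)"
    by (rule contractible_imp_holomorphic_log[OF _ convex_imp_contractible[OF convex_ball]]) (use nz in blast)+
  have "(cmod (w - q) / r) powr e = cmod (exp (of_real e * g w))" if w: "w \<in> ball z d" for w
  proof -
    have "cmod (w - q) / r = cmod ((w - q) / of_real r)" using assms by (simp add: norm_divide)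
    also have "\<dots> = exp (Re (g w))" by (simp add: g(2)[OF w])
    finally show ?thesis by (simp add: powr_def)
  qed
  moreover have "(\<lambda>w. exp (of_real e * g w)) holomorphic_on ball z d" by (intro holomorphic_intros g)
  ultimately show "\<exists>r'>0. \<exists>F. F holomorphic_on ball z r' \<and> (\<forall>w\<in>ball z r'. (cmod (w - q) / r) powr e = cmod (F w))"
    using d by blast
qed

text \<open>
  The bounded function \<open>v\<close> is multiplied by \<open>(\<bar>z - q\<bar> / r)\<^sup>e\<close>, which is again locally the modulus of a
  holomorphic function. The product tends to \<open>0\<close> at the puncture, so its maximum over the closed disc lies
  on the boundary circle, or else it vanishes identically. Then let \<open>e\<close> tend to \<open>0\<close>.
\<close>

lemma puncture_max_principle:
  assumes v: "loc_hol_modulus (cball q r - {q}) v" and r: "r > 0"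
    and bdd: "\<And>z. z \<in> cball q r - {q} \<Longrightarrow> v z \<le> B" and pos: "\<And>z. v z \<ge> 0"
    and M: "\<And>z. z \<in> sphere q r \<Longrightarrow> v z \<le> M"
    and z: "z \<in> cball q r - {q}"
  shows "v z \<le> M"
proof -
  have M0: "M \<ge> 0" using M[of "q + of_real r"] pos[of "q + of_real r"] r by (simp add: dist_norm)
  have B0: "B \<ge> 0" using bdd[OF z] pos[of z] by simp
  have eps: "v z * (cmod (z - q) / r) powr e \<le> M" if e: "e > 0" for e
  proof -
    define u where "u x = v x * (cmod (x - q) / r) powr e" for x
    have u: "loc_hol_modulus (cball q r - {q}) u"
      unfolding u_def
      by (intro loc_hol_modulus_mult v loc_hol_modulus_subset[OF loc_hol_modulus_powr[OF r]]) auto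
    have uq: "u q = 0" by (simp add: u_def)
    have "(u \<longlongrightarrow> u q) (at q within cball q r)"
      unfolding uq
    proof (rule tendsto_sandwich[of "\<lambda>_. 0" _ _ "\<lambda>x. B * (cmod (x - q) / r) powr e"])
      show "\<forall>\<^sub>F x in at q within cball q r. 0 \<le> u x" by (simp add: u_def pos)
      show "\<forall>\<^sub>F x in at q within cball q r. u x \<le> B * (cmod (x - q) / r) powr e"
        using bdd by (auto simp: u_def eventually_at intro!: exI[of _ 1] mult_right_mono)
      have "((\<lambda>x. B * (cmod (x - q) / r) powr e) \<longlongrightarrow> B * (cmod (q - q) / r) powr e) (at q within cball q r)"
        by (intro tendsto_intros) (use r e in auto)
      then show "((\<lambda>x. B * (cmod (x - q) / r) powr e) \<longlongrightarrow> 0) (at q within cball q r)" by simp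
    qed simp
    moreover have "continuous (at x within cball q r) u" if "x \<in> cball q r - {q}" for x
    proof -
      have "continuous (at x within (cball q r - {q})) u"
        using loc_hol_modulus_continuous[OF u] that by (simp add: continuous_on_eq_continuous_within)
      moreover have "at x within (cball q r - {q}) = at x within cball q r"
        by (rule at_within_nhd[of _ "- {q}"]) (use that in auto)
      ultimately show ?thesis by (simp add: continuous_within)
    qed
    ultimately have "continuous_on (cball q r) u"
      unfolding continuous_on_eq_continuous_within by (metis Diff_iff continuous_within singletonD)
    then obtain \<xi> where \<xi>: "\<xi> \<in> cball q r" "\<And>x. x \<in> cball q r \<Longrightarrow> u x \<le> u \<xi>"
      using continuous_attains_sup[of "cball q r" u] r by auto
    have "u \<xi> \<le> M"
    proof (cases "\<xi> = q \<or> \<xi> \<in> sphere q r")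
      case True
      then show ?thesis using M0 uq M[of \<xi>] r by (auto simp: u_def dist_norm norm_minus_commute)
    next
      case False
      then have \<xi>': "\<xi> \<in> ball q r - {q}" using \<xi>(1) by auto
      have con: "connected (ball q r - {q})" by (intro connected_open_delete) auto
      (* A maximum inside the punctured disc would make u constant there, with the value 0 that it takes
         in the limit at the puncture. *)
      have eq: "u x = u \<xi>" if "x \<in> ball q r - {q}" for x
        by (rule loc_hol_modulus_max_principle[OF loc_hol_modulus_subset[OF u] _ con \<xi>' _ that])
           (use \<xi>(2) in auto)
      have "((\<lambda>_. u \<xi>) \<longlongrightarrow> u q) (at q within cball q r)"
      proof (rule Lim_transform_eventually)
        show "(u \<longlongrightarrow> u q) (at q within cball q r)" by fact
        show "\<forall>\<^sub>F x in at q within cball q r. u x = u \<xi>"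
          unfolding eventually_at using r eq by (intro exI[of _ r]) (auto simp: dist_commute)
      qed
      moreover have "at q within cball q r = at q" by (rule at_within_interior) (use r in simp)
      ultimately have "((\<lambda>_. u \<xi>) \<longlongrightarrow> u q) (at q)" by simp
      then have "u \<xi> = u q" by (simp only: tendsto_const_iff[OF at_neq_bot])
      then show ?thesis using uq M0 by simp
    qed
    then show ?thesis using \<xi>(2)[of z] z by (auto simp: u_def)
  qed
  have zq: "cmod (z - q) / r > 0" using z r by auto
  have "((\<lambda>n. v z * (cmod (z - q) / r) powr (1 / real (Suc n))) \<longlongrightarrow> v z * (cmod (z - q) / r) powr 0) sequentially"
    by (intro tendsto_intros) (use zq LIMSEQ_Suc[OF lim_1_over_n] in auto)
  moreover have "(cmod (z - q) / r) powr 0 = 1" using z r by simp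
  ultimately have lim: "((\<lambda>n. v z * (cmod (z - q) / r) powr (1 / real (Suc n))) \<longlongrightarrow> v z) sequentially"
    by (simp only: mult_1_right)
  show ?thesis by (rule LIMSEQ_le_const2[OF lim]) (use eps in auto)
qed

lemma countable_lattice: "countable (lattice \<tau>)"
proof -
  have "lattice \<tau> = (\<lambda>(m, n). of_int m + of_int n * \<tau>) ` (UNIV :: (int \<times> int) set)"
    unfolding lattice_def by auto
  then show ?thesis by simp
qed

context reduced_basis
begin

lemma closed_lattice: "closed (lattice \<tau>)"
proof (rule discrete_imp_closed[of "cmod w1"])
  show "\<forall>x\<in>lattice \<tau>. \<forall>y\<in>lattice \<tau>. dist y x < cmod w1 \<longrightarrow> y = x"
    using shortest lattice_add[OF _ lattice_uminus]
    by (metis add_uminus_conv_diff dist_norm eq_iff_diff_eq_0 linorder_not_le)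
qed (use w1_nonzero in simp)

text \<open>
  By periodicity the maximum over the complement of small discs about the translates of \<open>a\<close> is attained.
  By \<open>puncture_max_principle\<close> the function is no larger inside the discs, so this is a maximum over the
  whole punctured torus, and the maximum principle applies.
\<close>

lemma periodic_modulus_constant:
  assumes v: "loc_hol_modulus {z. z - a \<notin> lattice \<tau>} v" and pos: "\<And>z. v z \<ge> 0"
    and per: "\<And>z l. l \<in> lattice \<tau> \<Longrightarrow> v (z + l) = v z"
    and bdd: "R0 > 0" "\<And>z. z \<in> ball a R0 - {a} \<Longrightarrow> v z \<le> B"
  obtains K where "\<And>z. z - a \<notin> lattice \<tau> \<Longrightarrow> v z = K"
proof -
  let ?S = "{z. z - a \<notin> lattice \<tau>}"
  (* The discs of radius R about the lattice translates of a are disjoint, since 2 R < |w1|, and the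
     one about a lies where v is known to be bounded. *)
  define R where "R = min (cmod w1 / 3) (R0 / 2)"
  have R: "R > 0" "R < R0" "2 * R < cmod w1"
  proof -
    have "R \<le> cmod w1 / 3" "R \<le> R0 / 2" "cmod w1 > 0" using w1_nonzero by (auto simp: R_def)
    then show "R < R0" "2 * R < cmod w1" using bdd(1) by linarith+
    show "R > 0" using bdd(1) w1_nonzero by (auto simp: R_def)
  qed
  define far where "far z \<longleftrightarrow> (\<forall>l\<in>lattice \<tau>. cmod (z - a - l) \<ge> R)" for z
  have far_S: "far z \<Longrightarrow> z \<in> ?S" for z using R(1) by (auto simp: far_def)
  have far_shift: "far (z - l)" if "far z" "l \<in> lattice \<tau>" for z l
    unfolding far_def
  proof
    fix m assume "m \<in> lattice \<tau>"
    then have "cmod (z - a - (l + m)) \<ge> R" using that lattice_add[OF that(2)] unfolding far_def by blast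
    then show "cmod (z - l - a - m) \<ge> R" by (simp add: algebra_simps)
  qed
  have far_sphere: "far z" if "z \<in> sphere a R" for z
    unfolding far_def
  proof
    fix l assume l: "l \<in> lattice \<tau>"
    have z: "cmod (z - a) = R" using that by (simp add: dist_norm norm_minus_commute)
    show "cmod (z - a - l) \<ge> R"
    proof (cases "l = 0")
      case False
      then have "cmod l \<ge> cmod w1" using shortest l by blast
      then show ?thesis using z R(3) norm_triangle_ineq2[of l "z - a"] by (simp add: norm_minus_commute)
    qed (use z in simp)
  qed
  define K where "K = {z. far z} \<inter> cball 0 (1 + cmod \<tau>)"
  have "closed {z. far z}"
  proof -
    have "{z. far z} = (\<Inter>l\<in>lattice \<tau>. {z. R \<le> cmod (z - a - l)})" by (auto simp: far_def)
    also have "closed \<dots>" by (intro closed_INT ballI closed_Collect_le continuous_intros)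
    finally show ?thesis .
  qed
  then have K: "compact K" unfolding K_def by (intro closed_Int_compact) auto
  have to_K: "\<exists>l\<in>lattice \<tau>. z - l \<in> K" if "far z" for z
  proof -
    obtain l where l: "l \<in> lattice \<tau>" "z - l \<in> fund_parallelogram \<tau>"
      using lattice_translate_to_fund_parallelogram[OF Im_pos] by blast
    then have "z - l \<in> K" using far_shift[OF that l(1)] fund_parallelogram_bounded[OF Im_pos] by (auto simp: K_def)
    then show ?thesis using l(1) by blast
  qed
  have per': "v (z - l) = v z" if "l \<in> lattice \<tau>" for z l
    using per[OF lattice_uminus[OF that], of z] by simp
  have "far (a + of_real R)" by (rule far_sphere) (use R(1) in \<open>simp add: dist_norm\<close>)
  then have "K \<noteq> {}" using to_K by blast
  moreover have "continuous_on K v"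
    using loc_hol_modulus_continuous[OF v] far_S by (auto simp: K_def intro: continuous_on_subset)
  ultimately obtain \<xi> where \<xi>: "\<xi> \<in> K" "\<And>z. z \<in> K \<Longrightarrow> v z \<le> v \<xi>"
    using continuous_attains_sup[OF K] by blast
  have far_le: "v z \<le> v \<xi>" if "far z" for z
    using to_K[OF that] \<xi>(2) per' by metis
  have le: "v z \<le> v \<xi>" if z: "z \<in> ?S" for z
  proof (cases "far z")
    case False
    then obtain l where l: "l \<in> lattice \<tau>" "cmod (z - a - l) < R" unfolding far_def by force
    have sub: "cball a R - {a} \<subseteq> ?S"
    proof
      fix x assume x: "x \<in> cball a R - {a}"
      have "x - a \<notin> lattice \<tau>"
      proof
        assume "x - a \<in> lattice \<tau>"
        then have "cmod w1 \<le> cmod (x - a)" using x by (intro shortest) auto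
        then show False using x R by (auto simp: dist_norm norm_minus_commute)
      qed
      then show "x \<in> ?S" by simp
    qed
    have "z - l \<noteq> a" using z l(1) by auto
    then have "z - l \<in> cball a R - {a}" using l(2) by (simp add: dist_norm norm_minus_commute algebra_simps)
    then have "v (z - l) \<le> v \<xi>"
      by (rule puncture_max_principle[where B = B, OF loc_hol_modulus_subset[OF v sub] R(1) _ pos far_le[OF far_sphere], rotated -1])
         (use bdd(2) R(2) in auto)
    then show ?thesis using per'[OF l(1)] by simp
  qed (rule far_le)
  have "countable ((\<lambda>l. a + l) ` lattice \<tau>)" using countable_lattice by simp
  then have con: "connected (UNIV - (\<lambda>l. a + l) ` lattice \<tau>)"
    by (intro connected_open_diff_countable) auto
  have eqS: "UNIV - (\<lambda>l. a + l) ` lattice \<tau> = ?S" by force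
  have "open ?S"
  proof -
    have "closed (lattice \<tau>)" by (rule closed_lattice)
    then have "closed ((\<lambda>l. a + l) ` lattice \<tau>)" by (rule closed_translation)
    then show ?thesis unfolding eqS[symmetric] by (simp add: open_Diff)
  qed
  then have "v z = v \<xi>" if "z \<in> ?S" for z
    using loc_hol_modulus_max_principle[OF v _ con[unfolded eqS] _ le that] \<xi>(1) far_S by (auto simp: K_def)
  then show ?thesis using that by blast
qed

end

section \<open>Green function and logarithmic capacity\<close>

context reduced_basis
begin

text \<open>
  For \<open>y = z / w1\<close> the identity is \<open>Re (y\<^sup>2) - \<bar>y\<bar>\<^sup>2 = - 2 (Im y)\<^sup>2\<close>. It exhibits the norm of the theta series
  as a holomorphic modulus times the rotation invariant Gaussian weight of the flat frame.
\<close>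

lemma theta_norm_as_modulus:
  "theta_norm d s \<beta> \<tau>' (z / w1) =
     cmod (exp (of_real (pi * of_int d / (2 * Im \<tau>')) * (z / w1)\<^sup>2) * theta d s \<beta> \<tau>' (z / w1)) *
     exp (- (pi * of_int d / (2 * Im \<tau>)) * (cmod z)\<^sup>2)"
proof -
  define y where "y = z / w1"
  have T': "Im \<tau>' > 0" by (rule Im_reduced_pos)
  have "z = w1 * y" using w1_nonzero by (simp add: y_def)
  then have "(cmod z)\<^sup>2 = (cmod w1)\<^sup>2 * (cmod y)\<^sup>2" by (simp add: norm_mult power_mult_distrib)
  then have 1: "pi * of_int d / (2 * Im \<tau>) * (cmod z)\<^sup>2 = pi * of_int d / (2 * Im \<tau>') * (cmod y)\<^sup>2"
    using w1_nonzero by (simp add: Im_tau)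
  have re: "Re (y\<^sup>2) = (Re y)\<^sup>2 - (Im y)\<^sup>2" by (simp add: power2_eq_square)
  have "pi * of_int d / (2 * Im \<tau>') * Re (y\<^sup>2) - pi * of_int d / (2 * Im \<tau>') * (cmod y)\<^sup>2 =
      - (pi * of_int d / (2 * Im \<tau>') * (2 * (Im y)\<^sup>2))"
    unfolding cmod_power2 re by (simp only: right_diff_distrib distrib_left)
  then have "exp (pi * of_int d / (2 * Im \<tau>') * Re (y\<^sup>2)) * exp (- (pi * of_int d / (2 * Im \<tau>')) * (cmod y)\<^sup>2) =
      exp (- pi * of_int d * (Im y)\<^sup>2 / Im \<tau>')"
    unfolding exp_add[symmetric] by simp
  moreover have "cmod (exp (of_real (pi * of_int d / (2 * Im \<tau>')) * y\<^sup>2)) = exp (pi * of_int d / (2 * Im \<tau>') * Re (y\<^sup>2))"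
  proof -
    have "Re (of_real k * x) = k * Re x" for k x by simp
    then show ?thesis unfolding norm_exp_eq_Re by presburger
  qed
  ultimately show ?thesis
    unfolding y_def[symmetric] theta_norm_def norm_mult using 1 by (simp add: mult_ac)
qed

definition torus_theta_norm :: "complex \<Rightarrow> real" where
  "torus_theta_norm z = odd_theta_norm \<tau>' (z / w1)"

lemma torus_theta_norm_periodic: "l \<in> lattice \<tau> \<Longrightarrow> torus_theta_norm (z + l) = torus_theta_norm z"
proof (rule lattice_invariant)
  show "torus_theta_norm (z + w1) = torus_theta_norm z" for z
    using w1_nonzero by (simp add: torus_theta_norm_def add_divide_distrib theta_norm_plus_1)
  show "torus_theta_norm (z + w1 * \<tau>') = torus_theta_norm z" for z
    using w1_nonzero theta_norm_plus_tau[OF Im_reduced_pos]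
    by (simp add: torus_theta_norm_def add_divide_distrib)
qed

lemma torus_theta_norm_lattice: "l \<in> lattice \<tau> \<Longrightarrow> torus_theta_norm l = 0"
  using torus_theta_norm_periodic[of l 0] by (simp add: torus_theta_norm_def theta_norm_def odd_theta_0)

lemma torus_theta_norm_tendsto:
  assumes D: "(odd_theta \<tau>' has_field_derivative D) (at 0)"
  shows "((\<lambda>z. torus_theta_norm (z - a) / cmod (z - a)) \<longlongrightarrow> cmod D / cmod w1) (at a)"
proof -
  have lim: "((\<lambda>y. odd_theta \<tau>' y / y) \<longlongrightarrow> D) (at 0)"
    using D unfolding has_field_derivative_iff by (simp add: odd_theta_0)
  have f: "filterlim (\<lambda>z. (z - a) / w1) (at 0) (at a)"
    unfolding filterlim_at
    using w1_nonzero by (auto simp: eventually_at_filter intro!: tendsto_eq_intros)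
  have 1: "((\<lambda>z. odd_theta \<tau>' ((z - a) / w1) / ((z - a) / w1)) \<longlongrightarrow> D) (at a)"
    by (rule filterlim_compose[OF lim f])
  have 2: "((\<lambda>z. exp (- pi * (Im ((z - a) / w1))\<^sup>2 / Im \<tau>')) \<longlongrightarrow> exp (- pi * (Im ((a - a) / w1))\<^sup>2 / Im \<tau>')) (at a)"
    by (intro tendsto_intros) (use w1_nonzero Im_reduced_pos in auto)
  have "((\<lambda>z. cmod (odd_theta \<tau>' ((z - a) / w1) / ((z - a) / w1)) / cmod w1 * exp (- pi * (Im ((z - a) / w1))\<^sup>2 / Im \<tau>'))
      \<longlongrightarrow> cmod D / cmod w1 * 1) (at a)"
    by (intro tendsto_intros 1) (use 2 w1_nonzero in auto)
  moreover have "cmod (odd_theta \<tau>' ((z - a) / w1) / ((z - a) / w1)) / cmod w1 * exp (- pi * (Im ((z - a) / w1))\<^sup>2 / Im \<tau>') =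
      torus_theta_norm (z - a) / cmod (z - a)" for z
    using w1_nonzero by (simp add: torus_theta_norm_def theta_norm_def norm_divide norm_mult)
  ultimately show ?thesis by simp
qed

text \<open>
  The factor \<open>1/2\<close> ensures that no other lattice translate is closer.
\<close>

lemma setdist_proj:
  assumes "cmod (w - z) \<le> cmod w1 / 2"
  shows "setdist (proj \<tau> w) (proj \<tau> z) = cmod (w - z)"
proof (rule antisym)
  show "setdist (proj \<tau> w) (proj \<tau> z) \<le> cmod (w - z)"
    using setdist_le_dist[OF proj_self[of w \<tau>] proj_self[of z \<tau>]] by (simp add: dist_norm)
  have "cmod (w - z) \<le> dist x y" if xy: "x \<in> proj \<tau> w" "y \<in> proj \<tau> z" for x y
  proof -
    define l where "l = (x - w) + - (y - z)"
    have l: "l \<in> lattice \<tau>" unfolding l_def using xy by (intro lattice_add lattice_uminus) (auto simp: mem_proj_iff)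
    have xy': "x - y = (w - z) + l" by (simp add: l_def)
    show ?thesis
    proof (cases "l = 0")
      case False
      then have "cmod l \<ge> cmod w1" using shortest l by blast
      moreover have "cmod l \<le> cmod (x - y) + cmod (w - z)"
        using norm_triangle_ineq4[of "x - y" "w - z"] by (simp add: xy')
      ultimately show ?thesis using assms by (simp add: dist_norm)
    qed (simp add: dist_norm xy')
  qed
  then show "cmod (w - z) \<le> setdist (proj \<tau> w) (proj \<tau> z)"
    using proj_self by (intro le_setdistI) blast+
qed

lemma torus_dist_near:
  "\<forall>\<^sub>F w in at z. torus_dist \<tau> (proj \<tau> w) (proj \<tau> z) = cmod (w - z) / sqrt (Im \<tau>)"
  unfolding eventually_at
  by (intro exI[of _ "cmod w1 / 2"]) (use w1_nonzero setdist_proj in \<open>auto simp: torus_dist_def dist_norm\<close>)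

text \<open>
  With \<open>N\<close> the torus theta norm, consider \<open>v(x) = N(x - a) exp (- G(x, a))\<close>. Both the Green function and
  the Gaussian weight in \<open>N\<close> have Laplacian \<open>- 2 \<pi> / Im \<tau>\<close>, so \<open>v\<close> is locally the modulus of a
  holomorphic function; it is bounded near \<open>a\<close> because the simple zero of \<open>N\<close> cancels the pole of
  \<open>exp (- G)\<close>. Hence \<open>v\<close> is constant. Its value at \<open>a + z0\<close> is at least \<open>N(z0)\<close>, as \<open>G < 0\<close>.
\<close>

theorem green_function_bound:
  assumes G: "green_function \<tau> G" and D: "(odd_theta \<tau>' has_field_derivative D) (at 0)"
    and N0: "torus_theta_norm z0 > 0" and z: "z - a \<notin> lattice \<tau>"
  shows "exp (real_of_ereal (G (proj \<tau> z) (proj \<tau> a))) \<le> torus_theta_norm (z - a) / torus_theta_norm z0"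
proof -
  let ?Q = "proj \<tau> a" and ?S = "{z. z - a \<notin> lattice \<tau>}"
  define g where "g z = real_of_ereal (G (proj \<tau> z) ?Q)" for z
  have S: "proj \<tau> -` (torus \<tau> - {?Q}) = ?S"
    using proj_in_torus proj_eq_iff[of \<tau> a] by force
  obtain m where m0: "torus_integral \<tau> (\<lambda>_. m) = (1 :: real)"
    and mQ: "\<forall>Q\<in>torus \<tau>.
         torus_Ck_on \<tau> 2 (torus \<tau> - {Q}) (\<lambda>P. real_of_ereal (G P Q)) \<and>
         (\<forall>P \<in> torus \<tau> - {Q}.
            torus_laplacian \<tau> (\<lambda>P. real_of_ereal (G P Q)) P / (2 * pi) = - m) \<and>
         (\<forall>\<phi>. torus_smooth_on \<tau> (torus \<tau>) \<phi> \<longrightarrow>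
            torus_integral \<tau> (\<lambda>P. real_of_ereal (G P Q) * (torus_laplacian \<tau> \<phi> P / (2 * pi)))
              = \<phi> Q - torus_integral \<tau> (\<lambda>P. m * \<phi> P))"
    using G unfolding green_function_def by (elim conjE exE) assumption
  note m = m0 bspec[OF mQ proj_in_torus[of \<tau> a], THEN conjunct1]
    bspec[OF mQ proj_in_torus[of \<tau> a], THEN conjunct2, THEN conjunct1]
  have m1: "m = 1" using m(1) torus_integral_const[OF Im_pos] by simp
  have C2: "Ck_on 2 ?S g" using m(2) unfolding torus_Ck_on_def S g_def .
  have lap: "laplacian g x = - 2 * pi / Im \<tau>" if "x \<in> ?S" for x
  proof -
    have "proj \<tau> x \<in> torus \<tau> - {?Q}" using that S by blast
    from bspec[OF m(3) this] have "Im \<tau> * laplacian g x / (2 * pi) = - 1"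
      unfolding torus_laplacian_proj g_def[abs_def] m1 .
    then show ?thesis using Im_pos by (simp add: field_simps)
  qed
  have openS: "open ?S"
  proof -
    have "?S = (\<lambda>z. z - a) -` (- lattice \<tau>)" by auto
    then show ?thesis using closed_lattice by (simp add: open_vimage continuous_intros)
  qed
  define v where "v x = torus_theta_norm (x - a) * exp (- g x)" for x
  have lhm: "loc_hol_modulus ?S v"
    unfolding loc_hol_modulus_def
  proof
    fix x assume x: "x \<in> ?S"
    obtain r where r: "r > 0" "ball x r \<subseteq> ?S" using openS x open_contains_ball by blast
    define c where "c = pi / (2 * Im \<tau>)"
    define \<rho> where "\<rho> w = g w + c * (cmod (w - a))\<^sup>2" for w
    have C: "Ck_on 2 (ball x r) g" by (rule Ck_on_subset[OF C2 r(2)])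
    have C': "Ck_on 2 (ball x r) (\<lambda>w. c * (cmod (w - a))\<^sup>2)" by (rule Ck_on_norm_squared) simp
    have "Ck_on 2 (ball x r) \<rho>" unfolding \<rho>_def by (intro Ck_on_add C C') simp
    moreover have "laplacian \<rho> w = 0" if "w \<in> ball x r" for w
    proof -
      have "laplacian \<rho> w = laplacian g w + 4 * c"
        unfolding \<rho>_def laplacian_add[OF open_ball that C C'] laplacian_norm_squared ..
      also have "\<dots> = 0" using lap[of w] that r(2) Im_pos by (auto simp: c_def)
      finally show ?thesis .
    qed
    ultimately obtain F where F: "F holomorphic_on ball x r" "\<And>w. w \<in> ball x r \<Longrightarrow> \<rho> w = Re (F w)"
      using harmonic_is_Re_holomorphic[OF _ open_ball convex_ball] by blast
    define H where "H w = exp (of_real (pi / (2 * Im \<tau>')) * ((w - a) / w1)\<^sup>2) * odd_theta \<tau>' ((w - a) / w1) * exp (- F w)" for w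
    have th: "odd_theta \<tau>' holomorphic_on UNIV" by (rule theta_holomorphic[OF Im_reduced_pos]) simp
    have "(odd_theta \<tau>' \<circ> (\<lambda>w. (w - a) / w1)) holomorphic_on ball x r"
      by (rule holomorphic_on_compose_gen[OF _ th]) (auto intro!: holomorphic_intros simp: w1_nonzero)
    then have "H holomorphic_on ball x r"
      unfolding H_def using w1_nonzero by (auto intro!: holomorphic_intros F simp: o_def)
    moreover have "v w = cmod (H w)" if "w \<in> ball x r" for w
    proof -
      have "exp (- c * (cmod (w - a))\<^sup>2) * exp (- g w) = exp (- Re (F w))"
        unfolding exp_add[symmetric] F(2)[OF that, symmetric] \<rho>_def by simp
      moreover have "v w = cmod (exp (of_real (pi / (2 * Im \<tau>')) * ((w - a) / w1)\<^sup>2) * odd_theta \<tau>' ((w - a) / w1)) *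
          (exp (- c * (cmod (w - a))\<^sup>2) * exp (- g w))"
        unfolding v_def torus_theta_norm_def theta_norm_as_modulus c_def by (simp add: mult.assoc)
      moreover have "cmod (exp (- F w)) = exp (- Re (F w))" by simp
      ultimately show ?thesis unfolding H_def by (simp only: norm_mult)
    qed
    ultimately show "\<exists>r>0. \<exists>F. F holomorphic_on ball x r \<and> (\<forall>w\<in>ball x r. v w = cmod (F w))"
      using r(1) by blast
  qed
  have pos: "v x \<ge> 0" for x by (simp add: v_def torus_theta_norm_def theta_norm_nonneg)
  have per: "v (x + l) = v x" if "l \<in> lattice \<tau>" for x l
  proof -
    have "torus_theta_norm (x + l - a) = torus_theta_norm (x - a)"
      using torus_theta_norm_periodic[OF that, of "x - a"] by (simp add: algebra_simps)
    then show ?thesis by (simp add: v_def g_def proj_add_lattice[OF that])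
  qed
  have "\<exists>R0>0. \<exists>B. \<forall>x. x \<in> ball a R0 - {a} \<longrightarrow> v x \<le> B"
  proof -
    have "(\<lambda>w. g w - ln (torus_dist \<tau> (proj \<tau> w) ?Q)) \<in> O[at a](\<lambda>_. 1)"
      unfolding g_def using G[unfolded green_function_def, THEN conjunct2, THEN conjunct2] by (rule spec)
    then obtain C where C: "\<forall>\<^sub>F w in at a. \<bar>g w - ln (torus_dist \<tau> (proj \<tau> w) ?Q)\<bar> \<le> C"
      by (auto elim!: landau_o.bigE)
    define K where "K = cmod D / cmod w1 + 1"
    have "\<forall>\<^sub>F w in at a. torus_theta_norm (w - a) / cmod (w - a) < K"
      by (rule order_tendstoD(2)[OF torus_theta_norm_tendsto[OF D]]) (simp add: K_def)
    then have "\<forall>\<^sub>F w in at a. v w \<le> K * sqrt (Im \<tau>) * exp C"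
      using C torus_dist_near[of a] eventually_neq_at_within[of a a UNIV]
    proof eventually_elim
      case (elim w)
      have d: "cmod (w - a) > 0" using elim(4) by simp
      have "- g w \<le> C - ln (cmod (w - a) / sqrt (Im \<tau>))" using elim(2)[unfolded elim(3)] by linarith
      then have "exp (- g w) \<le> exp (C - ln (cmod (w - a) / sqrt (Im \<tau>)))" by simp
      also have "\<dots> = exp C * (sqrt (Im \<tau>) / cmod (w - a))"
        using d Im_pos by (simp add: exp_diff)
      finally have e: "exp (- g w) \<le> exp C * (sqrt (Im \<tau>) / cmod (w - a))" .
      have "torus_theta_norm (w - a) \<le> K * cmod (w - a)" using elim(1) d by (simp add: field_simps)
      then have "v w \<le> (K * cmod (w - a)) * (exp C * (sqrt (Im \<tau>) / cmod (w - a)))"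
        unfolding v_def using e d by (intro mult_mono) (auto simp: K_def)
      also have "\<dots> = K * sqrt (Im \<tau>) * exp C" using d by simp
      finally show ?case .
    qed
    then obtain R0 where "R0 > 0" "\<And>w. w \<noteq> a \<Longrightarrow> dist w a < R0 \<Longrightarrow> v w \<le> K * sqrt (Im \<tau>) * exp C"
      unfolding eventually_at by blast
    then show ?thesis by (intro exI[of _ R0] conjI exI[of _ "K * sqrt (Im \<tau>) * exp C"]) (auto simp: dist_commute)
  qed
  then obtain R0 B where RB: "R0 > 0" "\<And>x. x \<in> ball a R0 - {a} \<Longrightarrow> v x \<le> B" by blast
  obtain K where K: "\<And>x. x - a \<notin> lattice \<tau> \<Longrightarrow> v x = K"
    using periodic_modulus_constant[OF lhm pos per RB] by blast
  have z0: "z0 \<notin> lattice \<tau>" using N0 torus_theta_norm_lattice by force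
  have "v (z0 + a) = K" using K[of "z0 + a"] z0 by simp
  moreover have "g (z0 + a) \<le> 0"
  proof -
    have "G (proj \<tau> (z0 + a)) ?Q < 0"
      using G[unfolded green_function_def, THEN conjunct1] proj_in_torus by blast
    then show ?thesis unfolding g_def
      by (cases "G (proj \<tau> (z0 + a)) ?Q") auto
  qed
  ultimately have "K \<ge> torus_theta_norm z0"
    using N0 mult_left_mono[of 1 "exp (- g (z0 + a))" "torus_theta_norm z0"] by (simp add: v_def)
  moreover have "torus_theta_norm (z - a) = K * exp (g z)"
    using K[OF z] by (simp add: v_def exp_minus field_simps)
  ultimately have "torus_theta_norm (z - a) \<ge> torus_theta_norm z0 * exp (g z)" by (simp add: mult_right_mono)
  then show ?thesis using N0 by (simp add: g_def field_simps)
qed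

text \<open>
  The capacity is a limit in the second argument of \<open>G\<close>, so the bound above is applied with the pole at the
  moving point \<open>w\<close>.
\<close>

theorem log_capacity_bound:
  assumes G: "green_function \<tau> G" and c: "is_log_capacity \<tau> G c"
    and D: "(odd_theta \<tau>' has_field_derivative D) (at 0)" and N0: "torus_theta_norm z0 > 0"
  shows "0 < c (proj \<tau> z)" "c (proj \<tau> z) \<le> cmod D * sqrt (Im \<tau>') / torus_theta_norm z0"
proof -
  obtain l where l: "((\<lambda>w. real_of_ereal (G (proj \<tau> z) (proj \<tau> w)) - ln (torus_dist \<tau> (proj \<tau> z) (proj \<tau> w))) \<longlongrightarrow> l) (at z)"
    "c (proj \<tau> z) = exp l"
    using c unfolding is_log_capacity_def by blast
  show "0 < c (proj \<tau> z)" by (simp add: l(2))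
  have lim1: "((\<lambda>w. exp (real_of_ereal (G (proj \<tau> z) (proj \<tau> w)) - ln (torus_dist \<tau> (proj \<tau> z) (proj \<tau> w)))) \<longlongrightarrow> exp l) (at z)"
    by (intro tendsto_intros l)
  (* Reflection in z replaces z - w by w - z. *)
  have f: "filterlim (\<lambda>w. 2 * z - w) (at z) (at z)"
    unfolding filterlim_at by (auto simp: eventually_at_filter intro!: tendsto_eq_intros)
  have "((\<lambda>w. torus_theta_norm ((2 * z - w) - z) / cmod ((2 * z - w) - z)) \<longlongrightarrow> cmod D / cmod w1) (at z)"
    by (rule filterlim_compose[OF torus_theta_norm_tendsto[OF D] f])
  then have "((\<lambda>w. torus_theta_norm (z - w) / cmod (z - w)) \<longlongrightarrow> cmod D / cmod w1) (at z)" by simp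
  then have lim2: "((\<lambda>w. torus_theta_norm (z - w) / cmod (z - w) * (sqrt (Im \<tau>) / torus_theta_norm z0))
      \<longlongrightarrow> cmod D / cmod w1 * (sqrt (Im \<tau>) / torus_theta_norm z0)) (at z)"
    by (rule tendsto_mult_right)
  have near: "\<forall>\<^sub>F w in at z. cmod (w - z) < cmod w1 / 2"
    unfolding eventually_at by (intro exI[of _ "cmod w1 / 2"]) (use w1_nonzero in \<open>auto simp: dist_norm\<close>)
  have "\<forall>\<^sub>F w in at z. exp (real_of_ereal (G (proj \<tau> z) (proj \<tau> w)) - ln (torus_dist \<tau> (proj \<tau> z) (proj \<tau> w)))
      \<le> torus_theta_norm (z - w) / cmod (z - w) * (sqrt (Im \<tau>) / torus_theta_norm z0)"
    using near eventually_neq_at_within[of z z UNIV]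
  proof eventually_elim
    case (elim w)
    have d: "cmod (z - w) > 0" using elim(2) by simp
    have "z - w \<notin> lattice \<tau>"
    proof
      assume "z - w \<in> lattice \<tau>"
      then have "cmod w1 \<le> cmod (z - w)" using elim(2) by (intro shortest) auto
      then show False using elim(1) norm_minus_commute[of w z] norm_ge_zero[of "w - z"] by linarith
    qed
    note b = green_function_bound[OF G D N0 this]
    have td: "torus_dist \<tau> (proj \<tau> z) (proj \<tau> w) = cmod (z - w) / sqrt (Im \<tau>)"
      using setdist_proj[of z w] elim(1) by (simp add: torus_dist_def norm_minus_commute)
    have "exp (real_of_ereal (G (proj \<tau> z) (proj \<tau> w)) - ln (torus_dist \<tau> (proj \<tau> z) (proj \<tau> w))) =
        exp (real_of_ereal (G (proj \<tau> z) (proj \<tau> w))) * (sqrt (Im \<tau>) / cmod (z - w))"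
      using d Im_pos by (simp add: exp_diff td)
    also have "\<dots> \<le> torus_theta_norm (z - w) / torus_theta_norm z0 * (sqrt (Im \<tau>) / cmod (z - w))"
      using b d Im_pos by (intro mult_right_mono) auto
    finally show ?case by (simp add: mult_ac)
  qed
  from tendsto_le[OF at_neq_bot lim2 lim1 this]
  have "exp l \<le> cmod D / cmod w1 * (sqrt (Im \<tau>) / torus_theta_norm z0)" .
  also have "sqrt (Im \<tau>) = cmod w1 * sqrt (Im \<tau>')"
    by (simp add: Im_tau real_sqrt_mult)
  finally show "c (proj \<tau> z) \<le> cmod D * sqrt (Im \<tau>') / torus_theta_norm z0"
    using w1_nonzero by (simp add: l(2))
qed

end

section \<open>Numerical comparison\<close>

lemma exp_1_lower: "exp (1::real) \<ge> (2718 / 1000)"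
proof -
  have "5837465777 / 2147483648 - inverse (2 ^ 32) \<le> exp (1::real)"
    using e_approx_32 unfolding abs_le_iff by linarith
  then show ?thesis by simp
qed

lemma exp_lower_numerals:
  fixes x :: real
  shows "x \<ge> 4 \<Longrightarrow> exp x \<ge> 50" and "x \<ge> (543 / 100) \<Longrightarrow> exp x \<ge> 200"
proof -
  have e: "exp (1::real) \<ge> (27 / 10)" using exp_1_lower by linarith
  have e4: "exp (4::real) \<ge> 53" "exp (5::real) \<ge> 143"
  proof -
    have "((27 / 10)::real) ^ 4 \<le> exp 1 ^ 4" "((27 / 10)::real) ^ 5 \<le> exp 1 ^ 5" using e by (intro power_mono; simp)+
    then show "exp (4::real) \<ge> 53" "exp (5::real) \<ge> 143"
      by (simp_all add: exp_of_nat_mult[symmetric] power_divide)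
  qed
  show "exp x \<ge> 50" if "x \<ge> 4"
  proof -
    have "exp 4 \<le> exp x" using that by simp
    then show ?thesis using e4(1) by linarith
  qed
  show "exp x \<ge> 200" if "x \<ge> (543 / 100)"
  proof -
    have "((143 / 100)::real) \<le> exp (43 / 100)" using exp_ge_add_one_self[of "(43 / 100)::real"] by simp
    then have "(143::real) * (143 / 100) \<le> exp 5 * exp (43 / 100)" using e4(2) by (intro mult_mono) auto
    also have "\<dots> = exp (543 / 100)" by (simp add: exp_add[symmetric])
    also have "\<dots> \<le> exp x" using that by simp
    finally show ?thesis by simp
  qed
qed

lemma exp_minus_le:
  fixes x c :: real
  assumes "exp x \<ge> c" "c > 0"
  shows "exp (- x) \<le> 1 / c"
  using assms by (simp add: exp_minus field_simps)

lemma pi_T_bounds: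
  fixes T :: real
  assumes "T \<ge> sqrt 3 / 2"
  shows "T \<ge> (866 / 1000)" "pi * T \<ge> (272 / 100)"
proof -
  have "((1732 / 1000)::real) \<le> sqrt 3" by (rule real_le_rsqrt) (simp add: power2_eq_square)
  then show T: "T \<ge> (866 / 1000)" using assms by linarith
  have "(31415 / 10000) * (866 / 1000) \<le> pi * T" using T pi_approx(1) by (intro mult_mono) auto
  then show "pi * T \<ge> (272 / 100)" by simp
qed

text \<open>
  The exponential is bounded below by its tangent at \<open>2\<close>, near the values of the exponent at the critical
  degrees \<open>4\<close> and \<open>5\<close>. What remains is linear in \<open>T\<close> with positive slope, so it
  suffices to treat \<open>T = 0.866\<close>; there the inequality becomes a cubic in \<open>d - 3\<close> with positive
  coefficients.
\<close>

lemma key_exponential_inequality: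
  fixes T d :: real
  assumes T: "T \<ge> sqrt 3 / 2" and d: "d \<ge> 3"
  shows "195 * T * ((d - 2) / d)\<^sup>2 \<le> 2 * d * exp (pi * T * (1 - 1 / d))"
proof -
  define e where "e = d - 3"
  (* 46.36 is slightly less than 14.76 pi, and 14.76 = 2 * 7.38 with 7.38 < exp 2. *)
  define A where "A = (4636 / 100) * (d - 1) * d\<^sup>2 - 195 * (d - 2)\<^sup>2"
  have e0: "e \<ge> 0" and de: "d = e + 3" using d by (auto simp: e_def)
  note T1 = pi_T_bounds(1)[OF T]
  have "(866 / 1000) * A - (1476 / 100) * d ^ 3 = (2538776 / 100000) * e ^ 3 + (1947208 / 100000) * e\<^sup>2 + (10684296 / 100000) * e + (15526968 / 100000)"
    unfolding A_def de by (simp add: power2_eq_square power3_eq_cube algebra_simps) 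
  then have p: "(866 / 1000) * A - (1476 / 100) * d ^ 3 \<ge> 0" using e0 by simp
  have "d ^ 3 > 0" using d by simp
  then have A0: "A \<ge> 0" using p by linarith
  have "(866 / 1000) * A \<le> T * A" using T1 A0 by (intro mult_right_mono)
  then have "(1476 / 100) * d ^ 3 \<le> T * A" using p by linarith
  note base = this
  define u where "u = T * (d - 1) * d\<^sup>2"
  define t where "t = T * (d - 2)\<^sup>2"
  have TA: "T * A = (4636 / 100) * u - 195 * t"
    unfolding A_def u_def t_def by (simp add: algebra_simps)
  have pu: "(4636 / 100) * u \<le> (1476 / 100) * (pi * u)"
    using mult_right_mono[of "4636 / 100" "(1476 / 100) * pi" u] pi_approx(1) T1 d
    by (simp add: u_def mult.assoc)
  have "195 * t \<le> (1476 / 100) * (pi * u) - (1476 / 100) * d ^ 3"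
    using base TA pu by linarith
  then have 2: "195 * T * (d - 2)\<^sup>2 \<le> (1476 / 100) * (pi * T * (d - 1) * d\<^sup>2 - d ^ 3)"
  proof -
    have "195 * T * (d - 2)\<^sup>2 = 195 * t" "pi * T * (d - 1) * d\<^sup>2 = pi * u" by (simp_all add: t_def u_def)
    with \<open>195 * t \<le> _\<close> show ?thesis by (simp only: right_diff_distrib)
  qed
  define X where "X = pi * T * (1 - 1 / d)"
  have "(2718 / 1000) * (2718 / 1000) \<le> exp (1::real) * exp 1" using exp_1_lower by (intro mult_mono) auto
  then have e2: "(738 / 100) \<le> exp (2::real)" by (simp add: exp_add[symmetric])
  have X1: "X \<ge> 1"
  proof -
    have "1 - 1 / d \<ge> 2 / 3" using d by (simp add: field_simps)
    then have "(272 / 100) * (2 / 3) \<le> X" unfolding X_def using pi_T_bounds(2)[OF T] by (intro mult_mono) auto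
    then show ?thesis by simp
  qed
  have "(738 / 100) * (X - 1) \<le> exp 2 * exp (X - 2)"
    using e2 X1 exp_ge_add_one_self[of "X - 2"] by (intro mult_mono) auto
  then have eX: "(738 / 100) * (X - 1) \<le> exp X" by (simp add: exp_add[symmetric])
  have "(1476 / 100) * (pi * T * (d - 1) * d\<^sup>2 - d ^ 3) = d\<^sup>2 * (2 * d * ((738 / 100) * (X - 1)))"
    unfolding X_def using d by (simp add: power2_eq_square power3_eq_cube field_simps)
  with 2 have "195 * T * (d - 2)\<^sup>2 \<le> d\<^sup>2 * (2 * d * ((738 / 100) * (X - 1)))" by (simp only:)
  also have "\<dots> \<le> d\<^sup>2 * (2 * d * exp X)" using d eX by (intro mult_left_mono) auto
  finally show ?thesis unfolding X_def using d by (simp add: power_divide field_simps)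
qed

text \<open>
  Since \<open>\<pi> T \<ge> 2.72\<close>, the corrections \<open>r\<close>, \<open>Y\<close> and \<open>x\<close> are at most \<open>1/200\<close>, \<open>1/200\<close> and \<open>1/50\<close>. They
  enter as a factor \<open>1.031\<close> in the bound of \<open>c\<^sup>2\<close> and \<open>0.93\<close> in that of \<open>K\<close>. The constant \<open>195\<close> of
  \<open>key_exponential_inequality\<close> is chosen to exceed \<open>16 \<pi>\<^sup>2 (1.031 / 0.93)\<^sup>2\<close>.
\<close>

lemma capacity_versus_kernel_numerics:
  fixes T d \<delta> K c D N M I :: real
  assumes T: "T \<ge> sqrt 3 / 2" and d: "d \<ge> 3"
    and r: "r = exp (- 2 * pi * T)" and Y: "Y = exp (- pi * T * (d - 1))" and x: "x = exp (- (pi * d * T) / 2)"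
    and \<delta>: "\<bar>\<delta>\<bar> \<le> 1 / (2 * d)"
    and M: "M \<ge> exp (- pi * d * T * \<delta>\<^sup>2) * (1 - 2 * Y / (1 - Y))"
    and I: "I = sqrt (pi / (2 * (pi * d * T))) * ((1 + x) / (1 - x))"
    and K: "M\<^sup>2 \<le> K * I"
    and c: "0 < c" "c \<le> D * sqrt T / N" and D: "0 \<le> D" "D \<le> 2 * pi * exp (- pi * T / 4) / (1 - 3 * r)"
    and N: "N \<ge> 1 - 2 * r\<^sup>2 / (1 - r)"
  shows "c\<^sup>2 \<le> pi * (1 + 1 / (d / 2 - 1)) * K"
proof -
  note TT = pi_T_bounds[OF T]
  have r1: "0 < r" "r \<le> 1 / 200"
  proof -
    have "exp (2 * pi * T) \<ge> 200" by (rule exp_lower_numerals(2)) (use TT in simp)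
    then show "0 < r" "r \<le> 1 / 200" unfolding r using exp_minus_le[of 200 "2 * pi * T"] by simp_all
  qed
  have Y1: "0 < Y" "Y \<le> 1 / 200"
  proof -
    have "(pi * T) * 2 \<le> (pi * T) * (d - 1)" using TT d by (intro mult_left_mono) auto
    then have "exp (pi * T * (d - 1)) \<ge> 200" using TT by (intro exp_lower_numerals(2)) linarith
    then show "0 < Y" "Y \<le> 1 / 200" unfolding Y using exp_minus_le[of 200 "pi * T * (d - 1)"] by simp_all
  qed
  have x1: "0 < x" "x \<le> 1 / 50"
  proof -
    have "(pi * T) * 3 \<le> (pi * T) * d" using TT d by (intro mult_left_mono) auto
    moreover have "pi * d * T = (pi * T) * d" by simp
    ultimately have "exp (pi * d * T / 2) \<ge> 50" using TT by (intro exp_lower_numerals(1)) linarith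
    then show "0 < x" "x \<le> 1 / 50" unfolding x using exp_minus_le[of 50 "pi * d * T / 2"] by simp_all
  qed
  have Tpos: "T > 0" using TT by simp
  have "r\<^sup>2 \<le> (1 / 200)\<^sup>2" using r1 by (intro power_mono) auto
  then have "2 * r\<^sup>2 / (1 - r) \<le> (2 * (1 / 200)\<^sup>2) / (199 / 200)" using r1 by (intro frac_le) auto
  then have N1: "N \<ge> (9999 / 10000)" using N by (simp add: power2_eq_square)
  have "D \<le> 2 * pi * exp (- pi * T / 4) / (985 / 1000)"
    by (rule order_trans[OF D(2)]) (use r1 in \<open>intro divide_left_mono; simp\<close>)
  then have "D * sqrt T / N \<le> (2 * pi * exp (- pi * T / 4) / (985 / 1000)) * sqrt T / (9999 / 10000)"
    using N1 Tpos D(1) by (intro frac_le mult_right_mono) auto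
  with c(2) have "c \<le> (2 * pi * exp (- pi * T / 4) / (985 / 1000)) * sqrt T / (9999 / 10000)" by (rule order_trans)
  then have "c \<le> 2 * pi * exp (- pi * T / 4) * sqrt T * (1 / ((985 / 1000) * (9999 / 10000)))" by simp
  then have "c\<^sup>2 \<le> (2 * pi * exp (- pi * T / 4) * sqrt T * (1 / ((985 / 1000) * (9999 / 10000))))\<^sup>2"
    using c(1) by (intro power_mono) auto
  also have "\<dots> = 4 * pi\<^sup>2 * exp (- pi * T / 2) * T * (1 / ((985 / 1000) * (9999 / 10000)))\<^sup>2"
  proof -
    have "(exp (- pi * T / 4))\<^sup>2 = exp (- pi * T / 2)" by (simp add: exp_double[symmetric])
    then show ?thesis using Tpos by (simp only: power_mult_distrib real_sqrt_pow2[OF less_imp_le[OF Tpos]]) simp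
  qed
  also have "\<dots> \<le> 4 * pi\<^sup>2 * exp (- pi * T / 2) * T * (1031 / 1000)"
    using Tpos by (intro mult_left_mono) (auto simp: power2_eq_square)
  finally have cap: "c\<^sup>2 \<le> 4 * pi\<^sup>2 * exp (- pi * T / 2) * T * (1031 / 1000)" .
  have "2 * Y / (1 - Y) \<le> (2 * (1 / 200)) / (199 / 200)" using Y1 by (intro frac_le) auto
  then have "1 - 2 * Y / (1 - Y) \<ge> (9899 / 10000)" by simp
  then have M1: "exp (- pi * d * T * \<delta>\<^sup>2) * (9899 / 10000) \<le> M"
    by (intro order_trans[OF _ M] mult_left_mono) auto
  have "\<delta>\<^sup>2 \<le> (1 / (2 * d))\<^sup>2" using \<delta> d by (subst abs_le_square_iff[symmetric]) simp
  then have "2 * (pi * d * T) * \<delta>\<^sup>2 \<le> 2 * (pi * d * T) * (1 / (2 * d))\<^sup>2" using d Tpos by (intro mult_left_mono) auto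
  also have "\<dots> = pi * T / (2 * d)" using d by (simp add: power2_eq_square field_simps)
  finally have \<delta>1: "2 * (pi * d * T) * \<delta>\<^sup>2 \<le> pi * T / (2 * d)" .
  have "(exp (- pi * d * T * \<delta>\<^sup>2) * (9899 / 10000))\<^sup>2 \<le> M\<^sup>2" using M1 by (intro power_mono) auto
  moreover have "(exp (- pi * d * T * \<delta>\<^sup>2) * (9899 / 10000))\<^sup>2 = exp (- (2 * (pi * d * T) * \<delta>\<^sup>2)) * (9899 / 10000)\<^sup>2"
    unfolding power_mult_distrib by (simp add: exp_double[symmetric])
  moreover have "exp (- (pi * T / (2 * d))) * (9899 / 10000)\<^sup>2 \<le> exp (- (2 * (pi * d * T) * \<delta>\<^sup>2)) * (9899 / 10000)\<^sup>2"
    using \<delta>1 by (intro mult_right_mono) auto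
  ultimately have "exp (- (pi * T / (2 * d))) * (9899 / 10000)\<^sup>2 \<le> M\<^sup>2" by linarith
  moreover have "exp (- (pi * T / (2 * d))) * (97 / 100) \<le> exp (- (pi * T / (2 * d))) * (9899 / 10000)\<^sup>2"
    by (intro mult_left_mono) (auto simp: power2_eq_square)
  ultimately have "exp (- (pi * T / (2 * d))) * (97 / 100) \<le> M\<^sup>2" by linarith
  then have KI: "exp (- (pi * T / (2 * d))) * (97 / 100) \<le> K * I" using K by linarith
  have "(1 + x) / (1 - x) \<le> (51 / 50) / (49 / 50)" using x1 by (intro frac_le) auto
  also have "\<dots> \<le> 1041 / 1000" by simp
  finally have x2: "(1 + x) / (1 - x) \<le> (1041 / 1000)" .
  have s: "sqrt (pi / (2 * (pi * d * T))) = 1 / sqrt (2 * d * T)"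
    by (simp add: real_sqrt_divide)
  have S: "sqrt (2 * d * T) > 0" using d Tpos by simp
  have "I \<le> 1 / sqrt (2 * d * T) * (1041 / 1000)"
    unfolding I s by (rule mult_left_mono[OF x2]) (use S in simp)
  moreover have "I > 0" unfolding I s using x1 S by (intro mult_pos_pos divide_pos_pos) auto
  ultimately have I1: "I \<le> 1 / sqrt (2 * d * T) * (1041 / 1000)" "I > 0" by auto
  have Kpos: "K > 0"
  proof (rule ccontr)
    assume "\<not> K > 0"
    then have "K * I \<le> 0" using I1(2) by (simp add: mult_nonpos_nonneg)
    moreover have "exp (- (pi * T / (2 * d))) * (97 / 100) > 0" by simp
    ultimately show False using KI by linarith
  qed
  have "exp (- (pi * T / (2 * d))) * (97 / 100) \<le> K * (1 / sqrt (2 * d * T) * (1041 / 1000))"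
    by (rule order_trans[OF KI mult_left_mono[OF I1(1)]]) (use Kpos in simp)
  then have "sqrt (2 * d * T) * exp (- (pi * T / (2 * d))) * (97 / 100) \<le> K * (1041 / 1000)"
    using S by (simp add: field_simps)
  moreover have "sqrt (2 * d * T) * exp (- (pi * T / (2 * d))) \<ge> 0" using S by simp
  ultimately have K1: "(93 / 100) * (sqrt (2 * d * T) * exp (- (pi * T / (2 * d)))) \<le> K" by linarith
  define q where "q = (d - 2) / d"
  have q: "q > 0" using d by (simp add: q_def)
  define L where "L = (1031 / 1000) * (4 * pi * T * q * exp (- (pi * T / 2)))"
  define R where "R = (93 / 100) * (sqrt (2 * d * T) * exp (- (pi * T / (2 * d))))"
  have "L\<^sup>2 \<le> R\<^sup>2"
  proof -
    have E: "(exp (- (pi * T / 2)))\<^sup>2 = exp (- (pi * T))" "(exp (- (pi * T / (2 * d))))\<^sup>2 = exp (- (pi * T / d))"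
      by (simp_all add: exp_double[symmetric])
    have L2: "L\<^sup>2 = ((1031 / 1000)\<^sup>2 * 16 * pi\<^sup>2) * (T * exp (- (pi * T)) * (T * q\<^sup>2))"
      unfolding L_def power_mult_distrib E by (simp add: power2_eq_square)
    have R2: "R\<^sup>2 = (93 / 100)\<^sup>2 * (2 * d * T * exp (- (pi * T / d)))"
      unfolding R_def power_mult_distrib E using d Tpos by simp
    have "pi\<^sup>2 \<le> (31416 / 10000)\<^sup>2" using pi_approx(2) by (intro power_mono) auto
    then have "(1031 / 1000)\<^sup>2 * 16 * pi\<^sup>2 \<le> (93 / 100)\<^sup>2 * 195" by (simp add: power2_eq_square)
    then have "L\<^sup>2 \<le> (93 / 100)\<^sup>2 * 195 * (T * exp (- (pi * T)) * (T * q\<^sup>2))"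
      unfolding L2 using Tpos by (intro mult_right_mono) auto
    also have "\<dots> = (93 / 100)\<^sup>2 * (T * exp (- (pi * T))) * (195 * T * q\<^sup>2)" by simp
    also have "\<dots> \<le> (93 / 100)\<^sup>2 * (T * exp (- (pi * T))) * (2 * d * exp (pi * T * (1 - 1 / d)))"
      using key_exponential_inequality[OF T d] Tpos unfolding q_def by (intro mult_left_mono) auto
    also have "\<dots> = (93 / 100)\<^sup>2 * (2 * d * T * (exp (- (pi * T)) * exp (pi * T * (1 - 1 / d))))" by simp
    also have "exp (- (pi * T)) * exp (pi * T * (1 - 1 / d)) = exp (- (pi * T / d))"
      unfolding exp_add[symmetric] by (simp add: algebra_simps)
    finally show ?thesis unfolding R2 .
  qed
  moreover have "R \<ge> 0" using S unfolding R_def by simp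
  ultimately have LR: "L \<le> R" by (rule power2_le_imp_le)
  have "1 + 1 / (d / 2 - 1) = 1 / q" using d by (simp add: q_def field_simps)
  then have "pi * (1 + 1 / (d / 2 - 1)) * K = pi / q * K" by simp
  also have "\<dots> \<ge> pi / q * L" using LR K1 q unfolding R_def by (intro mult_left_mono) auto
  also have "pi / q * L = 4 * pi\<^sup>2 * exp (- pi * T / 2) * T * (1031 / 1000)"
    using q by (simp add: L_def power2_eq_square)
  finally show ?thesis using cap by linarith
qed

section \<open>Theta sections of the line bundle\<close>

lemma unit_complex_exp:
  assumes "cmod a = 1"
  obtains t :: real where "a = exp (2 * of_real pi * \<i> * of_real t)"
proof -
  define r where "r = Arg2pi a"
  have "a = exp (\<i> * of_real r)" using assms complex_norm_eq_1_exp[of a] by (simp add: r_def)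
  moreover have "\<i> * of_real r = 2 * of_real pi * \<i> * of_real (r / (2 * pi))" by simp
  ultimately have "a = exp (2 * of_real pi * \<i> * of_real (r / (2 * pi)))" by (simp only:)
  then show ?thesis by (rule that)
qed

context reduced_basis
begin

text \<open>
  The coefficient of a theta section with respect to a flat frame. The quadratic exponential
  converts between the classical normalization of theta series, periodic up to a constant in the direction \<open>1\<close>,
  and the rotation invariant weight of the frame.
\<close>

definition theta_factor :: "int \<Rightarrow> real \<Rightarrow> real \<Rightarrow> complex \<Rightarrow> complex" where
  "theta_factor d s \<beta> z =
     exp (of_real (pi * of_int d / (2 * Im \<tau>')) * (z / w1)\<^sup>2) * theta d s \<beta> \<tau>' (z / w1)"

lemma theta_factor_holomorphic:
  assumes "d > 0"
  shows "theta_factor d s \<beta> holomorphic_on A"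
proof -
  have "(theta d s \<beta> \<tau>' \<circ> (\<lambda>z. z / w1)) holomorphic_on A"
    by (rule holomorphic_on_compose_gen[OF _ theta_holomorphic[OF Im_reduced_pos assms, of _ _ UNIV]])
       (auto intro!: holomorphic_intros simp: w1_nonzero)
  then show ?thesis
    unfolding theta_factor_def using w1_nonzero by (auto intro!: holomorphic_intros simp: o_def)
qed

text \<open>
  The exponential in the first line is the inverse of the one by which a flat frame is multiplied under
  the same translation, and likewise in the next lemma.
\<close>

lemma theta_factor_plus_w1:
  "theta_factor d s \<beta> (z + w1) =
     exp (of_real (pi * of_int d / Im \<tau>) * (cnj w1 * z + of_real ((cmod w1)\<^sup>2) / 2)) *
     exp (2 * of_real pi * \<i> * of_real (of_int d * s)) * theta_factor d s \<beta> z"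
proof -
  define y where "y = z / w1"
  define k where "k = complex_of_real (pi * of_int d / (2 * Im \<tau>'))"
  have z: "z = w1 * y" using w1_nonzero by (simp add: y_def)
  have zw: "(z + w1) / w1 = y + 1" using w1_nonzero by (simp add: y_def add_divide_distrib)
  have "cnj w1 * z + of_real ((cmod w1)\<^sup>2) / 2 = of_real ((cmod w1)\<^sup>2) * (y + 1 / 2)"
    unfolding z by (simp only: complex_norm_square) (simp add: algebra_simps)
  moreover have "of_real (pi * of_int d / Im \<tau>) * of_real ((cmod w1)\<^sup>2) = 2 * k"
    using w1_nonzero by (simp add: Im_tau k_def)
  ultimately have e: "of_real (pi * of_int d / Im \<tau>) * (cnj w1 * z + of_real ((cmod w1)\<^sup>2) / 2) = 2 * k * (y + 1 / 2)"
    by (simp only: mult.assoc[symmetric])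
  have "exp (k * (y + 1)\<^sup>2) = exp (2 * k * (y + 1 / 2)) * exp (k * y\<^sup>2)"
    unfolding exp_add[symmetric] by (simp add: power2_eq_square algebra_simps)
  then show ?thesis
    unfolding e theta_factor_def zw y_def[symmetric] theta_plus_1 k_def[symmetric]
    by (simp add: mult_ac)
qed

lemma theta_factor_plus_w2:
  "theta_factor d s \<beta> (z + w1 * \<tau>') =
     exp (of_real (pi * of_int d / Im \<tau>) * (cnj (w1 * \<tau>') * z + of_real ((cmod (w1 * \<tau>'))\<^sup>2) / 2)) *
     exp (- 2 * of_real pi * \<i> * of_real \<beta>) * theta_factor d s \<beta> z"
proof -
  define y where "y = z / w1"
  define k where "k = complex_of_real (pi * of_int d / (2 * Im \<tau>'))"
  have T': "Im \<tau>' > 0" by (rule Im_reduced_pos)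
  have z: "z = w1 * y" using w1_nonzero by (simp add: y_def)
  have zw: "(z + w1 * \<tau>') / w1 = y + \<tau>'" using w1_nonzero by (simp add: y_def add_divide_distrib)
  have "cnj (w1 * \<tau>') * z + of_real ((cmod (w1 * \<tau>'))\<^sup>2) / 2 = of_real ((cmod w1)\<^sup>2) * (cnj \<tau>' * y + \<tau>' * cnj \<tau>' / 2)"
    unfolding z by (simp only: complex_norm_square) (simp add: algebra_simps)
  moreover have "of_real (pi * of_int d / Im \<tau>) * of_real ((cmod w1)\<^sup>2) = 2 * k"
    using w1_nonzero by (simp add: Im_tau k_def)
  ultimately have e: "of_real (pi * of_int d / Im \<tau>) * (cnj (w1 * \<tau>') * z + of_real ((cmod (w1 * \<tau>'))\<^sup>2) / 2) =
      2 * k * (cnj \<tau>' * y + \<tau>' * cnj \<tau>' / 2)"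
    by (simp only: mult.assoc[symmetric])
  have kd: "of_real pi * \<i> * of_int d = k * (\<tau>' - cnj \<tau>')"
  proof -
    have "\<tau>' - cnj \<tau>' = 2 * \<i> * of_real (Im \<tau>')" by (simp add: complex_diff_cnj)
    then show ?thesis using T' by (simp add: k_def)
  qed
  have "k * (y + \<tau>')\<^sup>2 + (- of_real pi * \<i> * of_int d * (\<tau>' + 2 * y) - 2 * of_real pi * \<i> * of_real \<beta>) =
      k * (y + \<tau>')\<^sup>2 - k * (\<tau>' - cnj \<tau>') * (\<tau>' + 2 * y) - 2 * of_real pi * \<i> * of_real \<beta>"
    unfolding kd[symmetric] by simp
  also have "\<dots> = 2 * k * (cnj \<tau>' * y + \<tau>' * cnj \<tau>' / 2) + - 2 * of_real pi * \<i> * of_real \<beta> + k * y\<^sup>2"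
    by (simp add: power2_eq_square algebra_simps)
  finally have E: "k * (y + \<tau>')\<^sup>2 + (- of_real pi * \<i> * of_int d * (\<tau>' + 2 * y) - 2 * of_real pi * \<i> * of_real \<beta>) =
      2 * k * (cnj \<tau>' * y + \<tau>' * cnj \<tau>' / 2) + - 2 * of_real pi * \<i> * of_real \<beta> + k * y\<^sup>2" .
  have "exp (k * (y + \<tau>')\<^sup>2) * exp (- of_real pi * \<i> * of_int d * (\<tau>' + 2 * y) - 2 * of_real pi * \<i> * of_real \<beta>) =
      exp (2 * k * (cnj \<tau>' * y + \<tau>' * cnj \<tau>' / 2)) * exp (- 2 * of_real pi * \<i> * of_real \<beta>) * exp (k * y\<^sup>2)"
    unfolding exp_add[symmetric] by (rule arg_cong[OF E])
  then show ?thesis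
    unfolding e theta_factor_def zw y_def[symmetric] theta_plus_tau k_def[symmetric]
    by (simp only: mult.assoc[symmetric])
qed

text \<open>
  The multipliers \<open>a\<^sub>1\<close> and \<open>a\<^sub>2\<close> of the flat frame are unimodular, so the product with a theta series
  descends to the torus once \<open>exp (2 \<pi> \<i> d s) a\<^sub>1 = 1\<close> and \<open>exp (- 2 \<pi> \<i> \<beta>) a\<^sub>2 = 1\<close>. The first equation
  fixes \<open>d s\<close> up to an integer, and this freedom centres the leading Gaussian near the given point.
\<close>

theorem theta_section_exists:
  assumes L: "holomorphic_line_bundle \<tau> L" and H: "hermitian_metric \<tau> L h"
    and curv: "\<forall>P\<in>torus \<tau>. c1_density \<tau> L h P = of_int d" and d: "d > 0"
  obtains \<sigma> s \<beta> where "holomorphic_section \<tau> L \<sigma>"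
    "\<And>i z. i \<in> bindex L \<Longrightarrow> proj \<tau> z \<in> bdom L i \<Longrightarrow>
       h i (proj \<tau> z) * (cmod (\<sigma> i (proj \<tau> z)))\<^sup>2 = (theta_norm d s \<beta> \<tau>' (z / w1))\<^sup>2"
    "\<bar>s + Im (p0 / w1) / Im \<tau>'\<bar> \<le> 1 / (2 * of_int d)"
proof -
  define c where "c = pi * of_int d / Im \<tau>"
  have lap: "laplacian (\<lambda>w. ln (h i (proj \<tau> w))) z = - 4 * c" if "i \<in> bindex L" "proj \<tau> z \<in> bdom L i" for i z
    using log_metric_laplacian[OF Im_pos L H curv that] by (simp add: c_def)
  obtain u where u: "flat_frame \<tau> L h c UNIV u" using flat_frame_global[OF Im_pos L H lap] by blast
  obtain a1 where a1: "cmod a1 = 1" "\<And>i z. i \<in> bindex L \<Longrightarrow> proj \<tau> z \<in> bdom L i \<Longrightarrow>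
        u i (z + w1) = a1 * exp (- of_real c * (cnj w1 * z + of_real ((cmod w1)\<^sup>2) / 2)) * u i z"
    using flat_frame_multiplier[OF L H u basis_in_lattice(1)] by blast
  obtain a2 where a2: "cmod a2 = 1" "\<And>i z. i \<in> bindex L \<Longrightarrow> proj \<tau> z \<in> bdom L i \<Longrightarrow>
        u i (z + w1 * \<tau>') = a2 * exp (- of_real c * (cnj (w1 * \<tau>') * z + of_real ((cmod (w1 * \<tau>'))\<^sup>2) / 2)) * u i z"
    using flat_frame_multiplier[OF L H u basis_in_lattice(2)] by blast
  obtain t1 where t1: "a1 = exp (2 * of_real pi * \<i> * of_real t1)" using unit_complex_exp[OF a1(1)] by blast
  obtain \<beta> where \<beta>: "a2 = exp (2 * of_real pi * \<i> * of_real \<beta>)" using unit_complex_exp[OF a2(1)] by blast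
  define x where "x = of_int d * (Im (p0 / w1) / Im \<tau>') - t1"
  define s where "s = (- of_int (round x) - t1) / of_int d"
  have ds: "of_int d * s = - of_int (round x) - t1" using d by (simp add: s_def)
  have "of_int d * (s + Im (p0 / w1) / Im \<tau>') = x - of_int (round x)"
    by (simp add: distrib_left ds x_def)
  moreover define X where "X = s + Im (p0 / w1) / Im \<tau>'"
  ultimately have "\<bar>of_int d * X\<bar> \<le> 1 / 2"
    using of_int_round_abs_le[of x] by (simp add: abs_minus_commute)
  then have "of_int d * \<bar>X\<bar> \<le> 1 / 2" using d by (simp add: abs_mult)
  then have "\<bar>X\<bar> \<le> 1 / (2 * of_int d)" using d by (simp add: field_simps)
  then have s: "\<bar>s + Im (p0 / w1) / Im \<tau>'\<bar> \<le> 1 / (2 * of_int d)" by (simp only: X_def)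
  have m1: "exp (2 * of_real pi * \<i> * of_real (of_int d * s)) * a1 = 1"
  proof -
    have "2 * of_real pi * \<i> * of_real (of_int d * s) + 2 * of_real pi * \<i> * of_real t1 =
        of_int (- round x) * (of_real (2 * pi) * \<i>)"
      unfolding ds by (simp add: algebra_simps)
    moreover have "exp (of_int (- round x) * (of_real (2 * pi) * \<i>)) = 1"
      by (auto simp: exp_eq_1 intro!: exI[of _ "- round x"])
    ultimately show ?thesis unfolding t1 exp_add[symmetric] by simp
  qed
  have m2: "exp (- 2 * of_real pi * \<i> * of_real \<beta>) * a2 = 1"
    unfolding \<beta> exp_add[symmetric] by simp
  define f where "f = theta_factor d s \<beta>"
  have inv: "f (z + l) * u i (z + l) = f z * u i z"
    if i: "i \<in> bindex L" "proj \<tau> z \<in> bdom L i" and l: "l \<in> lattice \<tau>" for i z l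
  proof -
    define F where "F z = (if proj \<tau> z \<in> bdom L i then f z * u i z else 0)" for z
    have cancel: "(exp A * m * X) * (a * exp (- of_real c * B) * Y) = X * Y"
      if "m * a = 1" "A = of_real c * B" for A B m X a Y :: complex
    proof -
      have "(exp A * m * X) * (a * exp (- of_real c * B) * Y) = (exp A * exp (- of_real c * B)) * (m * a) * (X * Y)"
        by (simp add: mult_ac)
      then show ?thesis using that by (simp add: exp_add[symmetric])
    qed
    have "F (z + w1) = F z" for z
      using a1(2)[OF i(1), of z] proj_add_lattice[OF basis_in_lattice(1), of z]
        cancel[OF m1, of _ _ "theta_factor d s \<beta> z" "u i z"] unfolding F_def f_def theta_factor_plus_w1 by (simp add: c_def)
    moreover have "F (z + w1 * \<tau>') = F z" for z
      using a2(2)[OF i(1), of z] proj_add_lattice[OF basis_in_lattice(2), of z]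
        cancel[OF m2, of _ _ "theta_factor d s \<beta> z" "u i z"] unfolding F_def f_def theta_factor_plus_w2 by (simp add: c_def)
    ultimately have "F (z + l) = F z" using l by (rule lattice_invariant)
    then show ?thesis using i(2) by (simp add: F_def proj_add_lattice[OF l])
  qed
  define \<sigma> where "\<sigma> i P = (let z = SOME z. z \<in> P in f z * u i z)" for i P
  have \<sigma>: "\<sigma> i (proj \<tau> z) = f z * u i z" if i: "i \<in> bindex L" "proj \<tau> z \<in> bdom L i" for i z
  proof -
    define z' where "z' = (SOME w. w \<in> proj \<tau> z)"
    have l: "z' - z \<in> lattice \<tau>" using proj_some[of \<tau> z] proj_eq_iff[of \<tau> z z'] by (simp add: z'_def)
    show ?thesis using inv[OF i l] by (simp add: \<sigma>_def z'_def)
  qed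
  have "holomorphic_section \<tau> L \<sigma>"
    unfolding holomorphic_section_def torus_holomorphic_on_def
  proof (intro conjI ballI)
    fix i assume i: "i \<in> bindex L"
    have "(\<lambda>z. f z * u i z) holomorphic_on (proj \<tau> -` bdom L i)"
      unfolding f_def using flat_frameD(1)[OF u i]
      by (intro holomorphic_intros theta_factor_holomorphic d) simp
    then show "(\<lambda>z. \<sigma> i (proj \<tau> z)) holomorphic_on (proj \<tau> -` bdom L i)"
      by (rule holomorphic_transform) (simp add: \<sigma>[OF i])
  next
    fix i j P assume i: "i \<in> bindex L" and j: "j \<in> bindex L" and P: "P \<in> bdom L i \<inter> bdom L j"
    then have "P \<in> torus \<tau>" using line_bundleD(3)[OF L] by blast
    then obtain z where z: "P = proj \<tau> z" unfolding torus_def by blast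
    show "\<sigma> i P = btrans L i j P * \<sigma> j P"
      using P \<sigma>[OF i, of z] \<sigma>[OF j, of z] flat_frameD(2)[OF u i j, of z] by (simp add: z)
  qed
  moreover have "h i (proj \<tau> z) * (cmod (\<sigma> i (proj \<tau> z)))\<^sup>2 = (theta_norm d s \<beta> \<tau>' (z / w1))\<^sup>2"
    if i: "i \<in> bindex L" "proj \<tau> z \<in> bdom L i" for i z
  proof -
    have "h i (proj \<tau> z) * (cmod (\<sigma> i (proj \<tau> z)))\<^sup>2 = (cmod (f z))\<^sup>2 * ((cmod (u i z))\<^sup>2 * h i (proj \<tau> z))"
      by (simp add: \<sigma>[OF i] norm_mult power_mult_distrib)
    also have "(cmod (u i z))\<^sup>2 * h i (proj \<tau> z) = exp (- c * (cmod z)\<^sup>2)"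
      by (rule flat_frameD(3)[OF u i(1) UNIV_I i(2)])
    also have "exp (- c * (cmod z)\<^sup>2) = (exp (- (pi * of_int d / (2 * Im \<tau>)) * (cmod z)\<^sup>2))\<^sup>2"
      by (simp add: c_def exp_double[symmetric])
    also have "(cmod (f z))\<^sup>2 * \<dots> = (theta_norm d s \<beta> \<tau>' (z / w1))\<^sup>2"
      unfolding theta_norm_as_modulus f_def theta_factor_def power_mult_distrib ..
    finally show ?thesis .
  qed
  ultimately show ?thesis using that s by blast
qed

lemma theta_norm_continuous:
  assumes "d > 0"
  shows "continuous_on UNIV (\<lambda>z. theta_norm d s \<beta> \<tau>' (z / w1))"
proof -
  have "continuous_on UNIV (theta d s \<beta> \<tau>')"
    by (rule holomorphic_on_imp_continuous_on[OF theta_holomorphic[OF Im_reduced_pos assms]])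
  then have "continuous_on UNIV (\<lambda>z. theta d s \<beta> \<tau>' (z / w1))"
    by (rule continuous_on_compose2) (auto intro!: continuous_intros simp: w1_nonzero)
  then show ?thesis
    unfolding theta_norm_def using Im_reduced_pos w1_nonzero by (intro continuous_intros) auto
qed

text \<open>
  The norm is bounded by a sum of Gaussians in the coordinate along \<open>w1 * \<tau>'\<close>, an
  integral linear form in the coordinates of the given parallelogram, so
  \<open>nn_integral_periodic_on_square\<close> reduces the integral to one variable.
\<close>

lemma theta_norm_square_integral:
  fixes d :: int and s \<beta> :: real
  assumes d: "d > 0"
  defines "A \<equiv> pi * of_int d * Im \<tau>'"
  shows "(\<integral>\<^sup>+ z\<in>fund_parallelogram \<tau>. ennreal ((theta_norm d s \<beta> \<tau>' (z / w1))\<^sup>2) \<partial>lborel) \<le>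
    ennreal (Im \<tau> * (sqrt (pi / (2 * A)) * ((1 + exp (- A / 2)) / (1 - exp (- A / 2)))))"
proof -
  define W where "W t = (gauss_sum A t)\<^sup>2" for t
  have W_meas [measurable]: "W \<in> borel_measurable borel" unfolding W_def by measurable
  have W_per: "W (of_int k + t) = W t" for k t by (simp add: W_def gauss_sum_plus_int)
  have A: "A > 0" using d Im_reduced_pos by (simp add: A_def)
  have [measurable]: "(\<lambda>z. theta_norm d s \<beta> \<tau>' (z / w1)) \<in> borel_measurable borel"
    by (rule borel_measurable_continuous_onI[OF theta_norm_continuous[OF d]])
  have coord: "Im ((of_real x + of_real v * \<tau>) / w1) / Im \<tau>' = of_int (- q) * x + of_int p * v" for x v
  proof -
    have dd: "of_int p * of_int q' - of_int q * of_int p' = (1 :: complex)"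
      using det by (metis of_int_1 of_int_diff of_int_mult)
    have "w1 * (of_real (of_int q' * x - of_int p' * v) + of_real (of_int (- q) * x + of_int p * v) * \<tau>') =
        of_real (of_int q' * x - of_int p' * v) * w1 + of_real (of_int (- q) * x + of_int p * v) * (w1 * \<tau>')"
      by (simp add: algebra_simps)
    also have "\<dots> = (of_int p * of_int q' - of_int q * of_int p') * (of_real x + of_real v * \<tau>)"
      unfolding w2 by (simp add: w1 algebra_simps)
    finally have "(of_real x + of_real v * \<tau>) / w1 =
        of_real (of_int q' * x - of_int p' * v) + of_real (of_int (- q) * x + of_int p * v) * \<tau>'"
      unfolding dd mult_1 using w1_nonzero by (metis nonzero_mult_div_cancel_left)
    then show ?thesis using Im_reduced_pos by simp
  qed
  have "(\<integral>\<^sup>+ z\<in>fund_parallelogram \<tau>. ennreal ((theta_norm d s \<beta> \<tau>' (z / w1))\<^sup>2) \<partial>lborel) =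
      ennreal (Im \<tau>) * (\<integral>\<^sup>+ v\<in>{0..<1}. (\<integral>\<^sup>+ x\<in>{0..<1}.
        ennreal ((theta_norm d s \<beta> \<tau>' ((of_real x + of_real v * \<tau>) / w1))\<^sup>2) \<partial>lborel) \<partial>lborel)"
    by (rule nn_integral_fund_parallelogram[OF Im_pos]) measurable
  also have "\<dots> \<le> ennreal (Im \<tau>) * (\<integral>\<^sup>+ v\<in>{0..<1}. (\<integral>\<^sup>+ x\<in>{0..<1}. W (of_int (- q) * x + of_int p * v + s) \<partial>lborel) \<partial>lborel)"
  proof (intro mult_left_mono nn_integral_mono mult_right_mono)
    fix v x :: real
    let ?z = "(of_real x + of_real v * \<tau>) / w1"
    have "ennreal ((theta_norm d s \<beta> \<tau>' ?z)\<^sup>2) = (ennreal (theta_norm d s \<beta> \<tau>' ?z))\<^sup>2"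
      by (simp add: ennreal_power theta_norm_nonneg)
    also have "\<dots> \<le> (gauss_sum A (s + Im ?z / Im \<tau>'))\<^sup>2"
      unfolding A_def by (intro power_mono theta_norm_le_gauss_sum Im_reduced_pos d) auto
    finally show "ennreal ((theta_norm d s \<beta> \<tau>' ?z)\<^sup>2) \<le> W (of_int (- q) * x + of_int p * v + s)"
      unfolding W_def coord by (simp only: add.commute)
  qed auto
  also have "\<dots> = ennreal (Im \<tau>) * (\<integral>\<^sup>+ t\<in>{0..<1}. W t \<partial>lborel)"
    by (rule arg_cong[OF nn_integral_periodic_on_square[OF W_meas W_per]]) (use w1_nonzero in \<open>auto simp: w1\<close>)
  also have "\<dots> \<le> ennreal (Im \<tau>) * ennreal (sqrt (pi / (2 * A)) * ((1 + exp (- A / 2)) / (1 - exp (- A / 2))))"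
    unfolding W_def by (intro mult_left_mono gauss_sum_sq_integral_le[OF A]) simp
  finally show ?thesis
    unfolding ennreal_mult'[OF less_imp_le[OF Im_pos]] .
qed

end

section \<open>Twisting by the canonical bundle\<close>

lemma tensor_canonical_simps:
  "bindex (tensor_bundle (canonical_bundle \<tau>) L) = {()} \<times> bindex L"
  "bdom (tensor_bundle (canonical_bundle \<tau>) L) (v, i) = torus \<tau> \<inter> bdom L i"
  "btrans (tensor_bundle (canonical_bundle \<tau>) L) (v, i) (v', j) P = btrans L i j P"
  "tensor_metric (canonical_bundle_metric \<tau>) h (v, i) P = Im \<tau> * h i P"
  by (simp_all add: tensor_bundle_def canonical_bundle_def tensor_metric_def canonical_bundle_metric_def)

lemma continuous_metric_canonical_twist:
  assumes M: "continuous_metric \<tau> L h" and T: "Im \<tau> > 0"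
  shows "continuous_metric \<tau> (tensor_bundle (canonical_bundle \<tau>) L) (tensor_metric (canonical_bundle_metric \<tau>) h)"
proof -
  have sub: "torus \<tau> \<inter> bdom L i = bdom L i" if "i \<in> bindex L" for i
    using M that unfolding continuous_metric_def torus_open_def by blast
  have o: "torus_open \<tau> (bdom L i)" and c: "continuous_on (proj \<tau> -` bdom L i) (\<lambda>z. h i (proj \<tau> z))"
    and p: "P \<in> bdom L i \<Longrightarrow> h i P > 0" if "i \<in> bindex L" for i P
    using M that unfolding continuous_metric_def by blast+
  have cover: "(\<Union>i\<in>bindex L. bdom L i) = torus \<tau>" using M unfolding continuous_metric_def by blast
  have tr: "h j P = (cmod (btrans L i j P))\<^sup>2 * h i P"
    if "i \<in> bindex L" "j \<in> bindex L" "P \<in> bdom L i \<inter> bdom L j" for i j P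
    using M that unfolding continuous_metric_def by blast
  show ?thesis
    unfolding continuous_metric_def tensor_canonical_simps
  proof (intro conjI ballI)
    fix i assume "i \<in> {()} \<times> bindex L"
    then obtain k where i: "i = ((), k)" "k \<in> bindex L" by auto
    show "torus_open \<tau> (bdom (tensor_bundle (canonical_bundle \<tau>) L) i)"
      using o[OF i(2)] by (simp add: i(1) tensor_canonical_simps sub[OF i(2)])
  next
    have "(\<Union>i\<in>{()} \<times> bindex L. bdom (tensor_bundle (canonical_bundle \<tau>) L) i) =
        (\<Union>k\<in>bindex L. torus \<tau> \<inter> bdom L k)"
      by (auto simp: tensor_canonical_simps)
    also have "\<dots> = torus \<tau>" using cover by blast
    finally show "(\<Union>i\<in>{()} \<times> bindex L. bdom (tensor_bundle (canonical_bundle \<tau>) L) i) = torus \<tau>" .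
  next
    fix i assume "i \<in> {()} \<times> bindex L"
    then obtain k where i: "i = ((), k)" "k \<in> bindex L" by auto
    show "continuous_on (proj \<tau> -` bdom (tensor_bundle (canonical_bundle \<tau>) L) i)
        (\<lambda>z. tensor_metric (canonical_bundle_metric \<tau>) h i (proj \<tau> z))"
      unfolding i(1) tensor_canonical_simps sub[OF i(2)] by (intro continuous_intros c[OF i(2)])
    fix P assume "P \<in> bdom (tensor_bundle (canonical_bundle \<tau>) L) i"
    then show "0 < tensor_metric (canonical_bundle_metric \<tau>) h i P"
      using p[OF i(2), of P] T by (simp add: i(1) tensor_canonical_simps)
  next
    fix i j P
    assume "i \<in> {()} \<times> bindex L" "j \<in> {()} \<times> bindex L"
      and P: "P \<in> bdom (tensor_bundle (canonical_bundle \<tau>) L) i \<inter> bdom (tensor_bundle (canonical_bundle \<tau>) L) j"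
    then obtain k l where i: "i = ((), k)" "k \<in> bindex L" and j: "j = ((), l)" "l \<in> bindex L" by auto
    have "h l P = (cmod (btrans L k l P))\<^sup>2 * h k P"
      using P by (intro tr i j) (auto simp: i(1) j(1) tensor_canonical_simps)
    then show "tensor_metric (canonical_bundle_metric \<tau>) h j P =
        (cmod (btrans (tensor_bundle (canonical_bundle \<tau>) L) i j P))\<^sup>2 * tensor_metric (canonical_bundle_metric \<tau>) h i P"
      unfolding i(1) j(1) tensor_canonical_simps by (simp only: mult.left_commute)
  qed
qed

lemma holomorphic_section_canonical_twist:
  assumes s: "holomorphic_section \<tau> L \<sigma>"
  shows "holomorphic_section \<tau> (tensor_bundle (canonical_bundle \<tau>) L) (\<lambda>(v, i). \<sigma> i)"
  unfolding holomorphic_section_def tensor_canonical_simps torus_holomorphic_on_def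
proof (intro conjI ballI)
  fix i assume "i \<in> {()} \<times> bindex L"
  then obtain k where i: "i = ((), k)" "k \<in> bindex L" by auto
  have "(\<lambda>z. \<sigma> k (proj \<tau> z)) holomorphic_on (proj \<tau> -` bdom L k)"
    using s i unfolding holomorphic_section_def torus_holomorphic_on_def by blast
  then show "(\<lambda>z. (case i of (v, i) \<Rightarrow> \<sigma> i) (proj \<tau> z)) holomorphic_on
      (proj \<tau> -` bdom (tensor_bundle (canonical_bundle \<tau>) L) i)"
    unfolding i(1) tensor_canonical_simps prod.case by (rule holomorphic_on_subset) auto
next
  fix i j P
  assume "i \<in> {()} \<times> bindex L" "j \<in> {()} \<times> bindex L"
    and P: "P \<in> bdom (tensor_bundle (canonical_bundle \<tau>) L) i \<inter> bdom (tensor_bundle (canonical_bundle \<tau>) L) j"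
  then obtain k l where i: "i = ((), k)" "k \<in> bindex L" and j: "j = ((), l)" "l \<in> bindex L" by auto
  have "P \<in> bdom L k \<inter> bdom L l" using P by (auto simp: i(1) j(1) tensor_canonical_simps)
  then show "(case i of (v, i) \<Rightarrow> \<sigma> i) P =
      btrans (tensor_bundle (canonical_bundle \<tau>) L) i j P * (case j of (v, i) \<Rightarrow> \<sigma> i) P"
    using s i(2) j(2) unfolding i(1) j(1) tensor_canonical_simps prod.case holomorphic_section_def by blast
qed

text \<open>
  The area form has total mass \<open>1\<close>.
\<close>

lemma curvature_is_degree:
  assumes T: "Im \<tau> > 0" and d: "has_degree \<tau> L d" and H: "hermitian_metric \<tau> L h"
    and curv: "\<forall>P\<in>torus \<tau>. c1_density \<tau> L h P = b"
  shows "b = of_int d"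
proof -
  have "torus_integral \<tau> (c1_density \<tau> L h) = of_int d" using d H unfolding has_degree_def by blast
  moreover have "torus_integral \<tau> (c1_density \<tau> L h) = torus_integral \<tau> (\<lambda>_. b)"
    using curv proj_in_torus by (simp add: torus_integral_def)
  ultimately show ?thesis using torus_integral_const[OF T, of b] by simp
qed

context reduced_basis
begin

text \<open>
  The theta section centred near \<open>p0\<close> is inserted into the extremal property. The metric \<open>Im \<tau>\<close> of the
  canonical bundle multiplies the value and the squared norm alike and cancels.
\<close>

theorem bergman_kernel_lower_bound:
  fixes L :: "'i line_bundle" and d :: int and h :: "'i \<Rightarrow> complex set \<Rightarrow> real"
  assumes L: "holomorphic_line_bundle \<tau> L" and H: "hermitian_metric \<tau> L h"
    and curv: "\<forall>P\<in>torus \<tau>. c1_density \<tau> L h P = of_int d" and d: "d \<ge> 2"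
    and \<kappa>: "is_bergman_kernel \<tau> (tensor_bundle (canonical_bundle \<tau>) L)
           (tensor_metric (canonical_bundle_metric \<tau>) h) \<kappa>"
  defines "A \<equiv> pi * of_int d * Im \<tau>'"
    and "Y \<equiv> exp (- pi * Im \<tau>' * (of_int d - 1))"
  obtains \<delta> M where "\<bar>\<delta>\<bar> \<le> 1 / (2 * of_int d)"
    "M \<ge> exp (- A * \<delta>\<^sup>2) * (1 - 2 * Y / (1 - Y))"
    "M\<^sup>2 \<le> kernel_norm (tensor_bundle (canonical_bundle \<tau>) L)
        (tensor_metric (canonical_bundle_metric \<tau>) h) \<kappa> (proj \<tau> p0) *
       (sqrt (pi / (2 * A)) * ((1 + exp (- A / 2)) / (1 - exp (- A / 2))))"
proof -
  let ?KL = "tensor_bundle (canonical_bundle \<tau>) L" and ?Kh = "tensor_metric (canonical_bundle_metric \<tau>) h"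
  define I where "I = sqrt (pi / (2 * A)) * ((1 + exp (- A / 2)) / (1 - exp (- A / 2)))"
  have d0: "d > 0" using d by simp
  have A: "A > 0" using d0 Im_reduced_pos by (simp add: A_def)
  have I0: "I \<ge> 0" using A by (simp add: I_def)
  obtain \<sigma> s \<beta> where \<sigma>: "holomorphic_section \<tau> L \<sigma>"
    and nrm: "\<And>i z. i \<in> bindex L \<Longrightarrow> proj \<tau> z \<in> bdom L i \<Longrightarrow>
       h i (proj \<tau> z) * (cmod (\<sigma> i (proj \<tau> z)))\<^sup>2 = (theta_norm d s \<beta> \<tau>' (z / w1))\<^sup>2"
    and s: "\<bar>s + Im (p0 / w1) / Im \<tau>'\<bar> \<le> 1 / (2 * of_int d)"
    using theta_section_exists[OF L H curv d0] by metis
  note M = hermitian_imp_continuous_metric[OF L H]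
  note KM = continuous_metric_canonical_twist[OF M Im_pos]
  define \<sigma>' where "\<sigma>' = (\<lambda>(v :: unit, i). \<sigma> i)"
  have \<sigma>': "holomorphic_section \<tau> ?KL \<sigma>'"
    unfolding \<sigma>'_def by (rule holomorphic_section_canonical_twist[OF \<sigma>])
  have nrm': "?Kh i (proj \<tau> z) * (cmod (\<sigma>' i (proj \<tau> z)))\<^sup>2 = Im \<tau> * (theta_norm d s \<beta> \<tau>' (z / w1))\<^sup>2"
    if i: "i \<in> bindex ?KL" "proj \<tau> z \<in> bdom ?KL i" for i z
  proof -
    obtain k where k: "i = ((), k)" "k \<in> bindex L" "proj \<tau> z \<in> bdom L k"
      using i by (auto simp: tensor_canonical_simps)
    show ?thesis unfolding k(1) tensor_canonical_simps \<sigma>'_def prod.case mult.assoc nrm[OF k(2,3)] ..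
  qed
  have inner: "Re (section_inner \<tau> ?KL ?Kh \<sigma>' \<sigma>') \<le> Im \<tau> * I"
    unfolding section_inner_def
  proof (rule torus_integral_nonneg_le[OF Im_pos, where f = "\<lambda>z. Im \<tau> * (theta_norm d s \<beta> \<tau>' (z / w1))\<^sup>2"])
    fix z
    define i where "i = frame_at ?KL (proj \<tau> z)"
    note i = frame_at[OF KM proj_in_torus[of \<tau> z], folded i_def]
    have "of_real (?Kh i (proj \<tau> z)) * \<sigma>' i (proj \<tau> z) * cnj (\<sigma>' i (proj \<tau> z)) =
        complex_of_real (?Kh i (proj \<tau> z) * (cmod (\<sigma>' i (proj \<tau> z)))\<^sup>2)"
      by (simp only: of_real_mult complex_norm_square mult.assoc)
    then show "(let i = frame_at ?KL (proj \<tau> z) in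
        of_real (?Kh i (proj \<tau> z)) * \<sigma>' i (proj \<tau> z) * cnj (\<sigma>' i (proj \<tau> z))) =
        complex_of_real (Im \<tau> * (theta_norm d s \<beta> \<tau>' (z / w1))\<^sup>2)"
      unfolding Let_def i_def[symmetric] nrm'[OF i] .
    show "0 \<le> Im \<tau> * (theta_norm d s \<beta> \<tau>' (z / w1))\<^sup>2" using Im_pos by simp
  next
    note cont = theta_norm_continuous[OF d0, of s \<beta>]
    show "continuous_on UNIV (\<lambda>z. Im \<tau> * (theta_norm d s \<beta> \<tau>' (z / w1))\<^sup>2)"
      by (intro continuous_intros cont)
    have [measurable]: "(\<lambda>z. (theta_norm d s \<beta> \<tau>' (z / w1))\<^sup>2) \<in> borel_measurable borel"
      by (intro borel_measurable_continuous_onI continuous_intros cont)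
    note [measurable] = fund_parallelogram_measurable[OF Im_pos]
    have "(\<integral>\<^sup>+ z\<in>fund_parallelogram \<tau>. ennreal (Im \<tau> * (theta_norm d s \<beta> \<tau>' (z / w1))\<^sup>2) \<partial>lborel) =
        (\<integral>\<^sup>+ z. ennreal (Im \<tau>) * (ennreal ((theta_norm d s \<beta> \<tau>' (z / w1))\<^sup>2) * indicator (fund_parallelogram \<tau>) z) \<partial>lborel)"
      unfolding ennreal_mult'[OF less_imp_le[OF Im_pos]] by (simp only: mult.assoc)
    also have "\<dots> = ennreal (Im \<tau>) * (\<integral>\<^sup>+ z\<in>fund_parallelogram \<tau>. ennreal ((theta_norm d s \<beta> \<tau>' (z / w1))\<^sup>2) \<partial>lborel)"
      by (rule nn_integral_cmult) measurable
    also have "\<dots> \<le> ennreal (Im \<tau>) * ennreal (Im \<tau> * I)"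
      unfolding I_def A_def by (intro mult_left_mono theta_norm_square_integral d0) simp
    finally show "(\<integral>\<^sup>+ z\<in>fund_parallelogram \<tau>. ennreal (Im \<tau> * (theta_norm d s \<beta> \<tau>' (z / w1))\<^sup>2) \<partial>lborel) \<le>
        ennreal (Im \<tau> * (Im \<tau> * I))"
      unfolding ennreal_mult'[OF less_imp_le[OF Im_pos], of "Im \<tau> * I"] .
  qed (use Im_pos I0 in simp)
  define i where "i = frame_at ?KL (proj \<tau> p0)"
  note i = frame_at[OF KM proj_in_torus[of \<tau> p0], folded i_def]
  let ?K = "kernel_norm ?KL ?Kh \<kappa> (proj \<tau> p0)"
  have K0: "?K \<ge> 0"
  proof -
    have "?Kh i (proj \<tau> p0) > 0" using KM i unfolding continuous_metric_def by blast
    then show ?thesis by (simp add: kernel_norm_def Let_def i_def[symmetric])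
  qed
  have "Im \<tau> * (theta_norm d s \<beta> \<tau>' (p0 / w1))\<^sup>2 \<le> ?K * Re (section_inner \<tau> ?KL ?Kh \<sigma>' \<sigma>')"
    using bergman_kernel_extremal[OF Im_pos KM \<kappa> \<sigma>' proj_in_torus i] unfolding nrm'[OF i] .
  also have "\<dots> \<le> ?K * (Im \<tau> * I)" using inner K0 by (rule mult_left_mono)
  also have "\<dots> = Im \<tau> * (?K * I)" by (simp only: mult.left_commute)
  finally have "(theta_norm d s \<beta> \<tau>' (p0 / w1))\<^sup>2 \<le> ?K * I" using Im_pos by simp
  moreover have "theta_norm d s \<beta> \<tau>' (p0 / w1) \<ge>
      exp (- A * (s + Im (p0 / w1) / Im \<tau>')\<^sup>2) * (1 - 2 * Y / (1 - Y))"
    using theta_norm_lower_bound[OF Im_reduced_pos d s, of \<beta>] by (simp add: A_def Y_def)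
  ultimately show ?thesis using that[of "s + Im (p0 / w1) / Im \<tau>'"] s unfolding I_def by blast
qed

end

section \<open>The inequality between capacity and Bergman kernel\<close>

theorem theorem1p11:
  fixes \<tau> :: complex
    and L :: "'i line_bundle"
    and d :: int
    and h\<^sub>L :: "'i \<Rightarrow> complex set \<Rightarrow> real"
    and b :: real
    and \<kappa> :: "unit \<times> 'i \<Rightarrow> unit \<times> 'i \<Rightarrow> complex set \<Rightarrow> complex set \<Rightarrow> complex"
    and G :: "complex set \<Rightarrow> complex set \<Rightarrow> ereal"
    and c\<^sub>X :: "complex set \<Rightarrow> real"
  assumes "Im \<tau> > 0"
    and "holomorphic_line_bundle \<tau> L"
    and "positive_line_bundle \<tau> L"
    and "has_degree \<tau> L d"
    and "d > 2"
    and "hermitian_metric \<tau> L h\<^sub>L"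
    and "b > 0"
    and "\<forall>P\<in>torus \<tau>. c1_density \<tau> L h\<^sub>L P = b"
    and "is_bergman_kernel \<tau> (tensor_bundle (canonical_bundle \<tau>) L)
           (tensor_metric (canonical_bundle_metric \<tau>) h\<^sub>L) \<kappa>"
    and "green_function \<tau> G"
    and "is_log_capacity \<tau> G c\<^sub>X"
  shows "\<forall>P\<in>torus \<tau>.
    pi * (1 + 1 / (real_of_int d / 2 - 1)) *
      kernel_norm (tensor_bundle (canonical_bundle \<tau>) L)
        (tensor_metric (canonical_bundle_metric \<tau>) h\<^sub>L) \<kappa> P
    \<ge> (c\<^sub>X P)\<^sup>2"
proof
  fix P assume "P \<in> torus \<tau>"
  then obtain z where P: "P = proj \<tau> z" unfolding torus_def by blast
  have curv: "\<forall>P\<in>torus \<tau>. c1_density \<tau> L h\<^sub>L P = of_int d"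
    using curvature_is_degree[OF assms(1,4,6,8)] assms(8) by simp
  obtain w1 \<tau>' p q p' q' where "reduced_basis \<tau> w1 \<tau>' p q p' q'"
    using reduced_basis_exists[OF assms(1)] by blast
  then interpret reduced_basis \<tau> w1 \<tau>' p q p' q' .
  define r where "r = exp (- 2 * pi * Im \<tau>')"
  have r: "r \<le> 1 / 200"
  proof -
    have "exp (2 * pi * Im \<tau>') \<ge> 200"
      using pi_T_bounds(2)[OF Im_reduced] by (intro exp_lower_numerals(2)) simp
    then show ?thesis unfolding r_def using exp_minus_le[of 200 "2 * pi * Im \<tau>'"] by simp
  qed
  have r0: "r > 0" by (simp add: r_def)
  obtain D where D: "(odd_theta \<tau>' has_field_derivative D) (at 0)"
    "cmod D \<le> 2 * pi * exp (- pi * Im \<tau>' / 4) / (1 - 3 * r)"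
    using odd_theta_deriv_bound[OF Im_reduced_pos] r unfolding r_def by auto
  define z0 where "z0 = w1 * ((1 + \<tau>') / 2)"
  have N: "torus_theta_norm z0 \<ge> 1 - 2 * r\<^sup>2 / (1 - r)"
    using odd_theta_half_period_bound[OF Im_reduced_pos Re_reduced] w1_nonzero
    by (simp add: torus_theta_norm_def z0_def r_def)
  have "2 * r\<^sup>2 / (1 - r) < 1"
  proof -
    have "r * r \<le> (1 / 200) * (1 / 200)" using r r0 by (intro mult_mono) auto
    then show ?thesis using r r0 by (simp add: power2_eq_square field_simps)
  qed
  then have N0: "torus_theta_norm z0 > 0" using N by linarith
  obtain \<delta> M where K: "\<bar>\<delta>\<bar> \<le> 1 / (2 * of_int d)"
    "M \<ge> exp (- (pi * of_int d * Im \<tau>') * \<delta>\<^sup>2) *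
      (1 - 2 * exp (- pi * Im \<tau>' * (of_int d - 1)) / (1 - exp (- pi * Im \<tau>' * (of_int d - 1))))"
    "M\<^sup>2 \<le> kernel_norm (tensor_bundle (canonical_bundle \<tau>) L)
        (tensor_metric (canonical_bundle_metric \<tau>) h\<^sub>L) \<kappa> (proj \<tau> z) *
       (sqrt (pi / (2 * (pi * of_int d * Im \<tau>'))) *
        ((1 + exp (- (pi * of_int d * Im \<tau>') / 2)) / (1 - exp (- (pi * of_int d * Im \<tau>') / 2))))"
    using bergman_kernel_lower_bound[OF assms(2,6) curv _ assms(9), of z] assms(5) by auto
  show "(c\<^sub>X P)\<^sup>2 \<le> pi * (1 + 1 / (real_of_int d / 2 - 1)) *
      kernel_norm (tensor_bundle (canonical_bundle \<tau>) L)
        (tensor_metric (canonical_bundle_metric \<tau>) h\<^sub>L) \<kappa> P"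
    unfolding P
    by (rule capacity_versus_kernel_numerics[OF Im_reduced _ r_def refl refl K(1) _ refl K(3)
          log_capacity_bound[OF assms(10,11) D(1) N0] norm_ge_zero D(2) N])
       (use assms(5) K(2) in simp_all)
qed

end
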